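(* Let $1<p\le\infty$ and let $\Omega\subset\mathbb{R}^N$ be a domain of class $C^2$ with boundary $\Gamma$. Let $x\in\Omega$ and assume that, for $R>0$, there exists $y_x\in\Gamma$ such that $\overline{B_R(x)}\cap(\mathbb{R}^N\setminus\Omega)=\{y_x\}$ and that $\kappa_j(y_x)<1/R$ for $j=1,\dots,N-1$. If $u$ is the bounded viscosity solution of $u_t=\Delta_p^Gu$ in $\Omega\times(0,\infty)$, $u=0$ on $\Omega\times\{0\}$, $u=1$ on $\Gamma\times(0,\infty)$, then $$\lim_{t\to0^+}t^{-\frac{N+1}4}\int_{B_R(x)}u(z,t)\,dz=\frac{c_N}{(p')^{\frac{N+1}4}}\,\frac{R^{\frac{N-1}2}}{\sqrt{\Pi_\Gamma(y_x)}},\qquad c_N=\frac{2^{\frac{N+3}2}\pi^{\frac{N-1}2}}{(N+1)\,\Gamma\!\left(\frac{N+1}4\right)},$$ where $\Gamma(\cdot)$ in the formula for $c_N$ is Euler's gamma function.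
   Context: $N\ge2$; $\Omega$ is not necessarily bounded. $p'=p/(p-1)$, with $p'=1$ if $p=\infty$. $B_R(x)$ is the open ball of radius $R$ centered at $x$. $\kappa_1(y),\dots,\kappa_{N-1}(y)$ are the principal curvatures of $\Gamma$ at $y\in\Gamma$ with respect to the interior normal direction to $\Gamma$, and $\Pi_\Gamma(y)=\prod_{j=1}^{N-1}[1-R\,\kappa_j(y)]$. The game-theoretic (normalized) $p$-Laplacian is $\Delta_p^Gu=\frac1p\Big\{\Delta u+(p-2)\frac{\langle\nabla^2u\,\nabla u,\nabla u\rangle}{|\nabla u|^2}\Big\}$, and $\Delta_\infty^G$ is its limit as $p\to\infty$, i.e. $\Delta_\infty^Gu=\frac{\langle\nabla^2u\,\nabla u,\nabla u\rangle}{|\nabla u|^2}$. Put $F(\xi,X)=\frac1p\mathrm{tr}X+(1-\frac2p)\frac{\langle X\xi,\xi\rangle}{|\xi|^2}$ for $\xi\in\mathbb{R}^N\setminus\{0\}$ and $X$ real symmetric $N\times N$ (with $1/p=0$ if $p=\infty$), $F_*(\xi,X)=\lim_{r\to0^+}\inf\{F(\eta,Y):\eta\ne0,|\eta-\xi|<r,|Y-X|<r\}$ and $F^*=-(-F)_*$. A function $u\in C(\Omega\times(0,\infty))$ is a viscosity solution of $u_t=\Delta_p^Gu$ if at every $(x,t)\in\Omega\times(0,\infty)$: for every $\varphi\in C^2(\Omega\times(0,\infty))$ such that $u-\varphi$ attains its maximum at $(x,t)$, $\varphi_t-F^*(\nabla\varphi,\nabla^2\varphi)\le0$ at $(x,t)$;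 and for every $\varphi\in C^2(\Omega\times(0,\infty))$ such that $u-\varphi$ attains its minimum at $(x,t)$, $\varphi_t-F_*(\nabla\varphi,\nabla^2\varphi)\ge0$ at $(x,t)$. The initial and boundary conditions are meant classically: $u$ is continuous on $\overline\Omega\times[0,\infty)$ away from $\Gamma\times\{0\}$. *)

theory Defs
  imports "HOL-Analysis.Analysis"
begin

definition gradient :: "('a::real_inner \<Rightarrow> real) \<Rightarrow> 'a \<Rightarrow> 'a" where
  "gradient f x = (THE D. GDERIV f x :> D)"

definition hessian :: "(real^'n \<Rightarrow> real) \<Rightarrow> real^'n \<Rightarrow> real^'n^'n" where
  "hessian f x = jacobian (gradient f) (at x)"

text \<open>Continuous differentiability of order two, for open \<open>S\<close>; \<open>G\<close> is the gradient of \<open>f\<close> and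
  \<open>H\<close> its derivative, continuous in operator norm. It is also used on space-time,
  \<open>'a = (real^'n) \<times> real\<close>.\<close>

definition C2_on :: "'a::euclidean_space set \<Rightarrow> ('a \<Rightarrow> real) \<Rightarrow> bool" where
  "C2_on S f \<longleftrightarrow> (\<exists>(G :: 'a \<Rightarrow> 'a) (H :: 'a \<Rightarrow> 'a \<Rightarrow>\<^sub>L 'a).
     (\<forall>x\<in>S. GDERIV f x :> G x) \<and>
     (\<forall>x\<in>S. (G has_derivative blinfun_apply (H x)) (at x)) \<and>
     continuous_on S H)"

text \<open>Near \<open>y\<close>, in Cartesian coordinates whose last axis points along the unit vector \<open>n\<close>, the set
  \<open>\<Omega>\<close> is the part of space strictly above the graph of a twice continuously differentiable function
  of the other \<open>N - 1\<close> coordinates. Such a function is encoded as a function \<open>g\<close> on the whole space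
  which is constant along \<open>n\<close>.\<close>

definition C2_graph_near ::
  "(real^'n) set \<Rightarrow> real^'n \<Rightarrow> real^'n \<Rightarrow> (real^'n \<Rightarrow> real) \<Rightarrow> bool" where
  "C2_graph_near \<Omega> y n g \<longleftrightarrow>
     norm n = 1 \<and> C2_on UNIV g \<and> (\<forall>z s. g (z + s *\<^sub>R n) = g z) \<and>
     (\<exists>r>0. \<Omega> \<inter> ball y r = {z \<in> ball y r. z \<bullet> n > g z})"

definition C2_domain :: "(real^'n) set \<Rightarrow> bool" where
  "C2_domain \<Omega> \<longleftrightarrow> open \<Omega> \<and> connected \<Omega> \<and> \<Omega> \<noteq> {} \<and>
     (\<forall>y\<in>frontier \<Omega>. \<exists>n g. C2_graph_near \<Omega> y n g)"

text \<open>\<open>\<kappa> 1, \<dots>, \<kappa> (N - 1)\<close> enumerate, with multiplicity, the principal curvatures of the boundary of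
  \<open>\<Omega>\<close> at \<open>y\<close> with respect to the interior normal: if the gradient of \<open>g\<close> vanishes at \<open>y\<close>, then
  \<open>n\<close> is the interior unit normal at \<open>y\<close> and the Hessian of \<open>g\<close> at \<open>y\<close>, restricted to the tangent
  space orthogonal to \<open>n\<close>, is the shape operator; the \<open>e j\<close> are the principal directions. With this
  sign a ball of radius \<open>\<rho>\<close> has principal curvatures \<open>1 / \<rho>\<close>.\<close>

definition principal_curvatures :: "(real^'n) set \<Rightarrow> real^'n \<Rightarrow> (nat \<Rightarrow> real) \<Rightarrow> bool" where
  "principal_curvatures \<Omega> y \<kappa> \<longleftrightarrow>
     (\<exists>n g e. C2_graph_near \<Omega> y n g \<and> gradient g y = 0 \<and>
        (\<forall>i\<in>{1..CARD('n) - 1}. \<forall>j\<in>{1..CARD('n) - 1}. e i \<bullet> e j = (if i = j then 1 else 0)) \<and>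
        (\<forall>j\<in>{1..CARD('n) - 1}. e j \<bullet> n = 0 \<and> hessian g y *v e j = \<kappa> j *\<^sub>R e j))"

text \<open>The exponent ranges over the extended reals; \<open>inverse \<infinity> = 0\<close> there, so \<open>1/p = 0\<close> for
  \<open>p = \<infinity>\<close>.\<close>

definition game_F :: "ereal \<Rightarrow> real^'n \<Rightarrow> real^'n^'n \<Rightarrow> real" where
  "game_F p \<xi> X = real_of_ereal (inverse p) * trace X
     + (1 - 2 * real_of_ereal (inverse p)) * ((X *v \<xi>) \<bullet> \<xi>) / (norm \<xi>)\<^sup>2"

definition conj_exponent :: "ereal \<Rightarrow> real" where
  "conj_exponent p = (if p = \<infinity> then 1 else real_of_ereal p / (real_of_ereal p - 1))"

text \<open>The infimum and the limit are taken in the reals; both exist for \<open>\<plusminus> game_F p\<close>, which is bounded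
  for bounded \<open>Y\<close>.\<close>

definition lower_envelope ::
  "(real^'n \<Rightarrow> real^'n^'n \<Rightarrow> real) \<Rightarrow> real^'n \<Rightarrow> real^'n^'n \<Rightarrow> real" where
  "lower_envelope F \<xi> X =
     Lim (at_right 0) (\<lambda>r::real. Inf {F \<eta> Y |\<eta> Y.
       \<eta> \<noteq> 0 \<and> transpose Y = Y \<and> norm (\<eta> - \<xi>) < r \<and> norm (Y - X) < r})"

definition upper_envelope ::
  "(real^'n \<Rightarrow> real^'n^'n \<Rightarrow> real) \<Rightarrow> real^'n \<Rightarrow> real^'n^'n \<Rightarrow> real" where
  "upper_envelope F \<xi> X = - lower_envelope (\<lambda>\<eta> Y. - F \<eta> Y) \<xi> X"

definition viscosity_solution ::
  "ereal \<Rightarrow> (real^'n) set \<Rightarrow> ((real^'n) \<times> real \<Rightarrow> real) \<Rightarrow> bool" where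
  "viscosity_solution p \<Omega> u \<longleftrightarrow>
     continuous_on (\<Omega> \<times> {0<..}) u \<and>
     (\<forall>x\<in>\<Omega>. \<forall>t>0. \<forall>\<phi>. C2_on (\<Omega> \<times> {0<..}) \<phi> \<longrightarrow>
        ((\<forall>w\<in>\<Omega> \<times> {0<..}. u w - \<phi> w \<le> u (x, t) - \<phi> (x, t)) \<longrightarrow>
           deriv (\<lambda>s. \<phi> (x, s)) t
           - upper_envelope (game_F p) (gradient (\<lambda>z. \<phi> (z, t)) x) (hessian (\<lambda>z. \<phi> (z, t)) x) \<le> 0) \<and>
        ((\<forall>w\<in>\<Omega> \<times> {0<..}. u w - \<phi> w \<ge> u (x, t) - \<phi> (x, t)) \<longrightarrow>
           deriv (\<lambda>s. \<phi> (x, s)) t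
           - lower_envelope (game_F p) (gradient (\<lambda>z. \<phi> (z, t)) x) (hessian (\<lambda>z. \<phi> (z, t)) x) \<ge> 0))"

text \<open>Bounded solution with initial value 0 and boundary value 1, both attained continuously except at
  the corner \<open>frontier \<Omega> \<times> {0}\<close>, where no condition is imposed.\<close>

definition bounded_solution ::
  "ereal \<Rightarrow> (real^'n) set \<Rightarrow> ((real^'n) \<times> real \<Rightarrow> real) \<Rightarrow> bool" where
  "bounded_solution p \<Omega> u \<longleftrightarrow>
     viscosity_solution p \<Omega> u \<and> bounded (u ` (\<Omega> \<times> {0<..})) \<and>
     continuous_on (closure \<Omega> \<times> {0..} - frontier \<Omega> \<times> {0}) u \<and>
     (\<forall>z\<in>\<Omega>. u (z, 0) = 0) \<and>
     (\<forall>z\<in>frontier \<Omega>. \<forall>t>0. u (z, t) = 1)"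

definition c_const :: "nat \<Rightarrow> real" where
  "c_const N = 2 powr ((real N + 3) / 2) * pi powr ((real N - 1) / 2)
     / ((real N + 1) * Gamma ((real N + 1) / 4))"

end

theory Submission
  imports Defs
begin

text \<open>The proof reduces the nonlinear equation to explicit heat kernels in one variable. If \<open>\<psi>\<close> is twice
differentiable, then \<open>F\<close> at \<open>w = f(\<psi>(z), t)\<close> equals \<open>f'' |\<nabla>\<psi>|\<^sup>2 / p'\<close> plus \<open>f'\<close> times a quantity
bounded by the second derivatives of \<open>\<psi>\<close>; all directions other than the gradient enter through the
bounded term only. Take for \<open>\<psi>\<close> the height \<open>z \<bullet> n - g(z)\<close> above the graph that describes the
boundary, so that \<open>|\<nabla>\<psi>|\<close> is close to 1 near the contact point \<open>y\<close>. Then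
\<open>1 - Erf(a (\<psi> \<mp> C t) / \<surd>t)\<close> is a supersolution (upper sign, \<open>4 a\<^sup>2 |\<nabla>\<psi>|\<^sup>2 \<le> p'\<close>) or a subsolution
(lower sign, \<open>4 a\<^sup>2 |\<nabla>\<psi>|\<^sup>2 \<ge> p'\<close>), the drift \<open>C t\<close> absorbing the bounded term. Both bounds meet at
\<open>a = \<surd>p' / 2\<close>, so the solution is asymptotically \<open>1 - Erf(\<surd>p' \<psi> / (2 \<surd>t))\<close> near \<open>y\<close>.\<close>

text \<open>Three points make this rigorous. First, the definition of a viscosity solution tests with functions
on all of space-time, while the barriers are local; since the solution is bounded, a quartic
polynomial makes every local quadratic majorant global (\<open>quad_test_dominates\<close>), and a comparison
principle against profiles \<open>f(\<psi>, t)\<close> follows (\<open>comparison_with_profile\<close>). Second, the barriers are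
localized by tilting: to bound the solution at \<open>z0\<close> one uses \<open>\<psi>(z) \<mp> |z - z0|\<^sup>2\<close> in place of \<open>\<psi>\<close>,
which changes nothing at \<open>z0\<close> and dominates on a sphere around \<open>y\<close>, apart from points inside the
domain where the solution is exponentially small (\<open>interior_decay\<close>, \<open>decreasing_barrier\<close>,
\<open>increasing_barrier\<close>). Third, nothing is prescribed on the corner, the boundary at time 0. If a
bounded subsolution is at most \<open>A\<close> near a corner point and at most 0 on the rest of the parabolic
boundary, then the decreasing barrier improves \<open>A\<close> at heights above \<open>\<surd>t\<close> and the increasing one below
\<open>\<surd>t\<close>, by a factor smaller than 1 that depends on the chart only (\<open>corner_improvement\<close>). Iteration
shows that the corner is harmless, so \<open>0 \<le> u \<le> 1\<close>, and the two barriers give the sharp bounds of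
\<open>solution_sandwich\<close>.\<close>

text \<open>It remains to integrate. With \<open>1 - Erf x\<close> written as a Gaussian tail, the integral over the ball
becomes a Gaussian average of \<open>V(s)\<close>, the volume of the part of the ball near \<open>y\<close> where \<open>\<psi> \<le> s\<close>
(\<open>Erf_layer_cake\<close>). Scaling lengths by \<open>s\<close> along the normal and by \<open>\<surd>(2 s / (1/R - \<kappa> j))\<close> along the
principal directions turns this part, as \<open>s\<close> tends to 0, into a region between two paraboloids, which a
shear carries to \<open>|w|\<^sup>2 \<le> h \<le> 1\<close>; hence \<open>V(s)\<close> is asymptotic to a multiple of \<open>s\<close> to the power
\<open>(N + 1) / 2\<close> (\<open>boundary_cap_volume\<close>). Since \<open>s\<close> is of order \<open>\<surd>t\<close>, this produces the exponent
\<open>(N + 1) / 4\<close>. The duplication formula for the Gamma function brings the constant into the stated form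
(\<open>limit_constant\<close>).\<close>

section \<open>The operator on matrices of rank one plus scalar\<close>

definition recip :: "ereal \<Rightarrow> real" where "recip p = real_of_ereal (inverse p)"

text \<open>Identifies the limit \<open>r \<rightarrow> 0\<close> in the definition of the envelopes: the infima over shrinking
neighbourhoods increase as \<open>r\<close> decreases.\<close>

lemma antitone_tendsto_at_right_0:
  fixes I :: "real \<Rightarrow> real"
  assumes r0: "0 < r0"
    and mono: "\<And>r s. 0 < r \<Longrightarrow> r \<le> s \<Longrightarrow> s < r0 \<Longrightarrow> I s \<le> I r"
    and bd: "\<And>r. 0 < r \<Longrightarrow> r < r0 \<Longrightarrow> I r \<le> C"
  shows "(I \<longlongrightarrow> Sup (I ` {0<..<r0})) (at_right 0)"
proof -
  have bdd: "bdd_above (I ` {0<..<r0})" using bd by (intro bdd_aboveI[of _ C]) auto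
  have ne: "I ` {0<..<r0} \<noteq> {}" using r0 by auto
  show ?thesis
  proof (rule order_tendstoI)
    fix a assume "a < Sup (I ` {0<..<r0})"
    then obtain s where s: "0 < s" "s < r0" "a < I s"
      using less_cSup_iff[OF ne bdd] by auto
    show "eventually (\<lambda>r. a < I r) (at_right 0)"
      unfolding eventually_at_right_field using s mono by (intro exI[of _ s]) (auto intro: less_le_trans)
  next
    fix a assume "Sup (I ` {0<..<r0}) < a"
    moreover have "I r \<le> Sup (I ` {0<..<r0})" if "0 < r" "r < r0" for r
      using that by (intro cSup_upper bdd) auto
    ultimately show "eventually (\<lambda>r. I r < a) (at_right 0)"
      unfolding eventually_at_right_field using r0 by (intro exI[of _ r0]) (auto intro: le_less_trans)
  qed
qed

text \<open>The envelope is built from \<open>THE\<close>-style limits and conditionally complete infima, which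
are meaningful because the lower bound on \<open>F\<close> bounds the monotone family from above.\<close>

lemma upper_envelope_le:
  fixes F :: "real^'n \<Rightarrow> real^'n^'n \<Rightarrow> real"
  assumes sym: "transpose X = X"
    and below: "\<And>\<eta> Y. \<eta> \<noteq> 0 \<Longrightarrow> transpose Y = Y \<Longrightarrow> norm (Y - X) < 1 \<Longrightarrow> - C \<le> F \<eta> Y"
    and above: "\<And>\<epsilon>. 0 < \<epsilon> \<Longrightarrow> \<exists>r>0. \<forall>\<eta> Y. \<eta> \<noteq> 0 \<longrightarrow> transpose Y = Y \<longrightarrow> norm (\<eta> - \<xi>) < r \<longrightarrow>
                  norm (Y - X) < r \<longrightarrow> F \<eta> Y \<le> B + \<epsilon>"
  shows "upper_envelope F \<xi> X \<le> B"
proof -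
  define S where "S r = {- F \<eta> Y |\<eta> Y. \<eta> \<noteq> 0 \<and> transpose Y = Y \<and> norm (\<eta> - \<xi>) < r \<and> norm (Y - X) < r}" for r
  define I where "I r = Inf (S r)" for r
  have mem: "\<exists>\<eta>. \<eta> \<noteq> 0 \<and> norm (\<eta> - \<xi>) < r" if "0 < r" for r
  proof (cases "\<xi> = 0")
    case True
    obtain \<eta> :: "real^'n" where "norm \<eta> = r / 2" 
      by (rule vector_choose_size[of "r/2"]) (use \<open>0 < r\<close> in auto)
    then show ?thesis using that True by (intro exI[of _ \<eta>]) auto
  qed (use that in auto)
  have ne: "S r \<noteq> {}" if "0 < r" for r
    using mem[OF that] sym that unfolding S_def by force
  obtain r1 where r1: "0 < r1" "\<And>\<eta> Y. \<eta> \<noteq> 0 \<Longrightarrow> transpose Y = Y \<Longrightarrow> norm (\<eta> - \<xi>) < r1 \<Longrightarrow>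
                  norm (Y - X) < r1 \<Longrightarrow> F \<eta> Y \<le> B + 1"
    using above[of 1] by auto
  define r0 where "r0 = min 1 r1"
  have r0: "0 < r0" using r1 by (simp add: r0_def)
  have lowS: "- B - 1 \<le> x" if "x \<in> S r" "r \<le> r0" for x r
    using that r1(2) unfolding S_def r0_def by force
  have bdd: "bdd_below (S r)" if "r \<le> r0" for r
    using lowS that by (intro bdd_belowI[of _ "- B - 1"]) auto
  have upS: "x \<le> C" if xS: "x \<in> S r" and rr: "r \<le> r0" for x r
  proof -
    obtain \<eta> Y where h: "x = - F \<eta> Y" "\<eta> \<noteq> 0" "transpose Y = Y" "norm (Y - X) < r"
      using xS unfolding S_def by blast
    with rr have "norm (Y - X) < 1" by (simp add: r0_def)
    from below[OF h(2,3) this] h(1) show ?thesis by simp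
  qed
  have mono: "I s \<le> I r" if "0 < r" "r \<le> s" "s < r0" for r s
    unfolding I_def
  proof (rule cInf_superset_mono)
    show "S r \<subseteq> S s" unfolding S_def using that(2) by (force intro: less_le_trans)
  qed (use ne bdd that in auto)
  have upI: "I r \<le> C" if r: "0 < r" "r < r0" for r
  proof -
    obtain x where "x \<in> S r" using ne[OF r(1)] by blast
    then show ?thesis using upS[of x r] cInf_lower[OF _ bdd] r unfolding I_def by fastforce
  qed
  have lim: "(I \<longlongrightarrow> Sup (I ` {0<..<r0})) (at_right 0)"
    by (rule antitone_tendsto_at_right_0[OF r0 mono upI])
  have eq: "upper_envelope F \<xi> X = - Lim (at_right 0) I"
    unfolding upper_envelope_def lower_envelope_def I_def S_def ..
  also have "Lim (at_right 0) I = Sup (I ` {0<..<r0})"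
    by (rule tendsto_Lim[OF _ lim]) simp
  finally have e: "upper_envelope F \<xi> X = - Sup (I ` {0<..<r0})" .
  show ?thesis
  proof (rule field_le_epsilon)
    fix \<epsilon> :: real assume "0 < \<epsilon>"
    then obtain r where r: "0 < r" "\<And>\<eta> Y. \<eta> \<noteq> 0 \<Longrightarrow> transpose Y = Y \<Longrightarrow> norm (\<eta> - \<xi>) < r \<Longrightarrow>
                  norm (Y - X) < r \<Longrightarrow> F \<eta> Y \<le> B + \<epsilon>"
      using above[of \<epsilon>] by auto
    define s where "s = min r (r0/2)"
    have s: "0 < s" "s < r0" "s \<le> r" using r0 r by (auto simp: s_def)
    have "- B - \<epsilon> \<le> I s" unfolding I_def
    proof (rule cInf_greatest[OF ne[OF s(1)]])
      fix x assume "x \<in> S s"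
      then show "- B - \<epsilon> \<le> x" using r(2) s(3) unfolding S_def by force
    qed
    also have "I s \<le> Sup (I ` {0<..<r0})"
      using s upI by (intro cSup_upper bdd_aboveI[of _ C]) auto
    finally show "upper_envelope F \<xi> X \<le> B + \<epsilon>" using e by simp
  qed
qed

lemma matrix_entry_le_norm: "\<bar>Z $ i $ j\<bar> \<le> norm (Z :: real^'n^'n)"
proof -
  have "\<bar>Z $ i $ j\<bar> \<le> norm (Z $ i)" by (rule component_le_norm_cart)
  also have "\<dots> \<le> norm Z" by (rule Finite_Cartesian_Product.norm_nth_le)
  finally show ?thesis .
qed

text \<open>\<open>F\<close> is linear in its matrix argument, with a bound that is uniform in the direction of the gradient. It
allows to vary the matrix and the gradient separately.\<close>

lemma game_F_perturb:
  fixes \<eta> :: "real^'n" and X Y :: "real^'n^'n"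
  assumes "\<eta> \<noteq> 0"
  shows "\<bar>game_F p \<eta> Y - game_F p \<eta> X\<bar> \<le> (\<bar>recip p\<bar> * CARD('n)
      + \<bar>1 - 2 * recip p\<bar> * (CARD('n) * CARD('n))) * norm (Y - X)"
proof -
  define Z where "Z = Y - X"
  define i where "i = recip p"
  have Y: "Y = X + Z" by (simp add: Z_def)
  have "game_F p \<eta> Y - game_F p \<eta> X = i * trace Z + (1 - 2*i) * ((Z *v \<eta>) \<bullet> \<eta>) / (norm \<eta>)\<^sup>2"
    unfolding game_F_def recip_def[symmetric] Y i_def[symmetric]
    by (simp add: trace_add matrix_vector_mult_add_rdistrib inner_add_left ring_distribs add_divide_distrib)
  moreover have "\<bar>i * trace Z\<bar> \<le> \<bar>i\<bar> * (CARD('n) * norm Z)"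
  proof -
    have "\<bar>trace Z\<bar> \<le> (\<Sum>j\<in>(UNIV::'n set). norm Z)" unfolding trace_def
      by (rule order_trans[OF sum_abs]) (intro sum_mono matrix_entry_le_norm)
    then show ?thesis by (simp add: abs_mult mult_left_mono)
  qed
  moreover have "\<bar>(1 - 2*i) * ((Z *v \<eta>) \<bullet> \<eta>) / (norm \<eta>)\<^sup>2\<bar> \<le> \<bar>1 - 2*i\<bar> * (CARD('n) * CARD('n) * norm Z)"
  proof -
    have "norm (Z *v \<eta>) \<le> onorm ((*v) Z) * norm \<eta>" by (rule onorm) simp
    also have "\<dots> \<le> (CARD('n) * real CARD('n) * norm Z) * norm \<eta>"
      by (intro mult_right_mono onorm_le_matrix_component matrix_entry_le_norm) simp
    finally have a: "norm (Z *v \<eta>) \<le> (CARD('n) * real CARD('n) * norm Z) * norm \<eta>" .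
    have "\<bar>(Z *v \<eta>) \<bullet> \<eta>\<bar> \<le> norm (Z *v \<eta>) * norm \<eta>" by (rule Cauchy_Schwarz_ineq2)
    also have "\<dots> \<le> (CARD('n) * real CARD('n) * norm Z) * (norm \<eta>)\<^sup>2"
      using mult_right_mono[OF a, of "norm \<eta>"] by (simp add: power2_eq_square mult_ac)
    finally have "\<bar>(Z *v \<eta>) \<bullet> \<eta>\<bar> / (norm \<eta>)\<^sup>2 \<le> CARD('n) * real CARD('n) * norm Z"
      using assms by (simp add: divide_le_eq)
    then have "\<bar>1 - 2*i\<bar> * (\<bar>(Z *v \<eta>) \<bullet> \<eta>\<bar> / (norm \<eta>)\<^sup>2) \<le> \<bar>1 - 2*i\<bar> * (CARD('n) * CARD('n) * norm Z)"
      by (intro mult_left_mono) auto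
    then show ?thesis by (simp add: abs_mult)
  qed
  moreover have "\<bar>x + y\<bar> \<le> k + l" if "\<bar>x\<bar> \<le> k" "\<bar>y\<bar> \<le> l" for x y k l :: real
    using that by linarith
  ultimately have "\<bar>game_F p \<eta> Y - game_F p \<eta> X\<bar>
      \<le> \<bar>i\<bar> * (CARD('n) * norm Z) + \<bar>1 - 2*i\<bar> * (CARD('n) * CARD('n) * norm Z)"
    by presburger
  then show ?thesis unfolding Z_def[symmetric] i_def[symmetric] by (simp only: ring_distribs mult_ac)
qed

definition rank_one :: "real^'n \<Rightarrow> real^'n^'n" where "rank_one \<nu> = (\<chi> i j. \<nu> $ i * \<nu> $ j)"

lemma rank_one_vec: "rank_one \<nu> *v h = (\<nu> \<bullet> h) *\<^sub>R \<nu>"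
  by (simp add: rank_one_def matrix_vector_mult_def vec_eq_iff inner_vec_def sum_distrib_left sum_distrib_right mult_ac)

lemma trace_rank_one: "trace (rank_one \<nu>) = (norm \<nu>)\<^sup>2"
  unfolding power2_norm_eq_inner by (simp add: rank_one_def trace_def inner_vec_def)

lemma transpose_rank_one: "transpose (rank_one \<nu>) = rank_one \<nu>"
  by (simp add: rank_one_def transpose_def vec_eq_iff mult_ac)

text \<open>The two values of \<open>F\<close> that matter: \<open>iso_coeff\<close> is \<open>F(\<xi>, I)\<close>, and \<open>normal_coeff\<close> is \<open>F(\<nu>, \<nu>\<otimes>\<nu>)\<close> for a unit
vector \<open>\<nu>\<close>. The latter is \<open>1 / p'\<close> and is the diffusivity of the limiting heat equation.\<close>

definition iso_coeff :: "nat \<Rightarrow> ereal \<Rightarrow> real" where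
  "iso_coeff N p = recip p * N + 1 - 2 * recip p"

definition normal_coeff :: "ereal \<Rightarrow> real" where
  "normal_coeff p = 1 - recip p"

lemma trace_scaleR: "trace (c *\<^sub>R (A :: real^'n^'n)) = c * trace A"
  by (simp add: trace_def sum_distrib_left)

lemma scaleR_matrix_vec: "(c *\<^sub>R (A :: real^'n^'n)) *v x = c *\<^sub>R (A *v x)"
  by (simp add: matrix_vector_mult_def vec_eq_iff sum_distrib_left mult_ac)

lemma game_F_rank_one:
  fixes \<nu> \<eta> :: "real^'n"
  assumes "\<eta> \<noteq> 0"
  shows "game_F p \<eta> (c *\<^sub>R rank_one \<nu> + d *\<^sub>R mat 1) =
     c * (recip p * (norm \<nu>)\<^sup>2 + (1 - 2 * recip p) * ((\<nu> \<bullet> \<eta>)\<^sup>2 / (norm \<eta>)\<^sup>2))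
     + d * iso_coeff CARD('n) p"
proof -
  have t: "trace (c *\<^sub>R rank_one \<nu> + d *\<^sub>R mat 1) = c * (norm \<nu>)\<^sup>2 + d * CARD('n)"
    by (simp add: trace_add trace_scaleR trace_rank_one trace_I)
  have "((c *\<^sub>R rank_one \<nu> + d *\<^sub>R mat 1) *v \<eta>) \<bullet> \<eta> = c * (\<nu> \<bullet> \<eta>)\<^sup>2 + d * (norm \<eta>)\<^sup>2"
    by (simp add: matrix_vector_mult_add_rdistrib scaleR_matrix_vec rank_one_vec inner_add_left
        power2_norm_eq_inner power2_eq_square[of "\<nu> \<bullet> \<eta>"])
  with t assms show ?thesis unfolding game_F_def recip_def[symmetric] iso_coeff_def
    by (simp add: field_simps)
qed

text \<open>For these matrices the envelope needs no case distinction on a vanishing gradient: if \<open>\<nu> = 0\<close>, the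
matrix is a multiple of the identity, on which \<open>F\<close> does not depend on the direction; otherwise
\<open>b \<noteq> 0\<close> keeps the gradient away from 0, where \<open>F\<close> is continuous.\<close>

lemma upper_envelope_rank_one:
  fixes \<nu> :: "real^'n"
  assumes "b \<noteq> 0"
  shows "upper_envelope (game_F p) (b *\<^sub>R \<nu>) (c *\<^sub>R rank_one \<nu> + d *\<^sub>R mat 1)
      \<le> c * (norm \<nu>)\<^sup>2 * normal_coeff p + d * iso_coeff CARD('n) p"
proof -
  let ?X = "c *\<^sub>R rank_one \<nu> + d *\<^sub>R mat 1 :: real^'n^'n"
  define i where "i = recip p"
  define L where "L = (\<bar>recip p\<bar> * CARD('n)
      + \<bar>1 - 2 * recip p\<bar> * (CARD('n) * CARD('n)))"
  have L: "0 \<le> L" by (simp add: L_def)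
  have pert: "\<bar>game_F p \<eta> Y - game_F p \<eta> ?X\<bar> \<le> L * norm (Y - ?X)" if "\<eta> \<noteq> 0" for \<eta> Y
    unfolding L_def by (rule game_F_perturb[OF that])
  define D where "D = \<bar>c\<bar> * (\<bar>i\<bar> * (norm \<nu>)\<^sup>2 + \<bar>1 - 2 * i\<bar> * (norm \<nu>)\<^sup>2) + \<bar>d * iso_coeff CARD('n) p\<bar>"
  have low: "- D \<le> game_F p \<eta> ?X" if "\<eta> \<noteq> 0" for \<eta>
  proof -
    have "(\<nu> \<bullet> \<eta>)\<^sup>2 \<le> (norm \<nu>)\<^sup>2 * (norm \<eta>)\<^sup>2"
      by (metis Cauchy_Schwarz_ineq power2_norm_eq_inner)
    then have "(\<nu> \<bullet> \<eta>)\<^sup>2 / (norm \<eta>)\<^sup>2 \<le> (norm \<nu>)\<^sup>2"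
      using that by (simp add: divide_le_eq)
    then have "\<bar>c * (i * (norm \<nu>)\<^sup>2 + (1 - 2 * i) * ((\<nu> \<bullet> \<eta>)\<^sup>2 / (norm \<eta>)\<^sup>2))\<bar>
       \<le> \<bar>c\<bar> * (\<bar>i\<bar> * (norm \<nu>)\<^sup>2 + \<bar>1 - 2 * i\<bar> * (norm \<nu>)\<^sup>2)"
      unfolding abs_mult
      by (intro mult_left_mono order_trans[OF abs_triangle_ineq] add_mono)
         (auto simp: abs_mult simp del: times_divide_eq_right intro!: mult_left_mono)
    moreover have "- (B + \<bar>D\<bar>) \<le> A + D" if "\<bar>A\<bar> \<le> B" for A B D :: real using that by linarith
    ultimately show ?thesis unfolding game_F_rank_one[OF that] i_def[symmetric] D_def by blast
  qed
  have sym: "transpose ?X = ?X"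
    using transpose_rank_one[of \<nu>] by (simp add: transpose_def vec_eq_iff mat_def)
  show ?thesis
  proof (rule upper_envelope_le[OF sym, where C = "D + L"])
    fix \<eta> :: "real^'n" and Y :: "real^'n^'n" assume h: "\<eta> \<noteq> 0" "norm (Y - ?X) < 1"
    have "L * norm (Y - ?X) \<le> L * 1" using h L by (intro mult_left_mono) auto
    then show "- (D + L) \<le> game_F p \<eta> Y" using low[OF h(1)] pert[OF h(1), of Y] by linarith
  next
    fix \<epsilon> :: real assume e: "0 < \<epsilon>"
    have ev: "\<exists>r>0. \<forall>\<eta>. \<eta> \<noteq> 0 \<longrightarrow> norm (\<eta> - b *\<^sub>R \<nu>) < r \<longrightarrow>
        game_F p \<eta> ?X \<le> c * (norm \<nu>)\<^sup>2 * normal_coeff p + d * iso_coeff CARD('n) p + \<epsilon> / 2"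
    proof (cases "\<nu> = 0")
      case True
      then show ?thesis using e by (intro exI[of _ 1]) (simp add: game_F_rank_one)
    next
      case False
      then have nz: "b *\<^sub>R \<nu> \<noteq> 0" using assms by simp
      let ?h = "\<lambda>\<eta>. c * (i * (norm \<nu>)\<^sup>2 + (1 - 2 * i) * ((\<nu> \<bullet> \<eta>)\<^sup>2 / (norm \<eta>)\<^sup>2)) + d * iso_coeff CARD('n) p"
      have "isCont ?h (b *\<^sub>R \<nu>)" using nz by (intro continuous_intros) auto
      then have "(?h \<longlongrightarrow> ?h (b *\<^sub>R \<nu>)) (nhds (b *\<^sub>R \<nu>))"
        by (simp add: tendsto_nhds_iff isCont_def)
      moreover have "?h (b *\<^sub>R \<nu>) = c * (norm \<nu>)\<^sup>2 * normal_coeff p + d * iso_coeff CARD('n) p"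
      proof -
        have "(\<nu> \<bullet> (b *\<^sub>R \<nu>))\<^sup>2 = (norm \<nu>)\<^sup>2 * (norm (b *\<^sub>R \<nu>))\<^sup>2"
          by (simp add: power_mult_distrib power2_norm_eq_inner) (simp add: power2_eq_square)
        then have "(\<nu> \<bullet> (b *\<^sub>R \<nu>))\<^sup>2 / (norm (b *\<^sub>R \<nu>))\<^sup>2 = (norm \<nu>)\<^sup>2"
          using nz by simp
        then show ?thesis unfolding normal_coeff_def i_def[symmetric] by (simp add: algebra_simps)
      qed
      ultimately have "(?h \<longlongrightarrow> c * (norm \<nu>)\<^sup>2 * normal_coeff p + d * iso_coeff CARD('n) p) (nhds (b *\<^sub>R \<nu>))"
        by (simp only:)
      from order_tendstoD(2)[OF this, of "c * (norm \<nu>)\<^sup>2 * normal_coeff p + d * iso_coeff CARD('n) p + \<epsilon>/2"]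
      have "\<forall>\<^sub>F \<eta> in nhds (b *\<^sub>R \<nu>). ?h \<eta> < c * (norm \<nu>)\<^sup>2 * normal_coeff p + d * iso_coeff CARD('n) p + \<epsilon>/2"
        using e by simp
      then obtain r where "r > 0" "\<forall>\<eta>. dist \<eta> (b *\<^sub>R \<nu>) < r \<longrightarrow>
         ?h \<eta> < c * (norm \<nu>)\<^sup>2 * normal_coeff p + d * iso_coeff CARD('n) p + \<epsilon>/2"
        unfolding eventually_nhds_metric by blast
      then show ?thesis
        by (intro exI[of _ r]) (auto simp: game_F_rank_one dist_norm i_def intro!: less_imp_le)
    qed
    then obtain r where r: "0 < r" "\<And>\<eta>. \<eta> \<noteq> 0 \<Longrightarrow> norm (\<eta> - b *\<^sub>R \<nu>) < r \<Longrightarrow>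
        game_F p \<eta> ?X \<le> c * (norm \<nu>)\<^sup>2 * normal_coeff p + d * iso_coeff CARD('n) p + \<epsilon> / 2" by auto
    define s where "s = min r (\<epsilon> / (2 * (L + 1)))"
    have s: "0 < s" "s \<le> r" "s \<le> \<epsilon> / (2 * (L + 1))" using r e L by (auto simp: s_def)
    have Ls: "L * s \<le> \<epsilon> / 2"
    proof -
      have "L * s \<le> (L+1) * (\<epsilon> / (2 * (L + 1)))" using s L by (intro mult_mono) auto
      also have "\<dots> = \<epsilon> / 2"
      proof -
        have "m * (\<epsilon> / (2 * m)) = \<epsilon> / 2" if "0 < m" for m :: real using that by simp
        then show ?thesis using L by (meson add_nonneg_pos zero_less_one)
      qed
      finally show ?thesis .
    qed
    show "\<exists>r>0. \<forall>\<eta> Y. \<eta> \<noteq> 0 \<longrightarrow> transpose Y = Y \<longrightarrow> norm (\<eta> - b *\<^sub>R \<nu>) < r \<longrightarrow>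
         norm (Y - ?X) < r \<longrightarrow> game_F p \<eta> Y \<le> c * (norm \<nu>)\<^sup>2 * normal_coeff p + d * iso_coeff CARD('n) p + \<epsilon>"
    proof (intro exI[of _ s] conjI allI impI)
      fix \<eta> :: "real^'n" and Y :: "real^'n^'n"
      assume h: "\<eta> \<noteq> 0" "norm (\<eta> - b *\<^sub>R \<nu>) < s" "norm (Y - ?X) < s"
      have "L * norm (Y - ?X) \<le> L * s" using h L by (intro mult_left_mono) auto
      with Ls r(2)[OF h(1)] h(2) s(2) pert[OF h(1), of Y]
      show "game_F p \<eta> Y \<le> c * (norm \<nu>)\<^sup>2 * normal_coeff p + d * iso_coeff CARD('n) p + \<epsilon>" by linarith
    qed (use s in auto)
  qed
qed

section \<open>Quadratic test functions\<close>

text \<open>Coordinates relative to the point of contact. The quartic term has no first and second derivatives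
there, but dominates every bounded function far away.\<close>

definition quad_test :: "'a::real_inner \<Rightarrow> real \<Rightarrow> real \<Rightarrow> real \<Rightarrow> real \<Rightarrow> real \<Rightarrow> real \<Rightarrow> 'a \<times> real \<Rightarrow> real" where
  "quad_test \<nu> a b c d K L w = a * snd w + b * (\<nu> \<bullet> fst w) + c/2 * (\<nu> \<bullet> fst w)\<^sup>2 + d/2 * (fst w \<bullet> fst w)
     + K * (snd w)\<^sup>2 + L * (w \<bullet> w)\<^sup>2"

text \<open>Gradient and second derivative in space-time, as required by \<open>C2_on\<close>.\<close>

definition quad_test_grad where
  "quad_test_grad \<nu> a b c d K L w =
     (b *\<^sub>R \<nu> + (c * (\<nu> \<bullet> fst w)) *\<^sub>R \<nu> + d *\<^sub>R fst w + (4 * L * (w \<bullet> w)) *\<^sub>R fst w,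
      a + 2 * K * snd w + 4 * L * (w \<bullet> w) * snd w)"

definition quad_test_hess where
  "quad_test_hess \<nu> c d K L w v =
     ((c * (\<nu> \<bullet> fst v)) *\<^sub>R \<nu> + d *\<^sub>R fst v + (4 * L * (w \<bullet> w)) *\<^sub>R fst v + (8 * L * (w \<bullet> v)) *\<^sub>R fst w,
      2 * K * snd v + 4 * L * (w \<bullet> w) * snd v + 8 * L * (w \<bullet> v) * snd w)"

lemma quad_test_GDERIV:
  "GDERIV (\<lambda>w. quad_test \<nu> a b c d K L (w - w0)) w :> quad_test_grad \<nu> a b c d K L (w - w0)"
  unfolding gderiv_def quad_test_def
  apply (rule derivative_eq_intros | rule refl)+
  apply (rule ext)
  apply (simp add: quad_test_grad_def algebra_simps inner_commute power2_eq_square)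
  apply (simp add: inner_prod_def algebra_simps inner_commute)
  done

lemma quad_test_grad_deriv:
  "((\<lambda>w. quad_test_grad \<nu> a b c d K L (w - w0)) has_derivative quad_test_hess \<nu> c d K L (w - w0)) (at w)"
  unfolding quad_test_grad_def
  apply (rule derivative_eq_intros | rule refl)+
  apply (rule ext)
  apply (simp add: quad_test_hess_def algebra_simps inner_commute)
  done

lemma quad_test_C2: "C2_on S (\<lambda>w :: 'a::euclidean_space \<times> real. quad_test \<nu> a b c d K L (w - w0))"
  unfolding C2_on_def
proof (intro exI conjI ballI)
  fix w :: "'a \<times> real"
  show "GDERIV (\<lambda>w. quad_test \<nu> a b c d K L (w - w0)) w :> quad_test_grad \<nu> a b c d K L (w - w0)"
    by (rule quad_test_GDERIV)
  have bl: "bounded_linear (quad_test_hess \<nu> c d K L (w - w0))" for w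
    using quad_test_grad_deriv by (rule has_derivative_bounded_linear)
  show "((\<lambda>w. quad_test_grad \<nu> a b c d K L (w - w0)) has_derivative
      blinfun_apply (Blinfun (quad_test_hess \<nu> c d K L (w - w0)))) (at w)"
    using quad_test_grad_deriv by (simp add: bounded_linear_Blinfun_apply[OF bl])
  show "continuous_on S (\<lambda>w. Blinfun (quad_test_hess \<nu> c d K L (w - w0)))"
    by (rule continuous_on_blinfun_componentwise)
       (auto simp: bounded_linear_Blinfun_apply[OF bl] quad_test_hess_def intro!: continuous_intros)
qed

lemma gradient_eq: "GDERIV f x :> D \<Longrightarrow> gradient f x = D"
  unfolding gradient_def
proof (rule the_equality)
  fix D' assume "GDERIV f x :> D" "GDERIV f x :> D'"
  then have "(\<lambda>h. h \<bullet> D) = (\<lambda>h. h \<bullet> D')" unfolding gderiv_def by (rule has_derivative_unique)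
  then show "D' = D" by (metis inner_commute vector_eq_rdot)
qed

lemma quad_test_slice:
  "quad_test \<nu> a b c d K L ((z, t0) - (x0, t0)) = b * (\<nu> \<bullet> (z - x0)) + c/2 * (\<nu> \<bullet> (z - x0))\<^sup>2
     + d/2 * ((z - x0) \<bullet> (z - x0)) + L * ((z - x0) \<bullet> (z - x0))\<^sup>2"
  by (simp add: quad_test_def)

lemma quad_test_slice_gradient:
  "gradient (\<lambda>z. quad_test \<nu> a b c d K L ((z, t0) - (x0, t0))) z =
     b *\<^sub>R \<nu> + (c * (\<nu> \<bullet> (z - x0))) *\<^sub>R \<nu> + d *\<^sub>R (z - x0) + (4 * L * ((z - x0) \<bullet> (z - x0))) *\<^sub>R (z - x0)"
  apply (rule gradient_eq)
  unfolding gderiv_def quad_test_slice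
  apply (rule derivative_eq_intros | rule refl)+
  apply (rule ext)
  apply (simp add: algebra_simps inner_commute power2_eq_square)
  done

lemma quad_test_slice_hessian:
  fixes x0 :: "real^'n"
  shows "hessian (\<lambda>z. quad_test \<nu> a b c d K L ((z, t0) - (x0, t0))) x0 = c *\<^sub>R rank_one \<nu> + d *\<^sub>R mat 1"
proof -
  have "((\<lambda>z. gradient (\<lambda>z. quad_test \<nu> a b c d K L ((z, t0) - (x0, t0))) z) has_derivative
      (\<lambda>h. (c *\<^sub>R rank_one \<nu> + d *\<^sub>R mat 1) *v h)) (at x0)"
    unfolding quad_test_slice_gradient
    apply (rule derivative_eq_intros | rule refl)+
    apply (rule ext)
    apply (simp add: matrix_vector_mult_add_rdistrib scaleR_matrix_vec rank_one_vec)
    done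
  from frechet_derivative_at[OF this] show ?thesis
    unfolding hessian_def jacobian_def by (metis matrix_of_matrix_vector_mul)
qed

lemma quad_test_time_deriv:
  "deriv (\<lambda>s. quad_test \<nu> a b c d K L ((x0, s) - (x0, t0))) t0 = a"
  apply (rule DERIV_imp_deriv)
  unfolding quad_test_def
  apply (auto simp: inner_prod_def intro!: derivative_eq_intros)
  done

text \<open>The inequality for \<open>- u\<close> is the supersolution property of \<open>u\<close>: since \<open>F(-\<eta>, -Y) = - F(\<eta>, Y)\<close>, reflecting
the neighbourhoods in the definition of the lower envelope turns it into the upper one.\<close>

lemma viscosity_quad_test:
  fixes u :: "(real^'n) \<times> real \<Rightarrow> real"
  assumes visc: "viscosity_solution p \<Omega> u" and x0: "x0 \<in> \<Omega>" and t0: "0 < t0" and b: "b \<noteq> 0"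
  shows "(\<forall>w\<in>\<Omega> \<times> {0<..}. u w \<le> u (x0, t0) + quad_test \<nu> a b c d K L (w - (x0, t0))) \<Longrightarrow>
      a \<le> c * (norm \<nu>)\<^sup>2 * normal_coeff p + d * iso_coeff CARD('n) p"
    and "(\<forall>w\<in>\<Omega> \<times> {0<..}. - u w \<le> - u (x0, t0) + quad_test \<nu> a b c d K L (w - (x0, t0))) \<Longrightarrow>
      a \<le> c * (norm \<nu>)\<^sup>2 * normal_coeff p + d * iso_coeff CARD('n) p"
proof -
  have q0: "quad_test \<nu> a b c d K L 0 = 0" for a b c d K L by (simp add: quad_test_def)
  have 1: "(\<forall>w\<in>\<Omega> \<times> {0<..}. u w - \<phi> w \<le> u (x0, t0) - \<phi> (x0, t0)) \<Longrightarrow>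
           deriv (\<lambda>s. \<phi> (x0, s)) t0
           - upper_envelope (game_F p) (gradient (\<lambda>z. \<phi> (z, t0)) x0) (hessian (\<lambda>z. \<phi> (z, t0)) x0) \<le> 0"
    "(\<forall>w\<in>\<Omega> \<times> {0<..}. u w - \<phi> w \<ge> u (x0, t0) - \<phi> (x0, t0)) \<Longrightarrow>
           deriv (\<lambda>s. \<phi> (x0, s)) t0
           - lower_envelope (game_F p) (gradient (\<lambda>z. \<phi> (z, t0)) x0) (hessian (\<lambda>z. \<phi> (z, t0)) x0) \<ge> 0"
    if "C2_on (\<Omega> \<times> {0<..}) \<phi>" for \<phi>
    using visc x0 t0 that unfolding viscosity_solution_def by blast+
  note env = upper_envelope_rank_one[OF b, of p \<nu> c d]
  {
    assume h: "\<forall>w\<in>\<Omega> \<times> {0<..}. u w \<le> u (x0, t0) + quad_test \<nu> a b c d K L (w - (x0, t0))"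
    have "\<forall>w\<in>\<Omega> \<times> {0<..}. u w - quad_test \<nu> a b c d K L (w - (x0, t0))
        \<le> u (x0, t0) - quad_test \<nu> a b c d K L ((x0, t0) - (x0, t0))"
      using h by (auto simp: q0 diff_le_eq simp flip: zero_prod_def)
    from 1(1)[OF quad_test_C2 this] env
    show "a \<le> c * (norm \<nu>)\<^sup>2 * normal_coeff p + d * iso_coeff CARD('n) p"
      unfolding quad_test_time_deriv quad_test_slice_hessian quad_test_slice_gradient by simp
  next
    have env': "upper_envelope (game_F p) (b *\<^sub>R \<nu>) (c *\<^sub>R rank_one \<nu> + d *\<^sub>R mat 1)
       = - lower_envelope (game_F p) ((-b) *\<^sub>R \<nu>) ((-c) *\<^sub>R rank_one \<nu> + (-d) *\<^sub>R mat 1)"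
    proof -
      have odd: "game_F p (-\<eta>) (-Y) = - game_F p \<eta> Y" for \<eta> :: "real^'n" and Y
        by (simp add: game_F_def trace_def sum_negf matrix_vector_mult_def inner_vec_def)
      have swap: "{- game_F p \<eta> Y |\<eta> Y. \<eta> \<noteq> 0 \<and> transpose Y = Y \<and> norm (\<eta> - \<xi>) < r \<and> norm (Y - X) < r}
         = {game_F p \<eta> Y |\<eta> Y. \<eta> \<noteq> 0 \<and> transpose Y = Y \<and> norm (\<eta> - (-\<xi>)) < r \<and> norm (Y - (-X)) < r}"
        (is "?A = ?B") for \<xi> :: "real^'n" and X r
      proof -
        have tr: "transpose (-Y) = - Y" if "transpose Y = Y" for Y :: "real^'n^'n"
          using that by (simp add: transpose_def vec_eq_iff)
        have nm: "norm (- \<eta> + \<xi>) = norm (\<eta> - \<xi>)" "norm (- Y + X) = norm (Y - X)" 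
          "norm (- \<eta> - \<xi>) = norm (\<eta> + \<xi>)" "norm (- Y - X) = norm (Y + X)" 
          for \<eta> \<xi> :: "real^'n" and X Y :: "real^'n^'n"
          using norm_minus_cancel[of "\<eta> - \<xi>"] norm_minus_cancel[of "Y - X"]
            norm_minus_cancel[of "\<eta> + \<xi>"] norm_minus_cancel[of "Y + X"]
          by (simp_all only: minus_diff_eq minus_add_distrib diff_conv_add_uminus minus_minus add.commute)
        show ?thesis
        proof (intro set_eqI iffI)
          fix v assume "v \<in> ?A"
          then obtain \<eta> Y where "v = - game_F p \<eta> Y" "\<eta> \<noteq> 0" "transpose Y = Y" "norm (\<eta> - \<xi>) < r" "norm (Y - X) < r" by blast
          then show "v \<in> ?B" 
            by (intro CollectI exI[of _ "-\<eta>"] exI[of _ "-Y"]) (auto simp: odd tr nm norm_minus_commute)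
        next
          fix v assume "v \<in> ?B"
          then obtain \<eta> Y where "v = game_F p \<eta> Y" "\<eta> \<noteq> 0" "transpose Y = Y" "norm (\<eta> + \<xi>) < r" "norm (Y + X) < r" by auto
          then show "v \<in> ?A" 
            by (intro CollectI exI[of _ "-\<eta>"] exI[of _ "-Y"]) (auto simp: odd tr nm)
        qed
      qed
      show ?thesis unfolding upper_envelope_def lower_envelope_def swap by simp
    qed
    have neg: "- quad_test \<nu> a b c d K L w = quad_test \<nu> (-a) (-b) (-c) (-d) (-K) (-L) w" for w
      by (simp add: quad_test_def)
    assume h: "\<forall>w\<in>\<Omega> \<times> {0<..}. - u w \<le> - u (x0, t0) + quad_test \<nu> a b c d K L (w - (x0, t0))"
    have "\<forall>w\<in>\<Omega> \<times> {0<..}. u w - quad_test \<nu> (-a) (-b) (-c) (-d) (-K) (-L) (w - (x0, t0))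
        \<ge> u (x0, t0) - quad_test \<nu> (-a) (-b) (-c) (-d) (-K) (-L) ((x0, t0) - (x0, t0))"
      using h unfolding neg[symmetric] by (auto simp: q0 algebra_simps simp flip: zero_prod_def)
    from 1(2)[OF quad_test_C2 this] env env'
    show "a \<le> c * (norm \<nu>)\<^sup>2 * normal_coeff p + d * iso_coeff CARD('n) p"
      unfolding quad_test_time_deriv quad_test_slice_hessian quad_test_slice_gradient by simp
  }
qed

text \<open>The subsolution property in the only form used below. Test functions are local, and their Hessian is
\<open>c \<nu>\<otimes>\<nu> + d I\<close> with gradient parallel to \<open>\<nu>\<close>: a profile \<open>f(\<psi>(z), t)\<close> is majorized to second order by
such a function, with \<open>\<nu> = \<nabla>\<psi>\<close> and \<open>d\<close> accounting for the second derivatives of \<open>\<psi>\<close>. The coefficient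
\<open>K\<close> of the squared time is free because the equation does not see it.\<close>

definition jet_subsolution :: "ereal \<Rightarrow> (real^'n) set \<Rightarrow> ((real^'n) \<times> real \<Rightarrow> real) \<Rightarrow> bool" where
  "jet_subsolution p \<Omega> v \<longleftrightarrow> (\<forall>x0\<in>\<Omega>. \<forall>t0>0. \<forall>\<nu> a b c d K. b \<noteq> 0 \<longrightarrow>
     (\<forall>\<^sub>F w in nhds (x0, t0). v w \<le> v (x0, t0) + quad_test \<nu> a b c d K 0 (w - (x0, t0))) \<longrightarrow>
     a \<le> c * (norm \<nu>)\<^sup>2 * normal_coeff p + d * iso_coeff CARD('n) p)"

text \<open>Outside a ball of radius \<open>\<rho>\<close> the quartic term beats the constant, linear and quadratic terms separately,
which gives the three summands of \<open>L\<close>.\<close>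

lemma quad_test_dominates:
  fixes \<nu> :: "'a::euclidean_space"
  assumes loc: "\<forall>\<^sub>F w in nhds w0. v w \<le> v w0 + quad_test \<nu> a b c d K 0 (w - w0)"
    and bd: "\<And>w. w \<in> D \<Longrightarrow> v w \<le> M"
  shows "\<exists>L. \<forall>w\<in>D. v w \<le> v w0 + quad_test \<nu> a b c d K L (w - w0)"
proof -
  obtain \<rho> where \<rho>: "0 < \<rho>" "\<And>w. dist w w0 < \<rho> \<Longrightarrow> v w \<le> v w0 + quad_test \<nu> a b c d K 0 (w - w0)"
    using loc unfolding eventually_nhds_metric by auto
  define C1 where "C1 = \<bar>a\<bar> + \<bar>b\<bar> * norm \<nu>"
  define C2 where "C2 = \<bar>c/2\<bar> * (norm \<nu>)\<^sup>2 + \<bar>d/2\<bar> + \<bar>K\<bar>"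
  define C0 where "C0 = \<bar>M\<bar> + \<bar>v w0\<bar>"
  have C: "0 \<le> C1" "0 \<le> C2" "0 \<le> C0" by (auto simp: C1_def C2_def C0_def)
  define L where "L = C0 / \<rho>^4 + C1 / \<rho>^3 + C2 / \<rho>^2"
  have L: "0 \<le> L" using C \<rho> by (simp add: L_def)
  have split: "quad_test \<nu> a b c d K L h = quad_test \<nu> a b c d K 0 h + L * (h \<bullet> h)\<^sup>2" for h
    by (simp add: quad_test_def)
  have low: "- (C1 * norm h + C2 * (norm h)\<^sup>2) \<le> quad_test \<nu> a b c d K 0 h" for h :: "'a \<times> real"
  proof -
    have s: "\<bar>snd h\<bar> \<le> norm h" using norm_snd_le[of "snd h" "fst h"] by simp
    have f: "norm (fst h) \<le> norm h" using norm_fst_le[of "fst h" "snd h"] by simp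
    have i: "\<bar>\<nu> \<bullet> fst h\<bar> \<le> norm \<nu> * norm h"
      by (rule order_trans[OF Cauchy_Schwarz_ineq2]) (simp add: f mult_left_mono)
    have 1: "\<bar>a * snd h\<bar> \<le> \<bar>a\<bar> * norm h" by (simp add: abs_mult s mult_left_mono)
    have 2: "\<bar>b * (\<nu> \<bullet> fst h)\<bar> \<le> \<bar>b\<bar> * (norm \<nu> * norm h)" 
      unfolding abs_mult by (intro mult_left_mono i) auto
    have sq: "(\<nu> \<bullet> fst h)\<^sup>2 \<le> (norm \<nu> * norm h)\<^sup>2" using i by (rule abs_le_square_iff[THEN iffD1, OF order_trans]) simp
    have 3: "\<bar>c/2 * (\<nu> \<bullet> fst h)\<^sup>2\<bar> \<le> \<bar>c/2\<bar> * (norm \<nu> * norm h)\<^sup>2"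
      unfolding abs_mult using sq by (intro mult_left_mono) auto
    have 4: "\<bar>d/2 * (fst h \<bullet> fst h)\<bar> \<le> \<bar>d/2\<bar> * (norm h)\<^sup>2"
      unfolding abs_mult power2_norm_eq_inner[symmetric] abs_power2 using f
      by (intro mult_left_mono power_mono) auto
    have 5: "\<bar>K * (snd h)\<^sup>2\<bar> \<le> \<bar>K\<bar> * (norm h)\<^sup>2"
      unfolding abs_mult abs_power2 using s by (intro mult_left_mono abs_le_square_iff[THEN iffD1]) auto
    have e: "C1 * norm h + C2 * (norm h)\<^sup>2 = \<bar>a\<bar> * norm h + \<bar>b\<bar> * (norm \<nu> * norm h) +
       \<bar>c/2\<bar> * (norm \<nu> * norm h)\<^sup>2 + \<bar>d/2\<bar> * (norm h)\<^sup>2 + \<bar>K\<bar> * (norm h)\<^sup>2"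
      by (simp add: C1_def C2_def ring_distribs power_mult_distrib)
    have "quad_test \<nu> a b c d K 0 h = a * snd h + b * (\<nu> \<bullet> fst h) + c/2 * (\<nu> \<bullet> fst h)\<^sup>2
      + d/2 * (fst h \<bullet> fst h) + K * (snd h)\<^sup>2" by (simp add: quad_test_def)
    moreover have "- (y1 + y2 + y3 + y4 + y5) \<le> x1 + x2 + x3 + x4 + x5"
      if "\<bar>x1\<bar> \<le> y1" "\<bar>x2\<bar> \<le> y2" "\<bar>x3\<bar> \<le> y3" "\<bar>x4\<bar> \<le> y4" "\<bar>x5\<bar> \<le> y5"
      for x1 x2 x3 x4 x5 y1 y2 y3 y4 y5 :: real using that by linarith
    ultimately show ?thesis using 1 2 3 4 5 unfolding e by presburger
  qed
  have far: "C0 + (C1 * n + C2 * n\<^sup>2) \<le> L * n^4" if "\<rho> \<le> n" for n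
  proof -
    define y where "y = n / \<rho>"
    have y: "1 \<le> y" "n = y * \<rho>" using that \<rho> by (auto simp: y_def)
    have e1: "C0 \<le> C0 * y^4" using y C by (simp add: mult_le_cancel_left1)
    have e2: "C1 * n \<le> (C1 / \<rho>^3) * n^4"
    proof -
      have "C1 * n = C1 * \<rho> * y^1" using y by simp
      also have "\<dots> \<le> C1 * \<rho> * y^4" using y C \<rho> by (intro mult_left_mono power_increasing) auto
      also have "\<dots> = (C1 / \<rho>^3) * n^4" using \<rho> y(2) by (simp add: power_mult_distrib field_simps power_numeral_reduce)
      finally show ?thesis .
    qed
    have e3: "C2 * n\<^sup>2 \<le> (C2 / \<rho>^2) * n^4"
    proof -
      have "C2 * n\<^sup>2 = C2 * \<rho>\<^sup>2 * y^2" using y by (simp add: power_mult_distrib)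
      also have "\<dots> \<le> C2 * \<rho>\<^sup>2 * y^4" using y C \<rho> by (intro mult_left_mono power_increasing) auto
      also have "\<dots> = (C2 / \<rho>^2) * n^4" using \<rho> y(2) by (simp add: power_mult_distrib field_simps power_numeral_reduce)
      finally show ?thesis .
    qed
    have e0: "C0 * y^4 = C0 / \<rho>^4 * n^4" using \<rho> y(2) by (simp add: power_mult_distrib)
    show ?thesis unfolding L_def ring_distribs using e0 e1 e2 e3 by linarith
  qed
  show ?thesis
  proof (intro exI[of _ L] ballI)
    fix w assume w: "w \<in> D"
    show "v w \<le> v w0 + quad_test \<nu> a b c d K L (w - w0)"
    proof (cases "dist w w0 < \<rho>")
      case True
      then show ?thesis using \<rho>(2)[OF True] L unfolding split by (smt (verit) mult_nonneg_nonneg zero_le_power2)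
    next
      case False
      define h where "h = w - w0"
      have "\<rho> \<le> norm h" using False by (simp add: dist_norm h_def)
      from far[OF this] have f: "\<bar>M\<bar> + \<bar>v w0\<bar> + (C1 * norm h + C2 * (norm h)\<^sup>2) \<le> L * (h \<bullet> h)\<^sup>2"
        unfolding C0_def by (simp add: power2_norm_eq_inner[symmetric])
      have key: "x \<le> y + (q + l)" if "x \<le> k" "- m \<le> y" "k + m + z \<le> l" "- z \<le> q" for x y q l k m z :: real
        using that by linarith
      have m: "v w \<le> \<bar>M\<bar>" "- \<bar>v w0\<bar> \<le> v w0" using bd[OF w] by auto
      show ?thesis unfolding split h_def[symmetric] by (rule key[OF m f low])
    qed
  qed
qed

lemma viscosity_jet_subsolution:
  fixes u :: "(real^'n) \<times> real \<Rightarrow> real"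
  assumes visc: "viscosity_solution p \<Omega> u" and bd: "bounded (u ` (\<Omega> \<times> {0<..}))"
  shows "jet_subsolution p \<Omega> u" "jet_subsolution p \<Omega> (\<lambda>w. - u w)"
proof -
  obtain M where M: "\<And>w. w \<in> \<Omega> \<times> {0<..} \<Longrightarrow> \<bar>u w\<bar> \<le> M"
    using bd unfolding bounded_iff by auto
  show "jet_subsolution p \<Omega> u" unfolding jet_subsolution_def
  proof (intro ballI allI impI)
    fix x0 t0 \<nu> a b c d K
    assume h: "x0 \<in> \<Omega>" "0 < (t0::real)" "b \<noteq> (0::real)"
      and l: "\<forall>\<^sub>F w in nhds (x0, t0). u w \<le> u (x0, t0) + quad_test \<nu> a b c d K 0 (w - (x0, t0))"
    obtain L where "\<forall>w\<in>\<Omega> \<times> {0<..}. u w \<le> u (x0, t0) + quad_test \<nu> a b c d K L (w - (x0, t0))"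
      using quad_test_dominates[OF l, of "\<Omega> \<times> {0<..}" M] M by (meson abs_le_D1)
    from viscosity_quad_test(1)[OF visc h this]
    show "a \<le> c * (norm \<nu>)\<^sup>2 * normal_coeff p + d * iso_coeff CARD('n) p" .
  qed
  show "jet_subsolution p \<Omega> (\<lambda>w. - u w)" unfolding jet_subsolution_def
  proof (intro ballI allI impI)
    fix x0 t0 \<nu> a b c d K
    assume h: "x0 \<in> \<Omega>" "0 < (t0::real)" "b \<noteq> (0::real)"
      and l: "\<forall>\<^sub>F w in nhds (x0, t0). - u w \<le> - u (x0, t0) + quad_test \<nu> a b c d K 0 (w - (x0, t0))"
    obtain L where "\<forall>w\<in>\<Omega> \<times> {0<..}. - u w \<le> - u (x0, t0) + quad_test \<nu> a b c d K L (w - (x0, t0))"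
      using quad_test_dominates[of "\<lambda>w. - u w", OF l, of "\<Omega> \<times> {0<..}" M] M by (meson abs_le_D2)
    from viscosity_quad_test(2)[OF visc h this]
    show "a \<le> c * (norm \<nu>)\<^sup>2 * normal_coeff p + d * iso_coeff CARD('n) p" .
  qed
qed

lemma jet_subsolution_add: "jet_subsolution p \<Omega> v \<Longrightarrow> jet_subsolution p \<Omega> (\<lambda>w. v w + k)"
  unfolding jet_subsolution_def by (simp add: algebra_simps)

section \<open>Comparison with one-dimensional profiles\<close>

text \<open>Second derivatives are assumed at the centre only. The mean value theorem on the segment, applied to
the difference to the quadratic polynomial, reduces the claim to differentiability of the gradient.\<close>

lemma second_order_Taylor_Peano:
  fixes f :: "'a::real_inner \<Rightarrow> real"
  assumes G: "\<forall>\<^sub>F z in nhds x. GDERIV f z :> G z" and H: "(G has_derivative H) (at x)" and e: "0 < \<epsilon>"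
  shows "\<forall>\<^sub>F z in nhds x. \<bar>f z - f x - G x \<bullet> (z - x) - 1/2 * (H (z - x) \<bullet> (z - x))\<bar> \<le> \<epsilon> * (norm (z - x))\<^sup>2"
proof -
  obtain r1 where r1: "0 < r1" "\<And>z. dist z x < r1 \<Longrightarrow> GDERIV f z :> G z"
    using G unfolding eventually_nhds_metric by auto
  have bl: "bounded_linear H" using H by (rule has_derivative_bounded_linear)
  then interpret H: bounded_linear H .
  obtain r2 where r2: "0 < r2" "\<And>z. norm (z - x) < r2 \<Longrightarrow> norm (G z - G x - H (z - x)) \<le> \<epsilon> * norm (z - x)"
    using H e unfolding has_derivative_at_alt by metis
  show ?thesis unfolding eventually_nhds_metric
  proof (intro exI[of _ "min r1 r2"] conjI allI impI)
    fix z assume "dist z x < min r1 r2"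
    define h where "h = z - x"
    have h: "norm h < r1" "norm h < r2" using \<open>dist z x < min r1 r2\<close> by (auto simp: h_def dist_norm)
    define \<phi> where "\<phi> r = f (x + r *\<^sub>R h) - r * (G x \<bullet> h) - r\<^sup>2/2 * (H h \<bullet> h)" for r
    have d: "(\<phi> has_real_derivative ((G (x + r *\<^sub>R h) - G x - H (r *\<^sub>R h)) \<bullet> h)) (at r)" if "0 \<le> r" "r \<le> 1" for r
    proof -
      have "norm (r *\<^sub>R h) \<le> 1 * norm h" unfolding norm_scaleR using that by (intro mult_right_mono) auto
      then have "GDERIV f (x + r *\<^sub>R h) :> G (x + r *\<^sub>R h)" using h by (intro r1(2)) (simp add: dist_norm)
      then have "(f has_derivative (\<lambda>k. k \<bullet> G (x + r *\<^sub>R h))) (at (x + r *\<^sub>R h))" by (simp add: gderiv_def)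
      then have "((\<lambda>r. f (x + r *\<^sub>R h)) has_derivative (\<lambda>k. (k *\<^sub>R h) \<bullet> G (x + r *\<^sub>R h))) (at r)"
        by (rule has_derivative_compose[rotated]) (auto intro!: derivative_eq_intros)
      then have "((\<lambda>r. f (x + r *\<^sub>R h)) has_real_derivative (G (x + r *\<^sub>R h) \<bullet> h)) (at r)"
        by (simp add: has_field_derivative_def inner_commute mult.commute[of _ "_ \<bullet> _"])
      then show ?thesis unfolding \<phi>_def
        by (auto intro!: derivative_eq_intros simp: H.scaleR inner_diff_left)
    qed
    obtain r where r: "0 < r" "r < 1" "\<phi> 1 - \<phi> 0 = (1 - 0) * ((G (x + r *\<^sub>R h) - G x - H (r *\<^sub>R h)) \<bullet> h)"
      using MVT2[of 0 1 \<phi> "\<lambda>r. (G (x + r *\<^sub>R h) - G x - H (r *\<^sub>R h)) \<bullet> h"] d by auto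
    have rh: "norm (r *\<^sub>R h) \<le> 1 * norm h" unfolding norm_scaleR using r by (intro mult_right_mono) auto
    have "\<bar>\<phi> 1 - \<phi> 0\<bar> \<le> norm (G (x + r *\<^sub>R h) - G x - H (r *\<^sub>R h)) * norm h"
      unfolding r(3) using Cauchy_Schwarz_ineq2 by simp
    also have "\<dots> \<le> (\<epsilon> * norm (r *\<^sub>R h)) * norm h"
      using r2(2)[of "x + r *\<^sub>R h"] rh h by (intro mult_right_mono) auto
    also have "\<dots> \<le> (\<epsilon> * norm h) * norm h" using rh e by (intro mult_right_mono mult_left_mono) auto
    finally have "\<bar>\<phi> 1 - \<phi> 0\<bar> \<le> \<epsilon> * (norm h)\<^sup>2" by (simp add: power2_eq_square mult_ac)
    moreover have "\<phi> 1 - \<phi> 0 = f z - f x - G x \<bullet> h - 1/2 * (H h \<bullet> h)"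
      by (simp add: \<phi>_def h_def)
    ultimately show "\<bar>f z - f x - G x \<bullet> (z - x) - 1/2 * (H (z - x) \<bullet> (z - x))\<bar> \<le> \<epsilon> * (norm (z - x))\<^sup>2"
      by (simp add: h_def)
  qed (use r1 r2 in auto)
qed

text \<open>A one-sided expansion in a space variable \<open>s\<close> and the time, of second order in \<open>s\<close> and of first order in
\<open>t\<close>; mixed terms are absorbed by \<open>\<epsilon>\<close> and \<open>K\<close>.\<close>

definition taylor2 :: "(real \<Rightarrow> real \<Rightarrow> real) \<Rightarrow> real \<Rightarrow> real \<Rightarrow> real \<Rightarrow> real \<Rightarrow> real \<Rightarrow> bool" where
  "taylor2 f s t fs ft fss \<longleftrightarrow> (\<forall>\<epsilon>>0. \<exists>K. \<forall>\<^sub>F w in nhds (s, t).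
     f (fst w) (snd w) \<le> f s t + ft * (snd w - t) + fs * (fst w - s) + (fss/2 + \<epsilon>) * (fst w - s)\<^sup>2 + K * (snd w - t)\<^sup>2)"

text \<open>Mixed increments are controlled by the derivative of the time derivative:
\<open>B |\<delta>| |\<tau>| \<le> (\<epsilon>/2) \<delta>\<^sup>2 + B\<^sup>2 \<tau>\<^sup>2 / (2 \<epsilon>)\<close>.\<close>

lemma taylor2I:
  assumes fs: "\<forall>\<^sub>F s' in nhds s. ((\<lambda>s. f s t) has_real_derivative f1 s') (at s')"
    and fss: "(f1 has_real_derivative fss) (at s)"
    and ft: "\<forall>\<^sub>F w in nhds (s, t). (f (fst w) has_real_derivative f2 w) (at (snd w))"
    and f2: "f2 differentiable (at (s, t))"
  shows "taylor2 f s t (f1 s) (f2 (s, t)) fss"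
  unfolding taylor2_def
proof (intro allI impI)
  fix \<epsilon> :: real assume e: "0 < \<epsilon>"
  have P: "\<forall>\<^sub>F s' in nhds s. \<bar>f s' t - f s t - f1 s \<bullet> (s' - s) - 1/2 * ((fss * (s' - s)) \<bullet> (s' - s))\<bar> \<le> \<epsilon>/2 * (norm (s' - s))\<^sup>2"
    by (rule second_order_Taylor_Peano) (use fs fss e in \<open>auto simp: has_field_derivative_def\<close>)
  obtain f2' where f2': "(f2 has_derivative f2') (at (s, t))" using f2 unfolding differentiable_def by auto
  then have bl: "bounded_linear f2'" by (rule has_derivative_bounded_linear)
  obtain B0 where B0: "\<And>h. norm (f2' h) \<le> norm h * B0" "0 < B0" using bounded_linear.pos_bounded[OF bl] by auto
  define B where "B = B0 + 1"
  obtain d where d: "0 < d" "\<And>w. norm (w - (s,t)) < d \<Longrightarrow> norm (f2 w - f2 (s,t) - f2' (w - (s,t))) \<le> 1 * norm (w - (s,t))"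
    using f2' unfolding has_derivative_at_alt by (metis zero_less_one)
  have lip: "\<bar>f2 w - f2 (s,t)\<bar> \<le> B * norm (w - (s,t))" if "norm (w - (s,t)) < d" for w
  proof -
    have "f2 w - f2 (s,t) = (f2 w - f2 (s,t) - f2' (w - (s,t))) + f2' (w - (s,t))" by simp
    then show ?thesis using d(2)[OF that] B0(1)[of "w - (s,t)"] unfolding B_def real_norm_def
      by (simp add: algebra_simps)
  qed
  obtain r1 where r1: "0 < r1" "\<And>w. dist w (s,t) < r1 \<Longrightarrow> (f (fst w) has_real_derivative f2 w) (at (snd w))"
    using ft unfolding eventually_nhds_metric by auto
  obtain r2 where r2: "0 < r2" "\<And>s'. dist s' s < r2 \<Longrightarrow> \<bar>f s' t - f s t - f1 s * (s' - s) - 1/2 * (fss * (s' - s)\<^sup>2)\<bar> \<le> \<epsilon>/2 * (s' - s)\<^sup>2"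
    using P unfolding eventually_nhds_metric by (auto simp: power2_eq_square mult_ac)
  define r where "r = min (min r1 r2) d"
  have B: "0 < B" using B0 by (simp add: B_def)
  define K where "K = B + B\<^sup>2/(2*\<epsilon>)"
  show "\<exists>K. \<forall>\<^sub>F w in nhds (s, t). f (fst w) (snd w) \<le> f s t + f2 (s, t) * (snd w - t) + f1 s * (fst w - s)
     + (fss/2 + \<epsilon>) * (fst w - s)\<^sup>2 + K * (snd w - t)\<^sup>2"
  proof (rule exI[of _ K], unfold eventually_nhds_metric, intro exI[of _ r] conjI allI impI)
    show "0 < r" using r1 r2 d by (simp add: r_def)
    fix w assume w: "dist w (s, t) < r"
    obtain s' t' where [simp]: "w = (s', t')" by (cases w)
    define \<delta> \<tau> where "\<delta> = s' - s" and "\<tau> = t' - t"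
    have nw: "norm (w - (s,t)) < r" using w by (simp add: dist_norm)
    have near: "norm ((s', t'') - (s,t)) \<le> norm (w - (s,t)) \<and> norm ((s', t'') - (s,t)) \<le> \<bar>\<delta>\<bar> + \<bar>\<tau>\<bar>" if "\<bar>t'' - t\<bar> \<le> \<bar>\<tau>\<bar>" for t''
    proof
      have "(t'' - t)\<^sup>2 \<le> (t' - t)\<^sup>2" using that by (simp add: abs_le_square_iff \<tau>_def)
      then show "norm ((s', t'') - (s,t)) \<le> norm (w - (s,t))" by (simp add: norm_prod_def)
      show "norm ((s', t'') - (s,t)) \<le> \<bar>\<delta>\<bar> + \<bar>\<tau>\<bar>"
        using norm_Pair_le[of "s' - s" "t'' - t"] that by (simp add: \<delta>_def)
    qed
    have "\<exists>t''. \<bar>t'' - t\<bar> \<le> \<bar>\<tau>\<bar> \<and> f s' t' - f s' t = \<tau> * f2 (s', t'')"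
    proof -
      have der: "(f s' has_real_derivative f2 (s', t'')) (at t'')" if "\<bar>t'' - t\<bar> \<le> \<bar>\<tau>\<bar>" for t''
        using r1(2)[of "(s', t'')"] near[OF that] nw by (simp add: dist_norm r_def)
      consider "t' = t" | "t < t'" | "t' < t" by linarith
      then show ?thesis
      proof cases
        case 2
        obtain z where "t < z" "z < t'" "f s' t' - f s' t = (t' - t) * f2 (s', z)"
          using MVT2[of t t' "f s'" "\<lambda>z. f2 (s', z)"] der 2 by (auto simp: \<tau>_def)
        then show ?thesis by (intro exI[of _ z]) (auto simp: \<tau>_def)
      next
        case 3
        obtain z where "t' < z" "z < t" "f s' t - f s' t' = (t - t') * f2 (s', z)"
          using MVT2[of t' t "f s'" "\<lambda>z. f2 (s', z)"] der 3 by (auto simp: \<tau>_def)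
        then show ?thesis by (intro exI[of _ z]) (auto simp: \<tau>_def algebra_simps)
      qed (auto simp: \<tau>_def)
    qed
    then obtain t'' where t'': "\<bar>t'' - t\<bar> \<le> \<bar>\<tau>\<bar>" "f s' t' - f s' t = \<tau> * f2 (s', t'')" by auto
    have "\<tau> * f2 (s', t'') - \<tau> * f2 (s,t) \<le> \<bar>\<tau>\<bar> * \<bar>f2 (s', t'') - f2 (s,t)\<bar>"
      by (metis abs_ge_self abs_mult right_diff_distrib)
    also have "\<dots> \<le> \<bar>\<tau>\<bar> * (B * (\<bar>\<delta>\<bar> + \<bar>\<tau>\<bar>))"
    proof (intro mult_left_mono)
      have "\<bar>f2 (s', t'') - f2 (s,t)\<bar> \<le> B * norm ((s', t'') - (s,t))"
        using near[OF t''(1)] nw by (intro lip) (simp add: r_def)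
      also have "\<dots> \<le> B * (\<bar>\<delta>\<bar> + \<bar>\<tau>\<bar>)" using near[OF t''(1)] B by (intro mult_left_mono) auto
      finally show "\<bar>f2 (s', t'') - f2 (s,t)\<bar> \<le> B * (\<bar>\<delta>\<bar> + \<bar>\<tau>\<bar>)" .
    qed simp
    also have "\<dots> = B * (\<bar>\<tau>\<bar> * \<bar>\<delta>\<bar>) + B * \<tau>\<^sup>2" by (simp add: algebra_simps power2_eq_square)
    also have "B * (\<bar>\<tau>\<bar> * \<bar>\<delta>\<bar>) \<le> \<epsilon>/2 * \<delta>\<^sup>2 + B\<^sup>2/(2*\<epsilon>) * \<tau>\<^sup>2"
    proof -
      have "0 \<le> (\<epsilon> * \<bar>\<delta>\<bar> - B * \<bar>\<tau>\<bar>)\<^sup>2" by simp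
      then have "2 * \<epsilon> * (B * (\<bar>\<tau>\<bar> * \<bar>\<delta>\<bar>)) \<le> \<epsilon>\<^sup>2 * \<delta>\<^sup>2 + B\<^sup>2 * \<tau>\<^sup>2"
        by (simp add: power2_diff power_mult_distrib algebra_simps)
      then show ?thesis using e by (simp add: field_simps power2_eq_square)
    qed
    finally have "f s' t' - f s' t \<le> \<tau> * f2 (s,t) + \<epsilon>/2 * \<delta>\<^sup>2 + K * \<tau>\<^sup>2"
      using t''(2) by (simp add: K_def algebra_simps)
    moreover have "dist s' s < r2"
    proof -
      have "dist s' s \<le> dist w (s,t)" by (metis \<open>w = (s', t')\<close> dist_fst_le fst_conv)
      then show ?thesis using w by (simp add: r_def)
    qed
    note r2(2)[OF this]
    then have "f s' t \<le> f s t + f1 s * \<delta> + 1/2 * (fss * \<delta>\<^sup>2) + \<epsilon>/2 * \<delta>\<^sup>2"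
      unfolding \<delta>_def by linarith
    ultimately show "f (fst w) (snd w) \<le> f s t + f2 (s, t) * (snd w - t) + f1 s * (fst w - s)
       + (fss/2 + \<epsilon>) * (fst w - s)\<^sup>2 + K * (snd w - t)\<^sup>2"
      by (simp add: \<delta>_def[symmetric] \<tau>_def[symmetric] algebra_simps)
  qed
qed

lemma le_of_le_add_eps_mult:
  fixes X Y Z :: real
  assumes "\<And>\<epsilon>. 0 < \<epsilon> \<Longrightarrow> X \<le> Y + \<epsilon> * Z"
  shows "X \<le> Y"
proof (rule ccontr)
  assume "\<not> X \<le> Y"
  define e where "e = (X - Y) / (2 * (\<bar>Z\<bar> + 1))"
  have e: "0 < e" using \<open>\<not> X \<le> Y\<close> by (simp add: e_def)
  have "e * Z \<le> e * (\<bar>Z\<bar> + 1)" using e by (intro mult_left_mono) auto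
  also have "\<dots> = (X - Y) / 2" unfolding e_def by (simp add: field_simps)
  finally show False using assms[OF e] \<open>\<not> X \<le> Y\<close> by (simp add: field_simps)
qed

text \<open>A subsolution touched from above by a profile satisfies the one-dimensional equation, up to the
\<open>C\<^sup>1\<^sup>,\<^sup>1\<close> constant \<open>\<kappa>\<close> of \<open>\<psi>\<close>, which enters with its worst sign. The term \<open>k / (T - t)\<close> is the usual
penalization that keeps a maximum away from the final time; it is also the source of strictness.\<close>

lemma profile_test:
  fixes v :: "(real^'n) \<times> real \<Rightarrow> real"
  assumes jet: "jet_subsolution p \<Omega> v" and x0: "x0 \<in> \<Omega>" and t0: "0 < t0" "t0 < T" and k: "0 \<le> k"
    and tay: "taylor2 f (\<psi> x0) t0 fs ft fss" and fs: "fs \<noteq> 0"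
    and \<psi>: "\<forall>\<^sub>F z in nhds x0. \<bar>\<psi> z - \<psi> x0 - \<nu> \<bullet> (z - x0)\<bar> \<le> \<kappa> * (norm (z - x0))\<^sup>2" and \<kappa>: "0 \<le> \<kappa>"
    and touch: "\<forall>\<^sub>F w in nhds (x0, t0). v w \<le> v (x0, t0) + (f (\<psi> (fst w)) (snd w) - f (\<psi> x0) t0)
                  + (k / (T - snd w) - k / (T - t0))"
  shows "ft + k / (T - t0)\<^sup>2 \<le> fss * (norm \<nu>)\<^sup>2 * normal_coeff p + 2 * \<kappa> * \<bar>fs\<bar> * iso_coeff CARD('n) p"
proof (rule le_of_le_add_eps_mult)
  fix \<epsilon> :: real assume e: "0 < \<epsilon>"
  obtain K where K: "\<forall>\<^sub>F w in nhds (\<psi> x0, t0).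
     f (fst w) (snd w) \<le> f (\<psi> x0) t0 + ft * (snd w - t0) + fs * (fst w - \<psi> x0) + (fss/2 + \<epsilon>) * (fst w - \<psi> x0)\<^sup>2 + K * (snd w - t0)\<^sup>2"
    using tay e unfolding taylor2_def by blast
  have nt: "((\<lambda>z. norm (z - x0)) \<longlongrightarrow> 0) (nhds x0)"
  proof -
    have "isCont (\<lambda>z. norm (z - x0)) x0" by (intro continuous_intros)
    then show ?thesis by (simp add: tendsto_nhds_iff isCont_def)
  qed
  have lin: "((\<lambda>z. \<psi> x0 + \<nu> \<bullet> (z - x0)) \<longlongrightarrow> \<psi> x0) (nhds x0)"
  proof -
    have "isCont (\<lambda>z. \<psi> x0 + \<nu> \<bullet> (z - x0)) x0" by (intro continuous_intros)
    then show ?thesis by (simp add: tendsto_nhds_iff isCont_def)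
  qed
  have q0: "((\<lambda>z. \<kappa> * (norm (z - x0))\<^sup>2) \<longlongrightarrow> 0) (nhds x0)"
    using tendsto_mult[OF tendsto_const[of \<kappa>] tendsto_power[OF nt, of 2]] by simp
  have \<psi>c: "(\<psi> \<longlongrightarrow> \<psi> x0) (nhds x0)"
  proof (rule tendsto_sandwich)
    show "\<forall>\<^sub>F z in nhds x0. \<psi> x0 + \<nu> \<bullet> (z - x0) - \<kappa> * (norm (z - x0))\<^sup>2 \<le> \<psi> z"
      using \<psi> by eventually_elim linarith
    show "\<forall>\<^sub>F z in nhds x0. \<psi> z \<le> \<psi> x0 + \<nu> \<bullet> (z - x0) + \<kappa> * (norm (z - x0))\<^sup>2"
      using \<psi> by eventually_elim linarith
    show "((\<lambda>z. \<psi> x0 + \<nu> \<bullet> (z - x0) - \<kappa> * (norm (z - x0))\<^sup>2) \<longlongrightarrow> \<psi> x0) (nhds x0)"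
      using tendsto_diff[OF lin q0] by simp
    show "((\<lambda>z. \<psi> x0 + \<nu> \<bullet> (z - x0) + \<kappa> * (norm (z - x0))\<^sup>2) \<longlongrightarrow> \<psi> x0) (nhds x0)"
      using tendsto_add[OF lin q0] by simp
  qed
  have nprod: "nhds (x0, t0) = nhds x0 \<times>\<^sub>F nhds t0" by (simp add: nhds_prod)
  have fstlim: "filterlim fst (nhds x0) (nhds (x0, t0))" unfolding nprod by (rule filterlim_fst)
  have sndlim: "filterlim snd (nhds t0) (nhds (x0, t0))" unfolding nprod by (rule filterlim_snd)
  have "((\<lambda>w. (\<psi> (fst w), snd w)) \<longlongrightarrow> (\<psi> x0, t0)) (nhds (x0, t0))"
    by (intro tendsto_Pair filterlim_compose[OF \<psi>c fstlim] sndlim)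
  from filterlim_iff[THEN iffD1, OF this, rule_format, OF K]
  have ev1: "\<forall>\<^sub>F w in nhds (x0, t0). f (\<psi> (fst w)) (snd w) \<le> f (\<psi> x0) t0 + ft * (snd w - t0) + fs * (\<psi> (fst w) - \<psi> x0)
     + (fss/2 + \<epsilon>) * (\<psi> (fst w) - \<psi> x0)\<^sup>2 + K * (snd w - t0)\<^sup>2" by simp
  define A where "A = \<bar>fss/2 + \<epsilon>\<bar>"
  have small: "((\<lambda>z. A * (\<kappa> * (2 * norm \<nu> * norm (z - x0) + \<kappa> * (norm (z - x0))\<^sup>2))) \<longlongrightarrow> A * (\<kappa> * (2 * norm \<nu> * 0 + \<kappa> * 0\<^sup>2))) (nhds x0)"
    by (intro tendsto_intros nt)
  then have "\<forall>\<^sub>F z in nhds x0. A * (\<kappa> * (2 * norm \<nu> * norm (z - x0) + \<kappa> * (norm (z - x0))\<^sup>2)) < \<epsilon>"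
    using e by (intro order_tendstoD(2)[OF small]) simp
  from eventually_conj[OF \<psi> this]
  have ev2: "\<forall>\<^sub>F z in nhds x0. fs * (\<psi> z - \<psi> x0) + (fss/2 + \<epsilon>) * (\<psi> z - \<psi> x0)\<^sup>2
      \<le> fs * (\<nu> \<bullet> (z - x0)) + (fss + 2*\<epsilon>)/2 * (\<nu> \<bullet> (z - x0))\<^sup>2 + (2*\<bar>fs\<bar>*\<kappa> + 2*\<epsilon>)/2 * ((z - x0) \<bullet> (z - x0))"
  proof eventually_elim
    case (elim z)
    define n where "n = norm (z - x0)"
    define l where "l = \<nu> \<bullet> (z - x0)"
    define \<delta> where "\<delta> = \<psi> z - \<psi> x0"
    have d: "\<bar>\<delta> - l\<bar> \<le> \<kappa> * n\<^sup>2" and sm: "A * (\<kappa> * (2 * norm \<nu> * n + \<kappa> * n\<^sup>2)) < \<epsilon>"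
      using elim by (auto simp: n_def l_def \<delta>_def)
    have l: "\<bar>l\<bar> \<le> norm \<nu> * n" unfolding l_def n_def by (rule Cauchy_Schwarz_ineq2)
    have "fs * \<delta> - fs * l \<le> \<bar>fs\<bar> * \<bar>\<delta> - l\<bar>" by (metis abs_ge_self abs_mult right_diff_distrib)
    also have "\<dots> \<le> \<bar>fs\<bar> * (\<kappa> * n\<^sup>2)" using d by (intro mult_left_mono) auto
    finally have 1: "fs * \<delta> \<le> fs * l + \<bar>fs\<bar> * \<kappa> * n\<^sup>2" by simp
    have "(fss/2 + \<epsilon>) * \<delta>\<^sup>2 - (fss/2 + \<epsilon>) * l\<^sup>2 \<le> A * \<bar>\<delta>\<^sup>2 - l\<^sup>2\<bar>"
      unfolding A_def by (metis abs_ge_self abs_mult right_diff_distrib)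
    also have "\<bar>\<delta>\<^sup>2 - l\<^sup>2\<bar> = \<bar>\<delta> - l\<bar> * \<bar>\<delta> - l + 2 * l\<bar>"
      unfolding abs_mult[symmetric] by (simp add: power2_eq_square algebra_simps)
    also have "A * (\<bar>\<delta> - l\<bar> * \<bar>\<delta> - l + 2 * l\<bar>) \<le> A * ((\<kappa> * n\<^sup>2) * (2 * norm \<nu> * n + \<kappa> * n\<^sup>2))"
      using d l by (intro mult_left_mono mult_mono) (auto simp: A_def)
    also have "\<dots> = (A * (\<kappa> * (2 * norm \<nu> * n + \<kappa> * n\<^sup>2))) * n\<^sup>2" by simp
    also have "\<dots> \<le> \<epsilon> * n\<^sup>2" using sm by (intro mult_right_mono) auto
    finally have 2: "(fss/2 + \<epsilon>) * \<delta>\<^sup>2 \<le> (fss/2 + \<epsilon>) * l\<^sup>2 + \<epsilon> * n\<^sup>2" by simp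
    have n2: "(z - x0) \<bullet> (z - x0) = n\<^sup>2" by (simp add: n_def power2_norm_eq_inner)
    have "fs * l + (fss + 2*\<epsilon>)/2 * l\<^sup>2 + (2*\<bar>fs\<bar>*\<kappa> + 2*\<epsilon>)/2 * n\<^sup>2
        = fs * l + (fss/2 + \<epsilon>) * l\<^sup>2 + \<bar>fs\<bar> * \<kappa> * n\<^sup>2 + \<epsilon> * n\<^sup>2" by (simp add: field_simps)
    then show ?case unfolding n2 l_def[symmetric] \<delta>_def[symmetric] using 1 2 by linarith
  qed
  have ev2': "\<forall>\<^sub>F w in nhds (x0, t0). fs * (\<psi> (fst w) - \<psi> x0) + (fss/2 + \<epsilon>) * (\<psi> (fst w) - \<psi> x0)\<^sup>2
      \<le> fs * (\<nu> \<bullet> (fst w - x0)) + (fss + 2*\<epsilon>)/2 * (\<nu> \<bullet> (fst w - x0))\<^sup>2 + (2*\<bar>fs\<bar>*\<kappa> + 2*\<epsilon>)/2 * ((fst w - x0) \<bullet> (fst w - x0))"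
    using filterlim_iff[THEN iffD1, OF fstlim, rule_format, OF ev2] .
  define K' where "K' = 2 * k / (T - t0)^3"
  have "\<forall>\<^sub>F t in nhds t0. t < t0 + (T - t0)/2"
    using t0 by (intro eventually_nhds_in_open[of "{..<t0 + (T - t0)/2}", simplified]) auto
  then have "\<forall>\<^sub>F t in nhds t0. k / (T - t) - k / (T - t0) \<le> k / (T - t0)\<^sup>2 * (t - t0) + K' * (t - t0)\<^sup>2"
  proof eventually_elim
    case (elim t)
    define D where "D = T - t0"
    define \<tau> where "\<tau> = t - t0"
    have D: "0 < D" "D / 2 \<le> D - \<tau>" using t0 elim by (auto simp: D_def \<tau>_def field_simps)
    have D': "0 < D - \<tau>" using D by linarith
    have "k / (D - \<tau>) - k / D - k / D\<^sup>2 * \<tau> = k * \<tau>\<^sup>2 / D\<^sup>2 * (1 / (D - \<tau>))"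
      using D D' by (simp add: field_simps power2_eq_square)
    also have "\<dots> \<le> k * \<tau>\<^sup>2 / D\<^sup>2 * (2 / D)"
      using D D' k by (intro mult_left_mono) (auto simp: field_simps)
    also have "\<dots> = 2 * k / D^3 * \<tau>\<^sup>2" using D by (simp add: field_simps power2_eq_square power3_eq_cube)
    finally show ?case by (simp add: D_def \<tau>_def K'_def)
  qed
  from filterlim_iff[THEN iffD1, OF sndlim, rule_format, OF this]
  have ev3: "\<forall>\<^sub>F w in nhds (x0, t0). k / (T - snd w) - k / (T - t0) \<le> k / (T - t0)\<^sup>2 * (snd w - t0) + K' * (snd w - t0)\<^sup>2" .
  have "\<forall>\<^sub>F w in nhds (x0, t0). v w \<le> v (x0, t0) + quad_test \<nu> (ft + k / (T - t0)\<^sup>2) fs (fss + 2*\<epsilon>) (2*\<bar>fs\<bar>*\<kappa> + 2*\<epsilon>) (K + K') 0 (w - (x0, t0))"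
    using touch ev1 ev2' ev3
  proof eventually_elim
    case (elim w)
    have "quad_test \<nu> (ft + k / (T - t0)\<^sup>2) fs (fss + 2*\<epsilon>) (2*\<bar>fs\<bar>*\<kappa> + 2*\<epsilon>) (K + K') 0 (w - (x0, t0))
      = ft * (snd w - t0) + k / (T - t0)\<^sup>2 * (snd w - t0) + (fs * (\<nu> \<bullet> (fst w - x0)) + (fss + 2*\<epsilon>)/2 * (\<nu> \<bullet> (fst w - x0))\<^sup>2 + (2*\<bar>fs\<bar>*\<kappa> + 2*\<epsilon>)/2 * ((fst w - x0) \<bullet> (fst w - x0)))
        + K * (snd w - t0)\<^sup>2 + K' * (snd w - t0)\<^sup>2"
      by (simp only: quad_test_def fst_diff snd_diff fst_conv snd_conv ring_distribs mult_zero_left add_0_right add.assoc)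
    then show ?case using elim by linarith
  qed
  from jet[unfolded jet_subsolution_def, rule_format, OF x0 t0(1) fs this]
  show "ft + k / (T - t0)\<^sup>2 \<le> fss * (norm \<nu>)\<^sup>2 * normal_coeff p + 2 * \<kappa> * \<bar>fs\<bar> * iso_coeff CARD('n) p
     + \<epsilon> * (2 * (norm \<nu>)\<^sup>2 * normal_coeff p + 2 * iso_coeff CARD('n) p)"
    by (simp add: algebra_simps)
qed

text \<open>The inequality that contradicts \<open>profile_test\<close>. The second derivatives of \<open>\<psi>\<close> are only known to be
bounded by \<open>2 \<kappa>\<close>, whence the absolute value of \<open>fs\<close>.\<close>

definition supersolution_at :: "ereal \<Rightarrow> (real \<Rightarrow> real \<Rightarrow> real) \<Rightarrow> (real^'n \<Rightarrow> real) \<Rightarrow> real^'n \<Rightarrow> real \<Rightarrow> bool" where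
  "supersolution_at p f \<psi> z t \<longleftrightarrow> (\<exists>fs ft fss \<nu> \<kappa>. taylor2 f (\<psi> z) t fs ft fss \<and> fs \<noteq> 0 \<and> 0 \<le> \<kappa> \<and>
         (\<forall>\<^sub>F z' in nhds z. \<bar>\<psi> z' - \<psi> z - \<nu> \<bullet> (z' - z)\<bar> \<le> \<kappa> * (norm (z' - z))\<^sup>2) \<and>
         fss * (norm \<nu>)\<^sup>2 * normal_coeff p + 2 * \<kappa> * \<bar>fs\<bar> * iso_coeff CARD('n) p \<le> ft)"

lemma supersolution_atI:
  fixes \<psi> :: "real^'n \<Rightarrow> real"
  assumes "taylor2 f (\<psi> z) t fs ft fss" "fs \<noteq> 0" "0 \<le> \<kappa>"
    "\<forall>\<^sub>F z' in nhds z. \<bar>\<psi> z' - \<psi> z - \<nu> \<bullet> (z' - z)\<bar> \<le> \<kappa> * (norm (z' - z))\<^sup>2"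
    "fss * (norm \<nu>)\<^sup>2 * normal_coeff p + 2 * \<kappa> * \<bar>fs\<bar> * iso_coeff CARD('n) p \<le> ft"
  shows "supersolution_at p f \<psi> z t"
  unfolding supersolution_at_def using assms by blast

text \<open>If the conclusion fails, then \<open>v - f(\<psi>, t) - k / (T - t)\<close> has a positive maximum: its superlevel set at a
positive height is compact, because the boundary condition keeps it away from the boundary and the penalty
away from the time \<open>T\<close>. The profile touches at the maximum. The equation is required only where \<open>v\<close> exceeds the
profile, which frees the barriers from having to be supersolutions where they are already large.\<close>

lemma comparison_with_profile:
  fixes v :: "(real^'n) \<times> real \<Rightarrow> real"
  assumes jet: "jet_subsolution p \<Omega> v" and V: "V \<subseteq> \<Omega>" "open V" "bounded V" 
    and vc: "continuous_on (V \<times> {0<..<T}) v" and vM: "\<And>z t. z \<in> V \<Longrightarrow> 0 < t \<Longrightarrow> t < T \<Longrightarrow> v (z, t) \<le> M"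
    and wc: "continuous_on (V \<times> {0<..<T}) (\<lambda>q. f (\<psi> (fst q)) (snd q))"
    and wM: "\<And>z t. z \<in> V \<Longrightarrow> 0 < t \<Longrightarrow> t < T \<Longrightarrow> - M' \<le> f (\<psi> z) t"
    and bdry: "\<And>z t. z \<in> closure V \<Longrightarrow> 0 \<le> t \<Longrightarrow> t < T \<Longrightarrow> \<not> (z \<in> V \<and> 0 < t) \<Longrightarrow>
       \<forall>\<^sub>F q in at (z, t) within V \<times> {0<..<T}. v q \<le> f (\<psi> (fst q)) (snd q)"
    and pde: "\<And>z t. z \<in> V \<Longrightarrow> 0 < t \<Longrightarrow> t < T \<Longrightarrow> f (\<psi> z) t < v (z, t) \<Longrightarrow>
       supersolution_at p f \<psi> z t"
    and z: "z \<in> V" and t: "0 < t" "t < T"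
  shows "v (z, t) \<le> f (\<psi> z) t"
proof (rule ccontr)
  assume neg: "\<not> v (z, t) \<le> f (\<psi> z) t"
  define D where "D = V \<times> {0<..<T}"
  \<comment> \<open>so small that the penalized difference is still positive at \<open>(z, t)\<close>\<close>
  define k where "k = (v (z, t) - f (\<psi> z) t) * (T - t) / 2"
  have k: "0 < k" using neg t by (simp add: k_def)
  define g where "g q = v q - f (\<psi> (fst q)) (snd q) - k / (T - snd q)" for q
  define c where "c = g (z, t)"
  have "k / (T - t) = (v (z, t) - f (\<psi> z) t) / 2"
  proof -
    have "a * m / 2 / m = a / 2" if "m \<noteq> 0" for a m :: real using that by simp
    then show ?thesis unfolding k_def using t by (metis diff_gt_0_iff_gt less_irrefl)
  qed
  then have c: "0 < c" using neg by (simp add: c_def g_def field_simps)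
  define S where "S = {q \<in> D. c \<le> g q}"
  have zt: "(z, t) \<in> D" using z t by (simp add: D_def)
  have opD: "open D" unfolding D_def by (intro open_Times V open_greaterThanLessThan)
  have gc: "continuous_on D g" unfolding g_def D_def
    by (intro continuous_intros vc wc) auto
  define P where "P = \<bar>M\<bar> + \<bar>M'\<bar> + 1"
  have P: "0 < P" by (simp add: P_def)
  have timebd: "snd q \<le> T - k / P" if "q \<in> S" for q
  proof -
    have q: "fst q \<in> V" "0 < snd q" "snd q < T" "0 < g q" using that c by (auto simp: S_def D_def)
    have "k / (T - snd q) < P"
      using vM[OF q(1-3)] wM[OF q(1-3)] q(4) unfolding g_def P_def by simp
    then have "k < P * (T - snd q)" using q(3) by (simp add: divide_less_eq)
    then have "k / P < T - snd q" using P by (simp add: divide_less_eq mult.commute)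
    then show ?thesis by simp
  qed
  have "compact S" unfolding compact_eq_bounded_closed
  proof
    have "bounded D" unfolding D_def using V by (intro bounded_Times) auto
    then show "bounded S" by (rule bounded_subset) (auto simp: S_def)
    show "closed S" unfolding closed_sequential_limits
    proof (intro allI impI, elim conjE)
      fix X q assume X: "\<forall>n. X n \<in> S" "X \<longlonglongrightarrow> q"
      have XD: "X n \<in> D" for n using X by (auto simp: S_def)
      have fl: "(\<lambda>n. fst (X n)) \<longlonglongrightarrow> fst q" "(\<lambda>n. snd (X n)) \<longlonglongrightarrow> snd q"
        using X(2) by (auto intro: tendsto_intros)
      have cl: "fst q \<in> closure V" unfolding closure_sequential using fl(1) XD by (intro exI[of _ "\<lambda>n. fst (X n)"]) (auto simp: D_def mem_Times_iff)
      have t0: "0 \<le> snd q" by (rule LIMSEQ_le_const[OF fl(2)]) (use XD in \<open>auto simp: D_def mem_Times_iff less_imp_le\<close>)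
      have "snd q \<le> T - k / P" by (rule LIMSEQ_le_const2[OF fl(2)]) (use timebd X in auto)
      then have t1: "snd q < T" using divide_pos_pos[OF k P] by linarith
      show "q \<in> S"
      proof (cases "q \<in> D")
        case True
        have "(\<lambda>n. g (X n)) \<longlonglongrightarrow> g q" using gc True XD X(2) unfolding continuous_on_sequentially comp_def by blast
        then have "c \<le> g q" by (rule LIMSEQ_le_const) (use X in \<open>auto simp: S_def\<close>)
        then show ?thesis using True by (simp add: S_def)
      next
        case False
        then have "\<not> (fst q \<in> V \<and> 0 < snd q)" using t1 by (auto simp: D_def mem_Times_iff)
        from bdry[OF cl t0 t1 this]
        have ev: "\<forall>\<^sub>F q' in at q within D. v q' \<le> f (\<psi> (fst q')) (snd q')" by (simp add: D_def)
        have "filterlim X (at q within D) sequentially"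
          unfolding filterlim_at using X(2) XD False by (auto intro!: always_eventually)
        from filterlim_iff[THEN iffD1, OF this, rule_format, OF ev]
        obtain n where "v (X n) \<le> f (\<psi> (fst (X n))) (snd (X n))" by (auto simp: eventually_sequentially)
        moreover have "0 < k / (T - snd (X n))" using k XD[of n] by (auto simp: D_def mem_Times_iff)
        ultimately have "g (X n) < 0" by (simp add: g_def)
        moreover have "c \<le> g (X n)" using X by (auto simp: S_def)
        ultimately show ?thesis using c by simp
      qed
    qed
  qed
  moreover have "S \<noteq> {}" using zt by (auto simp: S_def c_def)
  moreover have "continuous_on S g" using gc by (rule continuous_on_subset) (auto simp: S_def)
  ultimately obtain q where q: "q \<in> S" "\<And>q'. q' \<in> S \<Longrightarrow> g q' \<le> g q"
    using continuous_attains_sup by metis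
  obtain x0 t0 where q_eq: "q = (x0, t0)" by (cases q)
  have x0: "x0 \<in> V" "0 < t0" "t0 < T" "q \<in> D" "c \<le> g q" using q(1) by (auto simp: S_def D_def q_eq)
  have max: "g q' \<le> g q" if "q' \<in> D" for q' using q(2)[of q'] x0 that by (cases "q' \<in> S") (auto simp: S_def)
  have "0 < k / (T - t0)" using k x0 by simp
  then have "f (\<psi> x0) t0 < v (x0, t0)" using x0(5) c unfolding g_def q_eq by simp
  from pde[OF x0(1-3) this, unfolded supersolution_at_def] obtain fs ft fss \<nu> \<kappa> where h: "taylor2 f (\<psi> x0) t0 fs ft fss" "fs \<noteq> 0" "0 \<le> \<kappa>"
      "\<forall>\<^sub>F z' in nhds x0. \<bar>\<psi> z' - \<psi> x0 - \<nu> \<bullet> (z' - x0)\<bar> \<le> \<kappa> * (norm (z' - x0))\<^sup>2"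
      "fss * (norm \<nu>)\<^sup>2 * normal_coeff p + 2 * \<kappa> * \<bar>fs\<bar> * iso_coeff CARD('n) p \<le> ft" by auto
  have "\<forall>\<^sub>F w in nhds (x0, t0). w \<in> D" using opD x0(4) by (simp add: eventually_nhds_in_open q_eq)
  then have "\<forall>\<^sub>F w in nhds (x0, t0). v w \<le> v (x0, t0) + (f (\<psi> (fst w)) (snd w) - f (\<psi> x0) t0)
                  + (k / (T - snd w) - k / (T - t0))"
  proof eventually_elim
    case (elim w)
    from max[OF this] show ?case by (simp add: g_def q_eq)
  qed
  from profile_test[OF jet _ x0(2,3) _ h(1,2,4,3) this] V(1) x0(1) k
  have "ft + k / (T - t0)\<^sup>2 \<le> fss * (norm \<nu>)\<^sup>2 * normal_coeff p + 2 * \<kappa> * \<bar>fs\<bar> * iso_coeff CARD('n) p" by auto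
  moreover have "0 < k / (T - t0)\<^sup>2" using k x0 by simp
  ultimately show False using h(5) by linarith
qed

section \<open>The error function and Gaussian moments\<close>

definition gauss :: "real \<Rightarrow> real" where "gauss x = 2 / sqrt pi * exp (- x\<^sup>2)"
definition Erf :: "real \<Rightarrow> real" where "Erf x = (LBINT y=0..ereal x. gauss y)"

lemma gauss_pos: "0 < gauss x" by (simp add: gauss_def)

lemma gauss_deriv: "(gauss has_real_derivative (- 2 * x * gauss x)) (at x)"
  unfolding gauss_def by (rule derivative_eq_intros refl | simp)+

lemma continuous_gauss: "continuous_on A gauss"
  unfolding gauss_def by (intro continuous_intros)

lemma Erf_deriv: "(Erf has_real_derivative gauss x) (at x)"
proof -
  define b where "b = \<bar>x\<bar> + 1"
  have "((\<lambda>u. LBINT y=ereal 0..ereal u. gauss y) has_vector_derivative gauss x) (at x within {-b..b})"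
    by (rule interval_integral_FTC2[of "-b" 0 b]) (auto simp: b_def continuous_gauss)
  then have "(Erf has_vector_derivative gauss x) (at x within {-b..b})"
    by (simp add: Erf_def[abs_def] zero_ereal_def)
  moreover have "at x within {-b..b} = at x" by (rule at_within_interior) (auto simp: b_def)
  ultimately show ?thesis by (simp add: has_real_derivative_iff_has_vector_derivative)
qed

lemma Erf_0 [simp]: "Erf 0 = 0" by (simp add: Erf_def zero_ereal_def)

lemma Erf_strict_mono: "strict_mono Erf"
  by (rule DERIV_pos_imp_increasing[THEN strict_monoI]) (auto intro!: exI[of _ "gauss _"] Erf_deriv gauss_pos)

text \<open>Substituting \<open>x = \<surd>t\<close> turns the moment into an Euler integral.\<close>

lemma gaussian_moment_half_line:
  fixes b :: real assumes b: "0 \<le> b"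
  shows "set_integrable lborel {0<..} (\<lambda>x. x powr b * exp (- x\<^sup>2))"
    and "(LINT x:{0<..}|lborel. x powr b * exp (- x\<^sup>2)) = Gamma ((b + 1) / 2) / 2"
proof -
  define h :: "real \<Rightarrow> real" where "h t = t powr ((b + 1) / 2 - 1) / exp t / 2" for t
  have hG: "((\<lambda>t. t powr ((b + 1) / 2 - 1) / exp t) has_integral Gamma ((b + 1)/2)) {0..}"
    using Gamma_integral_real[of "(b+1)/2"] b by simp
  have nn: "(\<integral>\<^sup>+t. ennreal (t powr ((b + 1) / 2 - 1) / exp t * indicator {0..} t) \<partial>lborel) = ennreal (Gamma ((b + 1)/2))"
    using nn_integral_has_integral_lebesgue[OF _ hG] by (simp add: mult.commute)
  have si: "set_integrable lborel {0<..} h" and sv: "(LINT t:{0<..}|lborel. h t) = Gamma ((b + 1)/2) / 2"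
  proof -
    have hb: "has_bochner_integral lborel (\<lambda>t. t powr ((b + 1) / 2 - 1) / exp t * indicator {0..} t) (Gamma ((b + 1)/2))"
      by (rule has_bochner_integral_nn_integral) (use nn b in \<open>auto simp: indicator_def intro!: Gamma_real_nonneg\<close>)
    have eq: "indicator {0<..} t *\<^sub>R h t = (t powr ((b + 1) / 2 - 1) / exp t * indicator {0..} t) / 2" for t :: real
      by (auto simp: h_def indicator_def)
    show "set_integrable lborel {0<..} h" unfolding set_integrable_def eq
      by (rule integrable_divide) (use hb in \<open>simp add: has_bochner_integral_iff\<close>)
    show "(LINT t:{0<..}|lborel. h t) = Gamma ((b + 1)/2) / 2" unfolding set_lebesgue_integral_def eq
      using has_bochner_integral_integral_eq[OF hb] by (simp only: integral_divide_zero)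
  qed
  let ?f = "\<lambda>x::real. x powr b * exp (- x\<^sup>2)"
  have eq: "?f (sqrt t) * (inverse (sqrt t) / 2) = h t" if "0 < t" for t
  proof -
    have "sqrt t powr b * inverse (sqrt t) = t powr (b/2) * t powr (-1/2)"
      using that by (simp add: powr_half_sqrt[symmetric] powr_powr powr_minus)
    also have "\<dots> = t powr ((b+1)/2 - 1)" by (simp add: powr_add[symmetric] field_simps)
    finally show ?thesis using that by (simp add: h_def exp_minus field_simps)
  qed
  have ein: "einterval 0 \<infinity> = {0<..}" by (auto simp: einterval_def zero_ereal_def)
  have "set_integrable lborel (einterval 0 \<infinity>) ?f \<and> (LBINT x=0..\<infinity>. ?f x) = (LBINT x=0..\<infinity>. ?f (sqrt x) * (inverse (sqrt x) / 2))"
  proof (intro conjI)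
    note sub = interval_integral_substitution_nonneg[of 0 \<infinity> sqrt "\<lambda>t. inverse (sqrt t) / 2" ?f 0 \<infinity>]
    have prem: "(((ereal \<circ> sqrt \<circ> real_of_ereal) \<longlongrightarrow> 0) (at_right 0))"
      "(((ereal \<circ> sqrt \<circ> real_of_ereal) \<longlongrightarrow> \<infinity>) (at_left \<infinity>))"
    proof -
      have "((\<lambda>x. ereal (sqrt x)) \<longlongrightarrow> ereal (sqrt 0)) (at_right 0)"
        by (intro tendsto_intros)
      then have "(((\<lambda>x. ereal (sqrt x)) \<circ> real_of_ereal) \<longlongrightarrow> ereal (sqrt 0)) (at_right (ereal 0))"
        by (subst ereal_tendsto_simps)
      then show "(((ereal \<circ> sqrt \<circ> real_of_ereal) \<longlongrightarrow> 0) (at_right 0))"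
        by (simp add: zero_ereal_def comp_def)
      show "(((ereal \<circ> sqrt \<circ> real_of_ereal) \<longlongrightarrow> \<infinity>) (at_left \<infinity>))"
      proof -
        have "((\<lambda>x. ereal (sqrt x)) \<longlongrightarrow> \<infinity>) at_top"
          by (simp add: tendsto_PInfty_eq_at_top sqrt_at_top)
        then have "(((\<lambda>x. ereal (sqrt x)) \<circ> real_of_ereal) \<longlongrightarrow> \<infinity>) (at_left \<infinity>)"
          by (subst ereal_tendsto_simps)
        then show ?thesis by (simp add: comp_def)
      qed
    qed
    have si': "set_integrable lborel (einterval 0 \<infinity>) (\<lambda>x. ?f (sqrt x) * (inverse (sqrt x) / 2))"
      unfolding ein using si set_integrable_cong[of lborel lborel "{0<..}" "{0<..}" "\<lambda>t. ?f (sqrt t) * (inverse (sqrt t) / 2)" h] eq by simp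
    show "set_integrable lborel (einterval 0 \<infinity>) ?f"
      by (rule sub(1)) (use prem si' in \<open>auto intro!: DERIV_real_sqrt[THEN DERIV_cong] continuous_intros simp: zero_ereal_def field_simps\<close>)
    show "(LBINT x=0..\<infinity>. ?f x) = (LBINT x=0..\<infinity>. ?f (sqrt x) * (inverse (sqrt x) / 2))"
      by (rule sub(2)) (use prem si' in \<open>auto intro!: DERIV_real_sqrt[THEN DERIV_cong] continuous_intros simp: zero_ereal_def field_simps\<close>)
  qed
  moreover have "(LINT x:{0<..}|lborel. ?f (sqrt x) * (inverse (sqrt x) / 2)) = (LINT x:{0<..}|lborel. h x)"
    by (rule set_lebesgue_integral_cong) (use eq in auto)
  ultimately show "set_integrable lborel {0<..} ?f" and "(LINT x:{0<..}|lborel. ?f x) = Gamma ((b + 1) / 2) / 2"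
    unfolding ein interval_lebesgue_integral_def sv[symmetric] by (auto simp: ein)
qed

lemma Erf_mono: "x \<le> y \<Longrightarrow> Erf x \<le> Erf y"
  using Erf_strict_mono by (simp add: strict_mono_less_eq)

lemma Erf_pos: "0 < x \<Longrightarrow> 0 < Erf x"
  using strict_monoD[OF Erf_strict_mono, of 0 x] by simp

lemma Erf_nonpos: "x \<le> 0 \<Longrightarrow> Erf x \<le> 0"
  using Erf_mono[of x 0] by simp

lemma Erf_nonneg: "0 \<le> x \<Longrightarrow> 0 \<le> Erf x"
  using Erf_mono[of 0 x] by simp

lemma Erf_tendsto_1: "(Erf \<longlongrightarrow> 1) at_top"
proof -
  have si: "set_integrable lborel {0<..} gauss" and sv: "(LINT x:{0<..}|lborel. gauss x) = 1"
  proof -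
    have eq: "indicator {0<..} x *\<^sub>R gauss x = (2 / sqrt pi) * (indicator {0<..} x *\<^sub>R (x powr 0 * exp (- x\<^sup>2)))" for x :: real
      by (auto simp: gauss_def indicator_def)
    note m = gaussian_moment_half_line[of 0]
    show "set_integrable lborel {0<..} gauss" unfolding set_integrable_def eq
      using m(1) by (intro integrable_mult_right) (simp add: set_integrable_def)
    show "(LINT x:{0<..}|lborel. gauss x) = 1" unfolding set_lebesgue_integral_def eq
      using m(2) by (simp add: set_lebesgue_integral_def Gamma_one_half_real)
  qed
  have ae: "AE x in lborel. x \<noteq> (0::real)" by (rule AE_lborel_singleton)
  have si0: "set_integrable lborel {0..} gauss"
  proof -
    have "integrable lborel (\<lambda>x. indicator {0..} x *\<^sub>R gauss x) \<longleftrightarrow> integrable lborel (\<lambda>x. indicator {0<..} x *\<^sub>R gauss x)"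
      using ae by (intro integrable_cong_AE) (auto simp: indicator_def gauss_def elim!: eventually_mono)
    then show ?thesis using si by (simp add: set_integrable_def)
  qed
  have sv0: "(LINT x:{0..}|lborel. gauss x) = 1"
  proof -
    have "(LINT x:{0..}|lborel. gauss x) = (LINT x:{0<..}|lborel. gauss x)"
      unfolding set_lebesgue_integral_def using ae
      by (intro integral_cong_AE) (auto simp: indicator_def gauss_def elim!: eventually_mono)
    then show ?thesis using sv by simp
  qed
  have "((\<lambda>b. LINT x:{0..b}|lborel. gauss x) \<longlongrightarrow> (LINT x:{0..}|lborel. gauss x)) at_top"
    by (rule tendsto_set_lebesgue_integral_at_top[OF _ si0]) simp
  moreover have "\<forall>\<^sub>F b in at_top. (LINT x:{0..b}|lborel. gauss x) = Erf b"
    using eventually_ge_at_top[of 0]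
    by eventually_elim (simp add: Erf_def zero_ereal_def interval_integral_Icc)
  ultimately show ?thesis unfolding sv0 by (rule Lim_transform_eventually)
qed

lemma Erf_less_1: "Erf x < 1"
proof -
  have "Erf (x + 1) \<le> 1"
    by (rule tendsto_lowerbound[OF Erf_tendsto_1]) (auto intro: eventually_at_top_linorderI[of "x+1"] Erf_mono)
  then show ?thesis using strict_monoD[OF Erf_strict_mono, of x "x+1"] by simp
qed

text \<open>\<open>Erf x + exp(-x\<^sup>2)\<close> is nonincreasing for \<open>x \<ge> 1\<close> and tends to 1.\<close>

lemma Erf_tail: "1 \<le> x \<Longrightarrow> 1 - Erf x \<le> exp (- x\<^sup>2)"
proof -
  assume x: "1 \<le> x"
  define \<phi> where "\<phi> y = Erf y + exp (- y\<^sup>2)" for y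
  have "\<phi> y \<le> \<phi> x" if "x \<le> y" for y
  proof (rule DERIV_nonpos_imp_nonincreasing[OF that])
    fix z assume z: "x \<le> z" "z \<le> y"
    have "(\<phi> has_real_derivative (gauss z - 2 * z * exp (- z\<^sup>2))) (at z)"
      unfolding \<phi>_def by (rule derivative_eq_intros Erf_deriv refl | simp)+
    moreover have "1 \<le> sqrt pi" using pi_gt3 by simp
    then have "2 / sqrt pi \<le> 2 * z" using x z by (simp add: divide_le_eq mult_le_one[of 1] mult_mono[of 1 z 1 "sqrt pi", simplified])
    then have "gauss z - 2 * z * exp (- z\<^sup>2) \<le> 0" unfolding gauss_def using mult_right_mono by fastforce
    ultimately show "\<exists>d. (\<phi> has_real_derivative d) (at z) \<and> d \<le> 0" by blast
  qed
  moreover have "(\<phi> \<longlongrightarrow> 1 + 0) at_top" unfolding \<phi>_def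
  proof (intro tendsto_add Erf_tendsto_1)
    show "((\<lambda>y::real. exp (- y\<^sup>2)) \<longlongrightarrow> 0) at_top"
      by (rule filterlim_compose[OF exp_at_bot]) 
         (auto simp: filterlim_uminus_at_bot intro!: filterlim_pow_at_top filterlim_ident)
  qed
  ultimately have "1 \<le> \<phi> x"
    by (intro tendsto_upperbound[of \<phi> 1 at_top]) (auto intro: eventually_at_top_linorderI[of x])
  then show ?thesis by (simp add: \<phi>_def)
qed

lemma nn_integral_gauss_tail:
  assumes "0 \<le> x"
  shows "(\<integral>\<^sup>+ \<tau>. ennreal (gauss \<tau>) * indicator {x..} \<tau> \<partial>lborel) = ennreal (1 - Erf x)"
  by (rule nn_integral_FTC_atLeast) (auto intro!: borel_measurable_continuous_onI continuous_gauss Erf_tendsto_1 Erf_deriv less_imp_le[OF gauss_pos])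

section \<open>Heat profiles\<close>

text \<open>Affine functions of the self-similar solution of a one-dimensional heat equation, with a shift \<open>k\<close> of the
origin and a drift \<open>c\<close>.\<close>

definition heat_profile :: "real \<Rightarrow> real \<Rightarrow> real \<Rightarrow> real \<Rightarrow> real \<Rightarrow> real \<Rightarrow> real \<Rightarrow> real" where
  "heat_profile A B a k c s t = B + A * Erf (a * ((s + k + c * t) / sqrt t))"

lemma taylor2_heat_profile:
  fixes s k c t A B a :: real
  assumes t: "0 < t"
  defines "\<sigma> \<equiv> (s + k + c * t) / sqrt t"
  shows "taylor2 (heat_profile A B a k c) s t (A * a * gauss (a * \<sigma>) / sqrt t)
     (A * a * gauss (a * \<sigma>) * (c * sqrt t - \<sigma> / 2) / t) (- 2 * a^3 * \<sigma> * A * gauss (a * \<sigma>) / t)"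
proof -
  define f1 where "f1 s' = A * (a / sqrt t) * gauss (a * ((s' + k + c * t) / sqrt t))" for s'
  define f2 where "f2 w = A * (a * (c / sqrt (snd w) - (fst w + k + c * snd w) / (2 * snd w * sqrt (snd w))))
     * (2 / sqrt pi * exp (- (a * ((fst w + k + c * snd w) / sqrt (snd w)))\<^sup>2))" for w :: "real \<times> real"
  have "taylor2 (heat_profile A B a k c) s t (f1 s) (f2 (s, t)) (- 2 * a^3 * \<sigma> * A * gauss (a * \<sigma>) / t)"
  proof (rule taylor2I)
    show "\<forall>\<^sub>F s' in nhds s. ((\<lambda>s. heat_profile A B a k c s t) has_real_derivative f1 s') (at s')"
    proof (intro always_eventually allI)
      fix s'
      have "((\<lambda>s. s + k + c * t) has_real_derivative 1) (at s')"
        by (auto intro!: derivative_eq_intros)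
      from DERIV_cmult[OF DERIV_cdivide[OF this, of "sqrt t"], of a]
      have "((\<lambda>s. a * ((s + k + c * t) / sqrt t)) has_real_derivative a / sqrt t) (at s')"
        by simp
      from DERIV_chain2[OF Erf_deriv this]
      have "((\<lambda>s. Erf (a * ((s + k + c * t) / sqrt t))) has_real_derivative
         gauss (a * ((s' + k + c * t) / sqrt t)) * (a / sqrt t)) (at s')" .
      from DERIV_add[OF DERIV_const DERIV_cmult[OF this]]
      show "((\<lambda>s. heat_profile A B a k c s t) has_real_derivative f1 s') (at s')"
        unfolding heat_profile_def f1_def by (simp add: mult_ac)
    qed
    have "(f1 has_real_derivative (A * (a / sqrt t) * ((- 2 * (a * \<sigma>) * gauss (a * \<sigma>)) * (a / sqrt t)))) (at s)"
    proof -
      have "((\<lambda>s. s + k + c * t) has_real_derivative 1) (at s)"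
        by (auto intro!: derivative_eq_intros)
      from DERIV_cmult[OF DERIV_cdivide[OF this, of "sqrt t"], of a]
      have "((\<lambda>s. a * ((s + k + c * t) / sqrt t)) has_real_derivative a / sqrt t) (at s)"
        by simp
      from DERIV_cmult[OF DERIV_chain2[OF gauss_deriv this], of "A * (a / sqrt t)"]
      show ?thesis unfolding f1_def \<sigma>_def .
    qed
    moreover have "A * (a / sqrt t) * ((- 2 * (a * \<sigma>) * gauss (a * \<sigma>)) * (a / sqrt t)) = - 2 * a^3 * \<sigma> * A * gauss (a * \<sigma>) / t"
    proof -
      have "A * (a / sqrt t) * ((- 2 * (a * \<sigma>) * g) * (a / sqrt t)) = - 2 * a^3 * \<sigma> * A * g / (sqrt t * sqrt t)" for g
        by (simp add: power3_eq_cube)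
      then show ?thesis using t by simp
    qed
    ultimately show "(f1 has_real_derivative - 2 * a^3 * \<sigma> * A * gauss (a * \<sigma>) / t) (at s)" by simp
    have "open {w :: real \<times> real. 0 < snd w}" by (intro open_Collect_less continuous_intros)
    then have "\<forall>\<^sub>F w in nhds (s, t). 0 < snd w" using t eventually_nhds_in_open[of "{w. 0 < snd w}" "(s,t)"] by simp
    then show "\<forall>\<^sub>F w in nhds (s, t). (heat_profile A B a k c (fst w) has_real_derivative f2 w) (at (snd w))"
    proof eventually_elim
      case (elim w)
      obtain s' t' where [simp]: "w = (s', t')" by (cases w)
      have t': "0 < t'" using elim by simp
      have "((\<lambda>t. (s' + k + c * t) / sqrt t) has_real_derivative
          (c * sqrt t' - (s' + k + c * t') * (inverse (sqrt t') / 2)) / (sqrt t' * sqrt t')) (at t')"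
        by (rule DERIV_divide derivative_eq_intros DERIV_real_sqrt refl | use t' in simp)+
      moreover have "(c * sqrt t' - (s' + k + c * t') * (inverse (sqrt t') / 2)) / (sqrt t' * sqrt t')
          = c / sqrt t' - (s' + k + c * t') / (2 * t' * sqrt t')" 
      proof -
        define q where "q = sqrt t'"
        have q: "0 < q" "t' = q * q" using t' by (auto simp: q_def)
        have "(c * q - X * (inverse q / 2)) / (q * q) = c / q - X / (2 * (q * q) * q)" for X
          using q(1) by (simp add: field_simps)
        then show ?thesis unfolding q_def[symmetric] q(2)[symmetric] by (metis q(2))
      qed
      ultimately have d: "((\<lambda>t. (s' + k + c * t) / sqrt t) has_real_derivative
          (c / sqrt t' - (s' + k + c * t') / (2 * t' * sqrt t'))) (at t')" by simp
      from DERIV_add[OF DERIV_const DERIV_cmult[OF DERIV_chain2[OF Erf_deriv DERIV_cmult[OF d, of a]], of A]]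
      show ?case unfolding heat_profile_def[abs_def] f2_def by (simp add: gauss_def mult_ac)
    qed
    show "f2 differentiable (at (s, t))"
      unfolding f2_def differentiable_def
      by (rule exI, (rule derivative_intros | (use t in \<open>simp; fail\<close>))+)
  qed
  moreover have "f1 s = A * a * gauss (a * \<sigma>) / sqrt t" by (simp add: f1_def \<sigma>_def)
  moreover have "f2 (s, t) = A * a * gauss (a * \<sigma>) * (c * sqrt t - \<sigma> / 2) / t"
  proof -
    have "c / sqrt t - (s + k + c * t) / (2 * t * sqrt t) = (c * sqrt t - \<sigma> / 2) / t"
    proof -
      define q where "q = sqrt t"
      have q: "0 < q" "t = q * q" using t by (auto simp: q_def)
      have "c / q - X / (2 * (q * q) * q) = (c * q - X / q / 2) / (q * q)" for X
        using q(1) by (simp add: field_simps)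
      then show ?thesis unfolding \<sigma>_def q_def[symmetric] by (metis q(2))
    qed
    then have "f2 (s, t) = A * (a * ((c * sqrt t - \<sigma> / 2) / t)) * gauss (a * \<sigma>)"
      by (simp add: f2_def gauss_def \<sigma>_def)
    then show ?thesis by simp
  qed
  ultimately show ?thesis by simp
qed

lemma recip_bounds: "1 < p \<Longrightarrow> 0 \<le> recip p \<and> recip p < 1"
  unfolding recip_def by (cases p) (auto simp: one_ereal_def field_simps)

lemma normal_coeff_bounds: "1 < p \<Longrightarrow> 0 < normal_coeff p \<and> normal_coeff p \<le> 1"
  using recip_bounds[of p] by (simp add: normal_coeff_def)

lemma iso_coeff_nonneg: "1 < p \<Longrightarrow> 2 \<le> N \<Longrightarrow> 0 \<le> iso_coeff N p"
  using recip_bounds[of p] mult_left_mono[of 2 "real N" "recip p"] by (simp add: iso_coeff_def)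

text \<open>With \<open>\<sigma>\<close> the self-similar variable and \<open>G = a gauss(a \<sigma>) / t\<close>, the three terms of the equation are \<open>A G\<close> times
\<open>-2 a\<^sup>2 \<sigma> n\<^sup>2 q\<close>, \<open>\<plusminus> 2 \<kappa> C \<surd>t\<close> and \<open>c \<surd>t - \<sigma>/2\<close>. The sign of \<open>A\<close> decides on which side the diffusivity
\<open>1 / (4 a\<^sup>2)\<close> of the profile must lie from \<open>n\<^sup>2 q\<close>, and the drift compensates the term with \<open>\<kappa>\<close>.\<close>

lemma heat_profile_supersolution:
  fixes a A c k s t \<kappa> n q C :: real
  assumes t: "0 < t" and a: "0 < a" and \<kappa>: "0 \<le> \<kappa>" and C: "0 \<le> C"
    and alt: "(0 < A \<and> 1 \<le> 4 * a\<^sup>2 * n\<^sup>2 * q \<and> 2 * \<kappa> * C \<le> c) \<or> (A < 0 \<and> 4 * a\<^sup>2 * n\<^sup>2 * q \<le> 1 \<and> c \<le> - 2 * \<kappa> * C)"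
  defines "\<sigma> \<equiv> (s + k + c * t) / sqrt t"
  assumes \<sigma>: "0 \<le> \<sigma>"
  shows "(- 2 * a^3 * \<sigma> * A * gauss (a * \<sigma>) / t) * n\<^sup>2 * q + 2 * \<kappa> * \<bar>A * a * gauss (a * \<sigma>) / sqrt t\<bar> * C
     \<le> A * a * gauss (a * \<sigma>) * (c * sqrt t - \<sigma> / 2) / t"
proof -
  define r where "r = sqrt t"
  define G where "G = a * gauss (a * \<sigma>) / t"
  have r: "0 < r" "t = r * r" using t by (auto simp: r_def)
  have G: "0 < G" using a t by (simp add: G_def gauss_pos)
  have eG: "a * gauss (a * \<sigma>) = G * (r * r)" using r by (simp add: G_def)
  have e1: "(- 2 * a^3 * \<sigma> * A * gauss (a * \<sigma>) / t) = - 2 * a\<^sup>2 * \<sigma> * A * G"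
    by (simp add: G_def power3_eq_cube power2_eq_square)
  have e2: "\<bar>A * a * gauss (a * \<sigma>) / sqrt t\<bar> = \<bar>A\<bar> * G * r"
  proof -
    have "A * a * gauss (a * \<sigma>) / sqrt t = A * G * r"
      using eG r by (simp add: r_def[symmetric] mult.assoc)
    then show ?thesis using G r by (simp add: abs_mult)
  qed
  have e3: "A * a * gauss (a * \<sigma>) * (c * sqrt t - \<sigma> / 2) / t = A * G * (c * r - \<sigma> / 2)"
    by (simp add: G_def r_def)
  from alt show ?thesis
  proof
    assume h: "0 < A \<and> 1 \<le> 4 * a\<^sup>2 * n\<^sup>2 * q \<and> 2 * \<kappa> * C \<le> c"
    have "\<sigma> * 1 \<le> \<sigma> * (4 * a\<^sup>2 * n\<^sup>2 * q)" using h \<sigma> by (intro mult_left_mono) auto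
    moreover have "2 * \<kappa> * C * r \<le> c * r" using h r by (intro mult_right_mono) auto
    ultimately have "- 2 * a\<^sup>2 * \<sigma> * n\<^sup>2 * q + 2 * \<kappa> * C * r \<le> c * r - \<sigma> / 2" by (simp add: mult_ac)
    from mult_left_mono[OF this, of "A * G"] h G
    show ?thesis unfolding e1 e2 e3 by (simp add: algebra_simps)
  next
    assume h: "A < 0 \<and> 4 * a\<^sup>2 * n\<^sup>2 * q \<le> 1 \<and> c \<le> - 2 * \<kappa> * C"
    have "\<sigma> * (4 * a\<^sup>2 * n\<^sup>2 * q) \<le> \<sigma> * 1" using h \<sigma> by (intro mult_left_mono) auto
    moreover have "c * r \<le> - 2 * \<kappa> * C * r" using h r by (intro mult_right_mono) auto
    ultimately have "c * r - \<sigma> / 2 \<le> - 2 * a\<^sup>2 * \<sigma> * n\<^sup>2 * q - 2 * \<kappa> * C * r" by (simp add: mult_ac)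
    from mult_left_mono[OF this, of "- A * G"] h G
    have "- A * G * (c * r - \<sigma> / 2) \<le> - A * G * (- 2 * a\<^sup>2 * \<sigma> * n\<^sup>2 * q - 2 * \<kappa> * C * r)" by (simp add: mult_nonpos_nonneg)
    moreover have "\<bar>A\<bar> = - A" using h by simp
    ultimately show ?thesis unfolding e1 e2 e3 by (simp add: algebra_simps)
  qed
qed

section \<open>Charts and barriers at the boundary\<close>

text \<open>\<open>\<psi>\<close> is a defining function of \<open>\<Omega>\<close> near \<open>y\<close> with gradient \<open>\<nu>\<close>. The margin \<open>4 r\<close> leaves room for the
tilts below: adding \<open>\<plusminus> |z - z0|\<^sup>2\<close> changes the gradient by at most \<open>4 r\<close> in the ball, so that its length stays
between \<open>m\<close> and \<open>M\<close>.\<close>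

definition chart where
  "chart \<Omega> y r \<kappa> m M \<psi> \<nu> \<longleftrightarrow> 0 < r \<and> 0 \<le> \<kappa> \<and> 0 \<le> m \<and> \<Omega> \<inter> ball y r = {z \<in> ball y r. 0 < \<psi> z} \<and>
    continuous_on (ball y r) \<psi> \<and>
    (\<forall>z\<in>ball y r. \<forall>z'\<in>ball y r. \<bar>\<psi> z' - \<psi> z - \<nu> z \<bullet> (z' - z)\<bar> \<le> \<kappa> * (norm (z' - z))\<^sup>2) \<and>
    (\<forall>z\<in>ball y r. m + 4 * r \<le> norm (\<nu> z) \<and> norm (\<nu> z) + 4 * r \<le> (M::real))"

text \<open>The parabolic boundary without the corner: \<open>initially_le\<close> refers to interior points at time 0, and
\<open>laterally_le\<close> to boundary points at positive times. The limits are upper bounds by 0 of the limes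
superior.\<close>

definition initially_le :: "'a::topological_space set \<Rightarrow> ('a \<times> real \<Rightarrow> real) \<Rightarrow> bool" where
  "initially_le \<Omega> v \<longleftrightarrow> (\<forall>z\<in>\<Omega>. \<forall>e>0. \<forall>\<^sub>F q in at (z, 0) within \<Omega> \<times> {0<..}. v q \<le> e)"

definition laterally_le :: "'a::topological_space set \<Rightarrow> ('a \<times> real \<Rightarrow> real) \<Rightarrow> bool" where
  "laterally_le \<Omega> v \<longleftrightarrow> (\<forall>z\<in>frontier \<Omega>. \<forall>t>0. \<forall>e>0. \<forall>\<^sub>F q in at (z, t) within \<Omega> \<times> {0<..}. v q \<le> e)"

lemma eventually_within_mono: "S \<subseteq> S' \<Longrightarrow> eventually P (at x within S') \<Longrightarrow> eventually P (at x within S)"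
  by (rule filter_leD[OF at_le])

lemma eventually_within_less:
  assumes "isCont g q" "g q < (c::real)" shows "\<forall>\<^sub>F w in at q within S. g w < c"
  using order_tendstoD(2)[of g "g q" "at q within S" c] assms
  by (meson continuous_within continuous_at_imp_continuous_at_within)

lemma eventually_within_mem: "\<forall>\<^sub>F w in at q within S. w \<in> S"
  by (simp add: eventually_at_filter)

lemma isCont_comp_fst: "isCont \<phi> (fst q) \<Longrightarrow> isCont (\<lambda>q. \<phi> (fst q)) q"
  by (rule isCont_o2[where f = fst and g = \<phi>]) (auto intro: continuous_intros)

lemma heat_profile_isCont:
  "isCont \<phi> (fst q) \<Longrightarrow> 0 < snd q \<Longrightarrow> isCont (\<lambda>q. heat_profile A B a k c (\<phi> (fst q)) (snd q)) q"
proof -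
  assume h: "isCont \<phi> (fst q)" "0 < snd q"
  have "isCont (\<lambda>q. a * ((\<phi> (fst q) + k + c * snd q) / sqrt (snd q))) q"
    using h(2) by (intro continuous_intros isCont_comp_fst[OF h(1)]) auto
  then have "isCont (\<lambda>q. Erf (a * ((\<phi> (fst q) + k + c * snd q) / sqrt (snd q)))) q"
    by (rule isCont_o2[where g = Erf]) (rule DERIV_isCont[OF Erf_deriv])
  then show ?thesis unfolding heat_profile_def by (intro continuous_intros)
qed

lemma chart_tilt:
  assumes ch: "chart \<Omega> y r \<kappa> m M \<psi> \<nu>" and z: "z \<in> ball y r" and \<beta>: "\<bar>\<beta>\<bar> = 1"
  shows "\<forall>\<^sub>F z' in nhds z. \<bar>(\<psi> z' + \<beta> * (norm (z' - z0))\<^sup>2) - (\<psi> z + \<beta> * (norm (z - z0))\<^sup>2)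
       - (\<nu> z + (2 * \<beta>) *\<^sub>R (z - z0)) \<bullet> (z' - z)\<bar> \<le> (\<kappa> + 1) * (norm (z' - z))\<^sup>2"
proof -
  have "\<forall>\<^sub>F z' in nhds z. z' \<in> ball y r" using z by (intro eventually_nhds_in_open) auto
  then show ?thesis
  proof eventually_elim
    case (elim z')
    have 1: "\<bar>\<psi> z' - \<psi> z - \<nu> z \<bullet> (z' - z)\<bar> \<le> \<kappa> * (norm (z' - z))\<^sup>2"
      using ch z elim unfolding chart_def by blast
    have 2: "(norm (z' - z0))\<^sup>2 - (norm (z - z0))\<^sup>2 - 2 * ((z - z0) \<bullet> (z' - z)) = (norm (z' - z))\<^sup>2"
      by (simp add: power2_norm_eq_inner algebra_simps inner_commute)
    have "(\<psi> z' + \<beta> * (norm (z' - z0))\<^sup>2) - (\<psi> z + \<beta> * (norm (z - z0))\<^sup>2) - (\<nu> z + (2 * \<beta>) *\<^sub>R (z - z0)) \<bullet> (z' - z)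
      = (\<psi> z' - \<psi> z - \<nu> z \<bullet> (z' - z)) + \<beta> * ((norm (z' - z0))\<^sup>2 - (norm (z - z0))\<^sup>2 - 2 * ((z - z0) \<bullet> (z' - z)))"
      by (simp add: algebra_simps)
    also have "\<bar>\<dots>\<bar> \<le> \<bar>\<psi> z' - \<psi> z - \<nu> z \<bullet> (z' - z)\<bar> + \<bar>\<beta>\<bar> * (norm (z' - z))\<^sup>2"
      unfolding 2 by (rule order_trans[OF abs_triangle_ineq]) (simp add: abs_mult)
    also have "\<dots> \<le> (\<kappa> + 1) * (norm (z' - z))\<^sup>2" using 1 \<beta> by (simp add: algebra_simps)
    finally show ?case .
  qed
qed

lemma chart_tilt_norm:
  assumes ch: "chart \<Omega> y r \<kappa> m M \<psi> \<nu>" and z: "z \<in> ball y r" and z0: "z0 \<in> ball y r" and \<beta>: "\<bar>\<beta>\<bar> = 1"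
  shows "m \<le> norm (\<nu> z + (2 * \<beta>) *\<^sub>R (z - z0))" "norm (\<nu> z + (2 * \<beta>) *\<^sub>R (z - z0)) \<le> M"
proof -
  have b: "m + 4 * r \<le> norm (\<nu> z)" "norm (\<nu> z) + 4 * r \<le> M" using ch z unfolding chart_def by blast+
  have "norm (z - z0) \<le> 2 * r" using norm_triangle_ineq4[of "z - y" "z0 - y"] z z0 by (simp add: dist_norm norm_minus_commute)
  then have n: "norm ((2 * \<beta>) *\<^sub>R (z - z0)) \<le> 4 * r" using \<beta> by (simp add: abs_mult)
  show "m \<le> norm (\<nu> z + (2 * \<beta>) *\<^sub>R (z - z0))"
    using norm_triangle_ineq2[of "\<nu> z" "- ((2 * \<beta>) *\<^sub>R (z - z0))"] b n
    by (simp del: scaleR_minus_left norm_scaleR)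
  show "norm (\<nu> z + (2 * \<beta>) *\<^sub>R (z - z0)) \<le> M"
    using norm_triangle_ineq[of "\<nu> z" "(2 * \<beta>) *\<^sub>R (z - z0)"] b n by linarith
qed

text \<open>The barrier is \<open>A (1 - Erf) + h\<close> in the tilted height \<open>\<phi> = \<psi> - |z - z0|\<^sup>2\<close>. It is at least \<open>A + h\<close> wherever
\<open>\<phi> + c t < 0\<close>, in particular near every boundary point, the corner included, since \<open>z0\<close> is an interior
point. Hence no information on \<open>v\<close> at the corner or on the lateral boundary is needed beyond \<open>v \<le> A\<close>. On the
sphere of radius \<open>r/2\<close> either \<open>\<phi> + c t < 0\<close> or \<open>\<psi> \<ge> r\<^sup>2/16\<close>, where \<open>v \<le> h\<close> by assumption.\<close>

lemma decreasing_barrier: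
  fixes v :: "(real^'n) \<times> real \<Rightarrow> real"
  assumes p: "1 < p" and N: "2 \<le> CARD('n)" and jet: "jet_subsolution p \<Omega> v" and op: "open \<Omega>"
    and vc: "continuous_on (\<Omega> \<times> {0<..}) v" and ch: "chart \<Omega> y r \<kappa> m M \<psi> \<nu>"
    and a: "0 < a" "4 * a\<^sup>2 * M\<^sup>2 * normal_coeff p \<le> 1" and A: "0 < A" and h: "0 < h"
    and vA: "\<And>z t. z \<in> \<Omega> \<inter> ball y r \<Longrightarrow> 0 < t \<Longrightarrow> t < T \<Longrightarrow> v (z, t) \<le> A"
    and bottom: "initially_le \<Omega> v"
    and deep: "\<And>z t. z \<in> \<Omega> \<Longrightarrow> dist z y = r / 2 \<Longrightarrow> r\<^sup>2 / 16 \<le> \<psi> z \<Longrightarrow> 0 < t \<Longrightarrow> t < T \<Longrightarrow> v (z, t) \<le> h"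
    and z0: "z0 \<in> \<Omega>" "dist z0 y < r / 4" and t: "0 < t" "t < T"
  shows "v (z0, t) \<le> A * (1 - Erf (a * ((\<psi> z0 - 2 * (\<kappa> + 1) * iso_coeff CARD('n) p * t) / sqrt t))) + h"
proof -
  define C where "C = iso_coeff CARD('n) p"
  define c where "c = - 2 * (\<kappa> + 1) * C"
  define \<phi> where "\<phi> z = \<psi> z + (-1) * (norm (z - z0))\<^sup>2" for z
  define V where "V = \<Omega> \<inter> ball y (r / 2)"
  define f where "f = heat_profile (- A) (A + h) a 0 c"
  have r: "0 < r" "0 \<le> \<kappa>" using ch unfolding chart_def by auto
  have \<Omega>: "\<Omega> \<inter> ball y r = {z \<in> ball y r. 0 < \<psi> z}" using ch unfolding chart_def by auto
  have C: "0 \<le> C" unfolding C_def by (rule iso_coeff_nonneg[OF p N])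
  have q: "0 < normal_coeff p" using normal_coeff_bounds[OF p] by simp
  have sub: "ball y (r/2) \<subseteq> ball y r" "cball y (r/2) \<subseteq> ball y r" using r by auto
  have z0r: "z0 \<in> ball y r" "z0 \<in> ball y (r/2)" using z0 r by (auto simp: dist_commute)
  have "continuous_on (ball y r) \<phi>" unfolding \<phi>_def using ch unfolding chart_def by (intro continuous_intros) auto
  then have \<phi>c: "isCont \<phi> z" if "z \<in> ball y r" for z using that by (simp add: continuous_on_eq_continuous_at)
  have f_ge: "h \<le> f s t" for s t
    using mult_left_mono[OF less_imp_le[OF Erf_less_1], of A "a * ((s + 0 + c * t) / sqrt t)"] A by (simp add: f_def heat_profile_def)
  have f_big: "A + h \<le> f s t" if "s + c * t < 0" "0 < t" for s t
  proof -
    have "a * ((s + 0 + c * t) / sqrt t) \<le> 0" using that a by (intro mult_nonneg_nonpos divide_nonpos_pos) auto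
    from mult_left_mono[OF Erf_nonpos[OF this], of A] A show ?thesis by (simp add: f_def heat_profile_def)
  qed
  have fc: "isCont (\<lambda>q. f (\<phi> (fst q)) (snd q)) q" if "fst q \<in> ball y r" "0 < snd q" for q
    unfolding f_def by (rule heat_profile_isCont) (use \<phi>c that in auto)
  have lc: "isCont (\<lambda>q. \<phi> (fst q) + c * snd q) q" if "fst q \<in> ball y r" for q
    by (intro continuous_intros isCont_comp_fst[OF \<phi>c[OF that]])
  have "v (z0, t) \<le> f (\<phi> z0) t"
  proof (rule comparison_with_profile[OF jet, of V T A f \<phi> 0])
    show "V \<subseteq> \<Omega>" "open V" "bounded V" unfolding V_def using op by auto
    show "continuous_on (V \<times> {0<..<T}) v" using vc by (rule continuous_on_subset) (auto simp: V_def)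
    show "v (z, t) \<le> A" if "z \<in> V" "0 < t" "t < T" for z t using vA that sub by (auto simp: V_def)
    show "continuous_on (V \<times> {0<..<T}) (\<lambda>q. f (\<phi> (fst q)) (snd q))"
      by (intro continuous_at_imp_continuous_on ballI fc) (use sub in \<open>auto simp: V_def\<close>)
    show "- 0 \<le> f (\<phi> z) t" for z t using f_ge[of "\<phi> z" t] h by simp
    show "z0 \<in> V" "0 < t" "t < T" using z0 z0r t by (auto simp: V_def)
  next
    fix z s assume zs: "z \<in> closure V" "0 \<le> s" "s < T" "\<not> (z \<in> V \<and> 0 < s)"
    have "closure V \<subseteq> cball y (r/2)" by (rule closure_minimal) (auto simp: V_def)
    then have zc: "z \<in> cball y (r/2)" using zs by auto
    then have zr: "z \<in> ball y r" using sub by auto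
    have memV: "\<forall>\<^sub>F q in at (z, s) within V \<times> {0<..<T}. q \<in> V \<times> {0<..<T}" by (rule eventually_within_mem)
    have neg: "\<forall>\<^sub>F q in at (z, s) within V \<times> {0<..<T}. v q \<le> f (\<phi> (fst q)) (snd q)" if "\<phi> z + c * s < 0"
    proof -
      have "\<forall>\<^sub>F q in at (z, s) within V \<times> {0<..<T}. \<phi> (fst q) + c * snd q < 0"
        by (rule eventually_within_less) (use that lc zr in auto)
      with memV show ?thesis
      proof eventually_elim
        case (elim q)
        then have "A + h \<le> f (\<phi> (fst q)) (snd q)" by (intro f_big) auto
        moreover have "v q \<le> A" using vA[of "fst q" "snd q"] elim sub by (auto simp: V_def)
        ultimately show ?case using h by simp
      qed
    qed
    have c0: "c * s \<le> 0" using C r zs(2) by (intro mult_nonpos_nonneg) (auto simp: c_def intro!: mult_nonpos_nonneg)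
    show "\<forall>\<^sub>F q in at (z, s) within V \<times> {0<..<T}. v q \<le> f (\<phi> (fst q)) (snd q)"
    proof (cases "z \<in> \<Omega>")
      case False
      then have "\<psi> z \<le> 0" using \<Omega> zr by force
      moreover have "z \<noteq> z0" using False z0 by auto
      then have "0 < (norm (z - z0))\<^sup>2" by simp
      ultimately show ?thesis using c0 by (intro neg) (unfold \<phi>_def, linarith)
    next
      case z\<Omega>: True
      show ?thesis
      proof (cases "s = 0")
        case True
        have "\<forall>\<^sub>F q in at (z, s) within V \<times> {0<..<T}. v q \<le> h"
          using bottom z\<Omega> h True unfolding initially_le_def
          by (intro eventually_within_mono[of "V \<times> {0<..<T}" "\<Omega> \<times> {0<..}"]) (auto simp: V_def)
        then show ?thesis by eventually_elim (use f_ge order_trans in blast)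
      next
        case False
        then have s: "0 < s" using zs by simp
        then have "z \<notin> V" using zs by simp
        then have d: "dist z y = r / 2" using zc z\<Omega> by (auto simp: V_def dist_commute)
        show ?thesis
        proof (cases "\<phi> z + c * s < 0")
          case True then show ?thesis by (rule neg)
        next
          case False
          have "r / 4 \<le> norm (z - z0)" using d z0 dist_triangle[of z y z0] by (simp add: dist_norm)
          then have "(r/4)\<^sup>2 \<le> (norm (z - z0))\<^sup>2" using r by (intro power_mono) auto
          moreover have "(norm (z - z0))\<^sup>2 \<le> \<psi> z" using False c0 by (simp add: \<phi>_def)
          ultimately have "r\<^sup>2 / 16 \<le> \<psi> z" by (simp add: power_divide)
          from deep[OF z\<Omega> d this s zs(3)] have vh: "v (z, s) \<le> h" .
          have "f (\<phi> z) s > h"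
            using mult_strict_left_mono[OF Erf_less_1 A, of "a * ((\<phi> z + 0 + c * s) / sqrt s)"] by (simp add: f_def heat_profile_def)
          moreover have "isCont v (z, s)"
            using vc z\<Omega> s op by (subst (asm) continuous_on_eq_continuous_at) (auto intro: open_Times)
          then have "isCont (\<lambda>q. v q - f (\<phi> (fst q)) (snd q)) (z, s)"
            using fc[of "(z, s)"] zr s by (intro continuous_intros) auto
          ultimately have "\<forall>\<^sub>F q in at (z, s) within V \<times> {0<..<T}. v q - f (\<phi> (fst q)) (snd q) < 0"
            using vh by (intro eventually_within_less) auto
          then show ?thesis by eventually_elim simp
        qed
      qed
    qed
  next
    fix z s assume zs: "z \<in> V" "0 < s" "s < T" "f (\<phi> z) s < v (z, s)"
    have zr: "z \<in> ball y r" using zs sub by (auto simp: V_def)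
    define \<sigma> where "\<sigma> = (\<phi> z + 0 + c * s) / sqrt s"
    define n where "n = norm (\<nu> z + (2 * (-1)) *\<^sub>R (z - z0))"
    have \<sigma>: "0 \<le> \<sigma>"
    proof (rule ccontr)
      assume "\<not> 0 \<le> \<sigma>"
      then have "\<phi> z + c * s < 0" using zs by (simp add: \<sigma>_def not_le divide_less_0_iff)
      from f_big[OF this zs(2)] vA[of z s] zs zr h show False by (auto simp: V_def)
    qed
    have n: "n \<le> M" "0 \<le> n" unfolding n_def using chart_tilt_norm(2)[OF ch zr z0r(1), of "-1"] by auto
    have "4 * a\<^sup>2 * n\<^sup>2 * normal_coeff p \<le> 4 * a\<^sup>2 * M\<^sup>2 * normal_coeff p"
      using n q by (intro mult_right_mono mult_left_mono power_mono) auto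
    then have n1: "4 * a\<^sup>2 * n\<^sup>2 * normal_coeff p \<le> 1" using a by linarith
    have "(- 2 * a^3 * \<sigma> * (-A) * gauss (a * \<sigma>) / s) * n\<^sup>2 * normal_coeff p
        + 2 * (\<kappa> + 1) * \<bar>(-A) * a * gauss (a * \<sigma>) / sqrt s\<bar> * C
       \<le> (-A) * a * gauss (a * \<sigma>) * (c * sqrt s - \<sigma> / 2) / s"
      unfolding \<sigma>_def by (rule heat_profile_supersolution) (use zs a r C A n1 \<sigma> in \<open>auto simp: c_def \<sigma>_def\<close>)
    moreover have "taylor2 f (\<phi> z) s ((-A) * a * gauss (a * \<sigma>) / sqrt s)
       ((-A) * a * gauss (a * \<sigma>) * (c * sqrt s - \<sigma> / 2) / s) (- 2 * a^3 * \<sigma> * (-A) * gauss (a * \<sigma>) / s)"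
      unfolding f_def \<sigma>_def by (rule taylor2_heat_profile[OF zs(2)])
    moreover have "(-A) * a * gauss (a * \<sigma>) / sqrt s \<noteq> 0" using A a zs gauss_pos[of "a * \<sigma>"] by auto
    moreover have "\<forall>\<^sub>F z' in nhds z. \<bar>\<phi> z' - \<phi> z - (\<nu> z + (2 * (-1)) *\<^sub>R (z - z0)) \<bullet> (z' - z)\<bar> \<le> (\<kappa> + 1) * (norm (z' - z))\<^sup>2"
      unfolding \<phi>_def by (rule chart_tilt[OF ch zr]) simp
    ultimately show "supersolution_at p f \<phi> z s"
      using r unfolding C_def n_def by (intro supersolution_atI[where \<kappa> = "\<kappa> + 1"]) (assumption | simp)+
  qed
  then show ?thesis by (simp add: f_def heat_profile_def \<phi>_def c_def C_def algebra_simps)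
qed

text \<open>Here the tilted height is \<open>\<phi> = \<psi> + |z - z0|\<^sup>2\<close>, which is at least \<open>r\<^sup>2/16\<close> on the sphere of radius \<open>r/2\<close>; the
normalization by \<open>Erf(a r\<^sup>2 / (16 \<surd>T))\<close> lifts the barrier to \<open>A\<close> there. A shift \<open>\<eta> > 0\<close> does the same at the
initial time, uniformly up to the corner, because \<open>\<eta> / \<surd>t\<close> is unbounded; it is sent to 0 at the end.\<close>

lemma increasing_barrier:
  fixes v :: "(real^'n) \<times> real \<Rightarrow> real"
  assumes p: "1 < p" and N: "2 \<le> CARD('n)" and jet: "jet_subsolution p \<Omega> v" and op: "open \<Omega>"
    and vc: "continuous_on (\<Omega> \<times> {0<..}) v" and ch: "chart \<Omega> y r \<kappa> m M \<psi> \<nu>"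
    and a: "0 < a" "1 \<le> 4 * a\<^sup>2 * m\<^sup>2 * normal_coeff p" and A: "0 < A"
    and vA: "\<And>z t. z \<in> \<Omega> \<inter> ball y r \<Longrightarrow> 0 < t \<Longrightarrow> t < T \<Longrightarrow> v (z, t) \<le> A"
    and lateral: "laterally_le \<Omega> v"
    and z0: "z0 \<in> \<Omega>" "dist z0 y < r / 4" and t: "0 < t" "t < T"
  shows "v (z0, t) \<le> A / Erf (a * (r\<^sup>2 / 16 / sqrt T)) * Erf (a * ((\<psi> z0 + 2 * (\<kappa> + 1) * iso_coeff CARD('n) p * t) / sqrt t))"
proof -
  define C where "C = iso_coeff CARD('n) p"
  define c where "c = 2 * (\<kappa> + 1) * C"
  define \<phi> where "\<phi> z = \<psi> z + 1 * (norm (z - z0))\<^sup>2" for z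
  define V where "V = \<Omega> \<inter> ball y (r / 2)"
  have r: "0 < r" "0 \<le> \<kappa>" "0 \<le> m" using ch unfolding chart_def by auto
  have \<Omega>: "\<Omega> \<inter> ball y r = {z \<in> ball y r. 0 < \<psi> z}" using ch unfolding chart_def by auto
  have C: "0 \<le> C" unfolding C_def by (rule iso_coeff_nonneg[OF p N])
  have q: "0 < normal_coeff p" using normal_coeff_bounds[OF p] by simp
  have T: "0 < T" using t by simp
  define E where "E = Erf (a * (r\<^sup>2 / 16 / sqrt T))"
  have E: "0 < E" unfolding E_def using a r T by (intro Erf_pos) simp
  define A' where "A' = A / E"
  have A': "0 < A'" "A' * E = A" using A E by (auto simp: A'_def)
  have sub: "ball y (r/2) \<subseteq> ball y r" "cball y (r/2) \<subseteq> ball y r" using r by auto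
  have z0r: "z0 \<in> ball y r" "z0 \<in> ball y (r/2)" using z0 r by (auto simp: dist_commute)
  have "continuous_on (ball y r) \<phi>" unfolding \<phi>_def using ch unfolding chart_def by (intro continuous_intros) auto
  then have \<phi>c: "isCont \<phi> z" if "z \<in> ball y r" for z using that by (simp add: continuous_on_eq_continuous_at)
  have \<phi>0: "0 < \<phi> z" if "z \<in> V" for z
  proof -
    have "z \<in> {z \<in> ball y r. 0 < \<psi> z}" using that sub \<Omega> unfolding V_def by blast
    then show ?thesis by (simp add: \<phi>_def add_pos_nonneg)
  qed
  have c: "0 \<le> c" using r C by (simp add: c_def)
  have key: "v (z0, t) \<le> A' * Erf (a * ((\<psi> z0 + \<eta> + c * t) / sqrt t))" if \<eta>: "0 < \<eta>" for \<eta>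
  proof -
    define f where "f = heat_profile A' 0 a \<eta> c"
    have fc: "isCont (\<lambda>q. f (\<phi> (fst q)) (snd q)) q" if "fst q \<in> ball y r" "0 < snd q" for q
      unfolding f_def by (rule heat_profile_isCont) (use \<phi>c that in auto)
    have f_ge: "A' * Erf (a * (x / sqrt t)) \<le> f s t" if "x \<le> s + \<eta>" "0 < t" for x s t
    proof -
      have "x \<le> s + \<eta> + c * t" using that c by (simp add: add_increasing2)
      then have "a * (x / sqrt t) \<le> a * ((s + \<eta> + c * t) / sqrt t)" using a that by (intro mult_left_mono divide_right_mono) auto
      from mult_left_mono[OF Erf_mono[OF this], of A'] A' show ?thesis by (simp add: f_def heat_profile_def)
    qed
    have f_pos: "0 \<le> f (\<phi> z) t" if "z \<in> V" "0 < t" for z t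
      using f_ge[of 0 "\<phi> z" t] \<phi>0[OF that(1)] \<eta> that by simp
    have big: "A \<le> f s t'" if "x \<le> s + \<eta>" "0 < t'" "r\<^sup>2 / 16 / sqrt T \<le> x / sqrt t'" for x s t'
    proof -
      have "E \<le> Erf (a * (x / sqrt t'))" unfolding E_def using that a by (intro Erf_mono mult_left_mono) auto
      then have "A \<le> A' * Erf (a * (x / sqrt t'))" using A' mult_left_mono[of E _ A'] by simp
      then show ?thesis using f_ge[OF that(1,2)] by linarith
    qed
    have "v (z0, t) \<le> f (\<phi> z0) t"
    proof (rule comparison_with_profile[OF jet, of V T A f \<phi> 0])
      show "V \<subseteq> \<Omega>" "open V" "bounded V" unfolding V_def using op by auto
      show "continuous_on (V \<times> {0<..<T}) v" using vc by (rule continuous_on_subset) (auto simp: V_def)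
      show "v (z, t) \<le> A" if "z \<in> V" "0 < t" "t < T" for z t using vA that sub by (auto simp: V_def)
      show "continuous_on (V \<times> {0<..<T}) (\<lambda>q. f (\<phi> (fst q)) (snd q))"
        by (intro continuous_at_imp_continuous_on ballI fc) (use sub in \<open>auto simp: V_def\<close>)
      show "- 0 \<le> f (\<phi> z) t" if "z \<in> V" "0 < t" for z t using f_pos[OF that] by simp
      show "z0 \<in> V" "0 < t" "t < T" using z0 z0r t by (auto simp: V_def)
    next
      fix z s assume zs: "z \<in> closure V" "0 \<le> s" "s < T" "\<not> (z \<in> V \<and> 0 < s)"
      have "closure V \<subseteq> cball y (r/2)" by (rule closure_minimal) (auto simp: V_def)
      then have zc: "z \<in> cball y (r/2)" using zs by auto
      then have zr: "z \<in> ball y r" using sub by auto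
      have memV: "\<forall>\<^sub>F q in at (z, s) within V \<times> {0<..<T}. q \<in> V \<times> {0<..<T}" by (rule eventually_within_mem)
      show "\<forall>\<^sub>F q in at (z, s) within V \<times> {0<..<T}. v q \<le> f (\<phi> (fst q)) (snd q)"
      proof (cases "s = 0")
        case True
        \<comment> \<open>for times below \<open>\<delta>\<close> the shift alone lifts the barrier to \<open>A\<close>\<close>
        define \<delta> where "\<delta> = (16 * \<eta> * sqrt T / r\<^sup>2)\<^sup>2"
        have d: "0 < 16 * \<eta> * sqrt T / r\<^sup>2" using \<eta> T r(1) by (intro divide_pos_pos mult_pos_pos) auto
        then have "0 < \<delta>" unfolding \<delta>_def by (rule zero_less_power)
        then have "\<forall>\<^sub>F q in at (z, s) within V \<times> {0<..<T}. snd q < \<delta>"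
          using True by (intro eventually_within_less) auto
        with memV show ?thesis
        proof eventually_elim
          case (elim q)
          then have q: "fst q \<in> V" "0 < snd q" "snd q < T" by auto
          have "sqrt (snd q) \<le> 16 * \<eta> * sqrt T / r\<^sup>2" using elim d unfolding \<delta>_def by (metis less_imp_le real_sqrt_le_mono real_sqrt_unique)
          then have "r\<^sup>2 / 16 / sqrt T \<le> \<eta> / sqrt (snd q)" using q r(1) T \<eta> by (simp add: field_simps)
          then have "A \<le> f (\<phi> (fst q)) (snd q)" using \<phi>0[OF q(1)] q by (intro big[of \<eta>]) auto
          then show ?case using vA[of "fst q" "snd q"] q sub by (auto simp: V_def intro: order_trans)
        qed
      next
        case False
        then have s: "0 < s" using zs by simp
        show ?thesis
        proof (cases "z \<in> \<Omega>")
          case False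
          have "z \<in> closure \<Omega>" using zs(1) closure_mono[of V \<Omega>] by (auto simp: V_def)
          then have fr: "z \<in> frontier \<Omega>" using False op by (simp add: frontier_def interior_open)
          define e where "e = A' * Erf (a * (\<eta> / sqrt T))"
          have e: "0 < e" unfolding e_def using A' a \<eta> T by (intro mult_pos_pos Erf_pos) auto
          have "\<forall>\<^sub>F q in at (z, s) within V \<times> {0<..<T}. v q \<le> e"
            using lateral fr s e unfolding laterally_le_def
            by (intro eventually_within_mono[of "V \<times> {0<..<T}" "\<Omega> \<times> {0<..}"]) (auto simp: V_def)
          with memV show ?thesis
          proof eventually_elim
            case (elim q)
            then have q: "fst q \<in> V" "0 < snd q" "snd q < T" by auto
            have "Erf (a * (\<eta> / sqrt T)) \<le> Erf (a * (\<eta> / sqrt (snd q)))"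
              using q \<eta> a by (intro Erf_mono mult_left_mono divide_left_mono) auto
            then have "e \<le> A' * Erf (a * (\<eta> / sqrt (snd q)))" unfolding e_def using A' by (intro mult_left_mono) auto
            also have "\<dots> \<le> f (\<phi> (fst q)) (snd q)" using \<phi>0[OF q(1)] q by (intro f_ge) auto
            finally show ?case using elim by linarith
          qed
        next
          case True
          then have "z \<notin> V" using zs s by simp
          then have d: "dist z y = r / 2" using zc True by (auto simp: V_def dist_commute)
          have "r / 4 \<le> norm (z - z0)" using d z0 dist_triangle[of z y z0] by (simp add: dist_norm)
          then have "(r/4)\<^sup>2 \<le> (norm (z - z0))\<^sup>2" using r by (intro power_mono) auto
          moreover have "0 < \<psi> z" using True zr \<Omega> by blast
          ultimately have "r\<^sup>2 / 16 < \<phi> z" by (simp add: \<phi>_def power_divide)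
          moreover have "isCont (\<lambda>q. - \<phi> (fst q)) (z, s)" using isCont_comp_fst[where \<phi> = \<phi> and q = "(z, s)"] \<phi>c[OF zr] by (intro continuous_intros) auto
          ultimately have "\<forall>\<^sub>F q in at (z, s) within V \<times> {0<..<T}. - \<phi> (fst q) < - r\<^sup>2 / 16"
            by (intro eventually_within_less) auto
          with memV show ?thesis
          proof eventually_elim
            case (elim q)
            then have q: "fst q \<in> V" "0 < snd q" "snd q < T" by auto
            have "r\<^sup>2 / 16 / sqrt T \<le> (r\<^sup>2 / 16) / sqrt (snd q)" using q by (intro divide_left_mono) auto
            then have "A \<le> f (\<phi> (fst q)) (snd q)" using elim q \<eta> by (intro big[of "r\<^sup>2 / 16"]) auto
            then show ?case using vA[of "fst q" "snd q"] q sub by (auto simp: V_def intro: order_trans)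
          qed
        qed
      qed
    next
      fix z s assume zs: "z \<in> V" "0 < s" "s < T" "f (\<phi> z) s < v (z, s)"
      have zr: "z \<in> ball y r" using zs sub by (auto simp: V_def)
      define \<sigma> where "\<sigma> = (\<phi> z + \<eta> + c * s) / sqrt s"
      define n where "n = norm (\<nu> z + (2 * 1) *\<^sub>R (z - z0))"
      have \<sigma>: "0 \<le> \<sigma>" using \<phi>0[OF zs(1)] \<eta> c zs(2) by (simp add: \<sigma>_def)
      have n: "m \<le> n" unfolding n_def using chart_tilt_norm(1)[OF ch zr z0r(1), of "1"] by auto
      have "4 * a\<^sup>2 * m\<^sup>2 * normal_coeff p \<le> 4 * a\<^sup>2 * n\<^sup>2 * normal_coeff p"
        using n q r by (intro mult_right_mono mult_left_mono power_mono) auto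
      then have n1: "1 \<le> 4 * a\<^sup>2 * n\<^sup>2 * normal_coeff p" using a by linarith
      have "(- 2 * a^3 * \<sigma> * A' * gauss (a * \<sigma>) / s) * n\<^sup>2 * normal_coeff p
          + 2 * (\<kappa> + 1) * \<bar>A' * a * gauss (a * \<sigma>) / sqrt s\<bar> * C
         \<le> A' * a * gauss (a * \<sigma>) * (c * sqrt s - \<sigma> / 2) / s"
        unfolding \<sigma>_def by (rule heat_profile_supersolution) (use zs a r C A' n1 \<sigma> in \<open>auto simp: c_def \<sigma>_def\<close>)
      moreover have "taylor2 f (\<phi> z) s (A' * a * gauss (a * \<sigma>) / sqrt s)
         (A' * a * gauss (a * \<sigma>) * (c * sqrt s - \<sigma> / 2) / s) (- 2 * a^3 * \<sigma> * A' * gauss (a * \<sigma>) / s)"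
        unfolding f_def \<sigma>_def by (rule taylor2_heat_profile[OF zs(2)])
      moreover have "A' * a * gauss (a * \<sigma>) / sqrt s \<noteq> 0" using A' a zs gauss_pos[of "a * \<sigma>"] by auto
      moreover have "\<forall>\<^sub>F z' in nhds z. \<bar>\<phi> z' - \<phi> z - (\<nu> z + (2 * 1) *\<^sub>R (z - z0)) \<bullet> (z' - z)\<bar> \<le> (\<kappa> + 1) * (norm (z' - z))\<^sup>2"
        unfolding \<phi>_def by (rule chart_tilt[OF ch zr]) simp
      ultimately show "supersolution_at p f \<phi> z s"
        using r unfolding C_def n_def by (intro supersolution_atI[where \<kappa> = "\<kappa> + 1"]) (assumption | simp)+
    qed
    then show ?thesis by (simp add: f_def heat_profile_def \<phi>_def)
  qed
  have "((\<lambda>\<eta>. A' * Erf (a * ((\<psi> z0 + \<eta> + c * t) / sqrt t))) \<longlongrightarrow> A' * Erf (a * ((\<psi> z0 + 0 + c * t) / sqrt t))) (at_right 0)"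
    using t by (intro tendsto_intros isCont_tendsto_compose[OF DERIV_isCont[OF Erf_deriv]]) auto
  moreover have "\<forall>\<^sub>F \<eta> in at_right 0. v (z0, t) \<le> A' * Erf (a * ((\<psi> z0 + \<eta> + c * t) / sqrt t))"
    unfolding eventually_at_right_field using key zero_less_one by blast
  ultimately have "v (z0, t) \<le> A' * Erf (a * ((\<psi> z0 + 0 + c * t) / sqrt t))"
    by (rule tendsto_lowerbound) simp
  then show ?thesis by (simp add: A'_def E_def c_def C_def)
qed

section \<open>Decay inside the domain\<close>

lemma taylor2_exp_profile:
  "taylor2 (\<lambda>s t. M * exp (l * (s - b) + \<mu> * t)) s t (l * (M * exp (l * (s - b) + \<mu> * t)))
     (\<mu> * (M * exp (l * (s - b) + \<mu> * t))) (l\<^sup>2 * (M * exp (l * (s - b) + \<mu> * t)))"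
proof -
  define f1 where "f1 s' = l * (M * exp (l * (s' - b) + \<mu> * t))" for s'
  define f2 where "f2 w = \<mu> * (M * exp (l * (fst w - b) + \<mu> * snd w))" for w :: "real \<times> real"
  have "taylor2 (\<lambda>s t. M * exp (l * (s - b) + \<mu> * t)) s t (f1 s) (f2 (s, t)) (l\<^sup>2 * (M * exp (l * (s - b) + \<mu> * t)))"
  proof (rule taylor2I)
    show "\<forall>\<^sub>F s' in nhds s. ((\<lambda>s. M * exp (l * (s - b) + \<mu> * t)) has_real_derivative f1 s') (at s')"
      unfolding f1_def by (auto intro!: always_eventually derivative_eq_intros)
    show "(f1 has_real_derivative l\<^sup>2 * (M * exp (l * (s - b) + \<mu> * t))) (at s)"
      unfolding f1_def by (auto intro!: derivative_eq_intros simp: power2_eq_square)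
    show "\<forall>\<^sub>F w in nhds (s, t). ((\<lambda>t. M * exp (l * (fst w - b) + \<mu> * t)) has_real_derivative f2 w) (at (snd w))"
      unfolding f2_def by (auto intro!: always_eventually derivative_eq_intros)
    show "f2 differentiable at (s, t)"
      unfolding f2_def differentiable_def by (rule exI, (rule derivative_intros)+)
  qed
  then show ?thesis by (simp add: f1_def f2_def)
qed

lemma square_norm_expansion:
  "\<bar>(norm (z' - z0))\<^sup>2 - (norm (z - z0))\<^sup>2 - (2 *\<^sub>R (z - z0)) \<bullet> (z' - z)\<bar> \<le> 1 * (norm (z' - z))\<^sup>2"
proof -
  have "(norm (z' - z0))\<^sup>2 - (norm (z - z0))\<^sup>2 - (2 *\<^sub>R (z - z0)) \<bullet> (z' - z) = (norm (z' - z))\<^sup>2"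
    by (simp add: power2_norm_eq_inner algebra_simps inner_commute)
  then show ?thesis by simp
qed

text \<open>The barrier on the ball is \<open>M exp(l (|z - z0|\<^sup>2 - \<delta>\<^sup>2) + \<mu> t)\<close>. It exceeds \<open>M\<close> on the sphere, and it is a
supersolution as soon as \<open>\<mu> = 4 l\<^sup>2 \<delta>\<^sup>2 + 2 l C\<close>. The choice \<open>l = 1 / (16 t)\<close> for the time \<open>t\<close> of interest
makes the value at the centre exponentially small.\<close>

lemma interior_decay:
  fixes v :: "(real^'n) \<times> real \<Rightarrow> real"
  assumes p: "1 < p" and N: "2 \<le> CARD('n)" and jet: "jet_subsolution p \<Omega> v"
    and vc: "continuous_on (\<Omega> \<times> {0<..}) v" and M: "0 < M"
    and vM: "\<And>z t. z \<in> \<Omega> \<Longrightarrow> 0 < t \<Longrightarrow> v (z, t) \<le> M"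
    and bottom: "initially_le \<Omega> v" and op: "open \<Omega>"
    and sub: "cball z0 \<delta> \<subseteq> \<Omega>" and \<delta>: "0 < \<delta>" and t: "0 < t"
  shows "v (z0, t) \<le> M * exp (iso_coeff CARD('n) p / 4) * exp (- (\<delta>\<^sup>2 / 32) / t)"
proof -
  define C where "C = iso_coeff CARD('n) p"
  have C: "0 \<le> C" unfolding C_def by (rule iso_coeff_nonneg[OF p N])
  have q: "0 < normal_coeff p" "normal_coeff p \<le> 1" using normal_coeff_bounds[OF p] by auto
  define T where "T = 2 * t"
  have T: "0 < T" "t < T" using t by (auto simp: T_def)
  define l where "l = 1 / (8 * T)"
  define \<mu> where "\<mu> = 4 * l\<^sup>2 * \<delta>\<^sup>2 + 2 * l * C"
  have l: "0 < l" using T by (simp add: l_def)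
  have \<mu>: "0 < \<mu>" unfolding \<mu>_def using l \<delta> C by (simp add: add_pos_nonneg)
  define f where "f s t = M * exp (l * (s - \<delta>\<^sup>2) + \<mu> * t)" for s t
  define \<phi> where "\<phi> z = (norm (z - z0))\<^sup>2" for z
  define e where "e = M * exp (- l * \<delta>\<^sup>2)"
  have e: "0 < e" using M by (simp add: e_def)
  have ec: "e \<le> f (\<phi> z) t" if "0 < t" for z t
    using that M l \<mu> by (simp add: e_def f_def \<phi>_def algebra_simps)
  have fc: "isCont (\<lambda>q. f (\<phi> (fst q)) (snd q)) q" for q
    unfolding f_def \<phi>_def by (intro continuous_intros)
  have "v (z0, t) \<le> f (\<phi> z0) t"
  proof (rule comparison_with_profile[OF jet, of "ball z0 \<delta>" T M f \<phi> 0])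
    show "ball z0 \<delta> \<subseteq> \<Omega>" "open (ball z0 \<delta>)" "bounded (ball z0 \<delta>)" using sub by auto
    show "continuous_on (ball z0 \<delta> \<times> {0<..<T}) v" using vc by (rule continuous_on_subset) (use sub in auto)
    show "v (z, t) \<le> M" if "z \<in> ball z0 \<delta>" "0 < t" "t < T" for z t
      by (rule vM) (use that sub in auto)
    show "continuous_on (ball z0 \<delta> \<times> {0<..<T}) (\<lambda>q. f (\<phi> (fst q)) (snd q))"
      by (intro continuous_at_imp_continuous_on ballI fc)
    show "- 0 \<le> f (\<phi> z) t" if "0 < t" for z t using ec[OF that, of z] e by simp
    show "z0 \<in> ball z0 \<delta>" "0 < t" "t < T" using \<delta> t T by auto
  next
    fix z s assume zs: "z \<in> closure (ball z0 \<delta>)" "0 \<le> s" "s < T" "\<not> (z \<in> ball z0 \<delta> \<and> 0 < s)"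
    have zc: "z \<in> cball z0 \<delta>" using zs \<delta> by (simp add: closure_ball)
    then have z\<Omega>: "z \<in> \<Omega>" using sub by auto
    have memV: "\<forall>\<^sub>F q in at (z, s) within ball z0 \<delta> \<times> {0<..<T}. q \<in> ball z0 \<delta> \<times> {0<..<T}" by (rule eventually_within_mem)
    show "\<forall>\<^sub>F q in at (z, s) within ball z0 \<delta> \<times> {0<..<T}. v q \<le> f (\<phi> (fst q)) (snd q)"
    proof (cases "s = 0")
      case True
      have "\<forall>\<^sub>F q in at (z, s) within ball z0 \<delta> \<times> {0<..<T}. v q \<le> e"
        using bottom z\<Omega> e True sub unfolding initially_le_def
        by (intro eventually_within_mono[of "ball z0 \<delta> \<times> {0<..<T}" "\<Omega> \<times> {0<..}"]) auto
      with memV show ?thesis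
      proof eventually_elim
        case (elim q)
        then show ?case using ec[of "snd q" "fst q"] by auto
      qed
    next
      case False
      then have s: "0 < s" using zs by simp
      then have "dist z0 z = \<delta>" using zs(4) zc by auto
      then have "\<phi> z = \<delta>\<^sup>2" by (simp add: \<phi>_def dist_norm norm_minus_commute)
      then have "- f (\<phi> z) s < - M" using M s \<mu> by (simp add: f_def)
      then have "\<forall>\<^sub>F q in at (z, s) within ball z0 \<delta> \<times> {0<..<T}. - f (\<phi> (fst q)) (snd q) < - M"
        using fc[of "(z, s)"] by (intro eventually_within_less continuous_intros) auto
      with memV show ?thesis
      proof eventually_elim
        case (elim q)
        then have "fst q \<in> cball z0 \<delta>" by auto
        then have "fst q \<in> \<Omega>" using sub by blast
        then show ?case using elim vM[of "fst q" "snd q"] by auto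
      qed
    qed
  next
    fix z s assume zs: "z \<in> ball z0 \<delta>" "0 < s" "s < T" "f (\<phi> z) s < v (z, s)"
    have F: "0 < f (\<phi> z) s" using M by (simp add: f_def)
    have n: "(norm (2 *\<^sub>R (z - z0)))\<^sup>2 * normal_coeff p \<le> 4 * \<delta>\<^sup>2"
    proof -
      have "(norm (z - z0))\<^sup>2 \<le> \<delta>\<^sup>2" using zs by (intro power_mono) (auto simp: dist_norm norm_minus_commute)
      then have "(norm (2 *\<^sub>R (z - z0)))\<^sup>2 \<le> 4 * \<delta>\<^sup>2" by (simp add: power_mult_distrib)
      from mult_mono[OF this q(2)] q show ?thesis by simp
    qed
    have "l\<^sup>2 * ((norm (2 *\<^sub>R (z - z0)))\<^sup>2 * normal_coeff p) + 2 * l * C \<le> \<mu>"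
      using mult_left_mono[OF n, of "l\<^sup>2"] by (simp add: \<mu>_def)
    from mult_right_mono[OF this less_imp_le[OF F]]
    have "(l\<^sup>2 * f (\<phi> z) s) * (norm (2 *\<^sub>R (z - z0)))\<^sup>2 * normal_coeff p + 2 * 1 * \<bar>l * f (\<phi> z) s\<bar> * C \<le> \<mu> * f (\<phi> z) s"
      using l F by (simp add: algebra_simps)
    moreover have "taylor2 f (\<phi> z) s (l * f (\<phi> z) s) (\<mu> * f (\<phi> z) s) (l\<^sup>2 * f (\<phi> z) s)"
      unfolding f_def[abs_def] by (rule taylor2_exp_profile)
    moreover have "l * f (\<phi> z) s \<noteq> 0" using l F by simp
    moreover have "\<forall>\<^sub>F z' in nhds z. \<bar>\<phi> z' - \<phi> z - (2 *\<^sub>R (z - z0)) \<bullet> (z' - z)\<bar> \<le> 1 * (norm (z' - z))\<^sup>2"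
      unfolding \<phi>_def by (intro always_eventually allI square_norm_expansion)
    ultimately show "supersolution_at p f \<phi> z s"
      unfolding C_def by (intro supersolution_atI[where \<kappa> = 1]) (assumption | simp)+
  qed
  also have "f (\<phi> z0) t = M * exp (- l * \<delta>\<^sup>2 + \<mu> * t)" by (simp add: f_def \<phi>_def)
  also have "- l * \<delta>\<^sup>2 + \<mu> * t = C / 8 - (3 * \<delta>\<^sup>2 / 64) / t"
    unfolding \<mu>_def l_def T_def using t by (simp add: field_simps power2_eq_square)
  also have "M * exp (C / 8 - (3 * \<delta>\<^sup>2 / 64) / t) \<le> M * exp (C / 4 - (\<delta>\<^sup>2 / 32) / t)"
  proof -
    have "(\<delta>\<^sup>2 / 32) / t \<le> (3 * \<delta>\<^sup>2 / 64) / t" using t by (intro divide_right_mono) auto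
    then show ?thesis using M C by simp
  qed
  also have "C / 4 - (\<delta>\<^sup>2 / 32) / t = C / 4 + (- (\<delta>\<^sup>2 / 32) / t)" by simp
  also have "M * exp (C / 4 + (- (\<delta>\<^sup>2 / 32) / t)) = M * exp (C / 4) * exp (- (\<delta>\<^sup>2 / 32) / t)"
    by (simp only: exp_add mult.assoc)
  finally show ?thesis by (simp add: C_def)
qed

section \<open>The corner of the parabolic boundary\<close>

definition bounded_subsolution :: "ereal \<Rightarrow> (real^'n) set \<Rightarrow> ((real^'n) \<times> real \<Rightarrow> real) \<Rightarrow> bool" where
  "bounded_subsolution p \<Omega> v \<longleftrightarrow> jet_subsolution p \<Omega> v \<and> continuous_on (\<Omega> \<times> {0<..}) v \<and> initially_le \<Omega> v \<and>
     (\<exists>M>0. \<forall>z\<in>\<Omega>. \<forall>t>0. v (z, t) \<le> M)"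

lemma compact_decay:
  fixes v :: "(real^'n) \<times> real \<Rightarrow> real"
  assumes p: "1 < p" and N: "2 \<le> CARD('n)" and op: "open \<Omega>" and v: "bounded_subsolution p \<Omega> v"
    and K: "compact K" "K \<subseteq> \<Omega>"
  shows "\<exists>D c. 0 < D \<and> 0 < c \<and> (\<forall>z\<in>K. \<forall>t>0. v (z, t) \<le> D * exp (- c / t))"
proof -
  obtain M where M: "0 < M" "\<And>z t. z \<in> \<Omega> \<Longrightarrow> 0 < t \<Longrightarrow> v (z, t) \<le> M" using v unfolding bounded_subsolution_def by auto
  obtain \<delta> where \<delta>: "0 < \<delta>" "(\<Union>x\<in>K. cball x \<delta>) \<subseteq> \<Omega>"
    using compact_subset_open_imp_cball_epsilon_subset[OF K(1) op K(2)] by auto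
  have "v (z, t) \<le> M * exp (iso_coeff CARD('n) p / 4) * exp (- (\<delta>\<^sup>2 / 32) / t)" if "z \<in> K" "0 < t" for z t
  proof -
    have sub: "cball z \<delta> \<subseteq> \<Omega>" using \<delta>(2) that(1) by blast
    have j: "jet_subsolution p \<Omega> v" and c: "continuous_on (\<Omega> \<times> {0<..}) v" and i: "initially_le \<Omega> v"
      using v unfolding bounded_subsolution_def by auto
    show ?thesis by (rule interior_decay[OF p N j c M(1) M(2) i op sub \<delta>(1) that(2)])
  qed
  then show ?thesis using M(1) \<delta>(1)
    by (intro exI[of _ "M * exp (iso_coeff CARD('n) p / 4)"] exI[of _ "\<delta>\<^sup>2 / 32"]) auto
qed

lemma chart_shrink:
  assumes ch: "chart \<Omega> y r \<kappa> m M \<psi> \<nu>" and r': "0 < r'" "r' \<le> r"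
  shows "chart \<Omega> y r' \<kappa> m M \<psi> \<nu>"
proof -
  have sub: "ball y r' \<subseteq> ball y r" using r' by auto
  have 1: "\<Omega> \<inter> ball y r = {z \<in> ball y r. 0 < \<psi> z}" using ch unfolding chart_def by blast
  have "\<Omega> \<inter> ball y r' = (\<Omega> \<inter> ball y r) \<inter> ball y r'" using sub by blast
  also have "\<dots> = {z \<in> ball y r'. 0 < \<psi> z}" unfolding 1 using sub by blast
  finally have 2: "\<Omega> \<inter> ball y r' = {z \<in> ball y r'. 0 < \<psi> z}" .
  have 3: "continuous_on (ball y r') \<psi>" using ch sub unfolding chart_def by (meson continuous_on_subset)
  have 4: "m + 4 * r' \<le> norm (\<nu> z) \<and> norm (\<nu> z) + 4 * r' \<le> M" if "z \<in> ball y r'" for z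
  proof -
    have "m + 4 * r \<le> norm (\<nu> z) \<and> norm (\<nu> z) + 4 * r \<le> M" using ch sub that unfolding chart_def by blast
    then show ?thesis using r' by linarith
  qed
  have 5: "0 \<le> \<kappa>" "0 \<le> m" "\<forall>z\<in>ball y r'. \<forall>z'\<in>ball y r'. \<bar>\<psi> z' - \<psi> z - \<nu> z \<bullet> (z' - z)\<bar> \<le> \<kappa> * (norm (z' - z))\<^sup>2"
    using ch sub unfolding chart_def by blast+
  show ?thesis unfolding chart_def using 2 3 4 5 r' by blast
qed

lemma chart_deep_sphere:
  assumes ch: "chart \<Omega> y r \<kappa> m M \<psi> \<nu>"
  shows "compact {z :: real^'n. dist z y = r / 2 \<and> r\<^sup>2 / 16 \<le> \<psi> z}" "{z. dist z y = r / 2 \<and> r\<^sup>2 / 16 \<le> \<psi> z} \<subseteq> \<Omega>"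
proof -
  have r: "0 < r" using ch unfolding chart_def by auto
  have e: "{z. dist z y = r / 2 \<and> r\<^sup>2 / 16 \<le> \<psi> z} = sphere y (r/2) \<inter> \<psi> -` {r\<^sup>2 / 16..}"
    by (auto simp: dist_commute)
  have "continuous_on (sphere y (r/2)) \<psi>" using ch unfolding chart_def
    by (elim conjE) (erule continuous_on_subset, use r in auto)
  then have "closed (sphere y (r/2) \<inter> \<psi> -` {r\<^sup>2 / 16..})" by (rule continuous_closed_preimage) auto
  then show "compact {z. dist z y = r / 2 \<and> r\<^sup>2 / 16 \<le> \<psi> z}" unfolding e compact_eq_bounded_closed by auto
  show "{z. dist z y = r / 2 \<and> r\<^sup>2 / 16 \<le> \<psi> z} \<subseteq> \<Omega>"
  proof
    fix z assume "z \<in> {z. dist z y = r / 2 \<and> r\<^sup>2 / 16 \<le> \<psi> z}"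
    then have "z \<in> ball y r" "0 < \<psi> z" using r by (auto simp: dist_commute intro: less_le_trans[of 0 "r\<^sup>2/16"])
    then show "z \<in> \<Omega>" using ch unfolding chart_def by blast
  qed
qed

lemma exp_inverse_tendsto_0: "0 < c \<Longrightarrow> ((\<lambda>t::real. D * exp (- c / t)) \<longlongrightarrow> 0) (at_right 0)"
proof -
  assume c: "0 < c"
  have "filterlim (\<lambda>t::real. - c * inverse t) at_bot (at_right 0)"
    by (rule filterlim_tendsto_neg_mult_at_bot[OF tendsto_const _ filterlim_inverse_at_top_right]) (use c in simp)
  then have "((\<lambda>t::real. exp (- c * inverse t)) \<longlongrightarrow> 0) (at_right 0)"
    by (rule filterlim_compose[OF exp_at_bot])
  from tendsto_mult_right_zero[OF this, of D] show ?thesis by (simp add: divide_inverse)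
qed

lemma Erf_inverse_sqrt_tendsto_1: "0 < b \<Longrightarrow> ((\<lambda>t. Erf (b / sqrt t)) \<longlongrightarrow> 1) (at_right 0)"
proof -
  assume b: "0 < b"
  have "filterlim (\<lambda>t. sqrt t) (at_right 0) (at_right 0)"
    unfolding filterlim_at using tendsto_real_sqrt[of "\<lambda>t. t" 0 "at_right 0"]
    by (auto simp: eventually_at_right_field intro!: exI[of _ 1])
  then have "filterlim (\<lambda>t. inverse (sqrt t)) at_top (at_right 0)"
    by (rule filterlim_compose[OF filterlim_inverse_at_top_right])
  then have "filterlim (\<lambda>t. b * inverse (sqrt t)) at_top (at_right 0)"
    by (rule filterlim_tendsto_pos_mult_at_top[OF tendsto_const b])
  from filterlim_compose[OF Erf_tendsto_1 this] show ?thesis by (simp add: divide_inverse)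
qed

text \<open>Heights above \<open>\<surd>t\<close> are handled by the decreasing barrier, heights below by the increasing one. After the
drift is made small, they yield the factors \<open>1 - Erf(a1/2)\<close> and \<open>Erf(2 a2)\<close>; the mean of 1 and the larger of
them leaves room for the exponentially small errors. The coefficients \<open>a1\<close>, \<open>a2\<close> survive a shrinking of the
chart, so the factor is the same in every step of the iteration.\<close>

lemma corner_improvement:
  fixes v :: "(real^'n) \<times> real \<Rightarrow> real"
  assumes p: "1 < p" and N: "2 \<le> CARD('n)" and op: "open \<Omega>" and v: "bounded_subsolution p \<Omega> v"
    and lat: "laterally_le \<Omega> v" and ch: "chart \<Omega> y r \<kappa> m M \<psi> \<nu>" and m: "0 < m"
  shows "\<exists>\<theta><1. 0 < \<theta> \<and> (\<forall>A>0. (\<exists>r>0. \<exists>T>0. \<forall>z\<in>\<Omega> \<inter> ball y r. \<forall>t. 0 < t \<and> t < T \<longrightarrow> v (z, t) \<le> A) \<longrightarrow>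
     (\<exists>r>0. \<exists>T>0. \<forall>z\<in>\<Omega> \<inter> ball y r. \<forall>t. 0 < t \<and> t < T \<longrightarrow> v (z, t) \<le> \<theta> * A))"
proof -
  define q where "q = normal_coeff p"
  have q: "0 < q" unfolding q_def using normal_coeff_bounds[OF p] by simp
  have r: "0 < r" "0 \<le> \<kappa>" using ch unfolding chart_def by auto
  have "m + 4 * r \<le> norm (\<nu> y) \<and> norm (\<nu> y) + 4 * r \<le> M" using ch r unfolding chart_def by (auto simp: dist_self)
  then have M: "0 < M" using m r by linarith
  have jet: "jet_subsolution p \<Omega> v" and vc: "continuous_on (\<Omega> \<times> {0<..}) v" and ini: "initially_le \<Omega> v"
    using v unfolding bounded_subsolution_def by auto
  define a1 where "a1 = 1 / (2 * M * sqrt q)"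
  define a2 where "a2 = 1 / (2 * m * sqrt q)"
  have a1: "0 < a1" "4 * a1\<^sup>2 * M\<^sup>2 * q \<le> 1" using M q by (auto simp: a1_def power_mult_distrib power_divide)
  have a2: "0 < a2" "1 \<le> 4 * a2\<^sup>2 * m\<^sup>2 * q" using m q by (auto simp: a2_def power_mult_distrib power_divide)
  define \<theta>0 where "\<theta>0 = max (Erf (2 * a2)) (1 - Erf (a1 / 2))"
  have \<theta>0: "0 < \<theta>0" "\<theta>0 < 1" using Erf_pos[of "2 * a2"] Erf_pos[of "a1/2"] a1 a2 Erf_less_1[of "2 * a2"] by (auto simp: \<theta>0_def)
  \<comment> \<open>strictly between the limiting factor and 1, to absorb \<open>h\<close> and the normalization\<close>
  define \<theta> where "\<theta> = (1 + \<theta>0) / 2"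
  have \<theta>: "0 < \<theta>" "\<theta> < 1" "\<theta>0 < \<theta>" using \<theta>0 by (auto simp: \<theta>_def)
  define C where "C = 2 * (\<kappa> + 1) * iso_coeff CARD('n) p"
  have C: "0 \<le> C" unfolding C_def using iso_coeff_nonneg[OF p N] r by simp
  show ?thesis
  proof (rule exI[of _ \<theta>], intro conjI allI impI \<theta>(1,2))
    fix A :: real assume A: "0 < A" and "\<exists>r>0. \<exists>T>0. \<forall>z\<in>\<Omega> \<inter> ball y r. \<forall>t. 0 < t \<and> t < T \<longrightarrow> v (z, t) \<le> A"
    then obtain r0 T0 where r0: "0 < r0" "0 < T0" "\<And>z t. z \<in> \<Omega> \<inter> ball y r0 \<Longrightarrow> 0 < t \<Longrightarrow> t < T0 \<Longrightarrow> v (z, t) \<le> A" by blast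
    define r' where "r' = min r r0"
    have r': "0 < r'" "r' \<le> r" "r' \<le> r0" using r r0 by (auto simp: r'_def)
    note ch' = chart_shrink[OF ch r'(1,2)]
    obtain D c where Dc: "0 < D" "0 < c" "\<And>z t. dist z y = r' / 2 \<Longrightarrow> r'\<^sup>2 / 16 \<le> \<psi> z \<Longrightarrow> 0 < t \<Longrightarrow> v (z, t) \<le> D * exp (- c / t)"
      using compact_decay[OF p N op v chart_deep_sphere[OF ch']] by blast
    define h where "h = A * (\<theta> - \<theta>0)"
    have h: "0 < h" using A \<theta> by (simp add: h_def)
    have "\<forall>\<^sub>F T in at_right 0. D * exp (- c / T) < h" by (rule order_tendstoD(2)[OF exp_inverse_tendsto_0[OF Dc(2)] h])
    moreover have "\<forall>\<^sub>F T in at_right 0. \<theta>0 / \<theta> < Erf (a2 * (r'\<^sup>2 / 16) / sqrt T)"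
      by (rule order_tendstoD(1)[OF Erf_inverse_sqrt_tendsto_1]) (use a2 r' \<theta> in \<open>auto simp: divide_less_eq\<close>)
    moreover have "((\<lambda>T. C * sqrt T) \<longlongrightarrow> C * sqrt 0) (at_right 0)" by (intro tendsto_intros)
    then have "\<forall>\<^sub>F T in at_right 0. C * sqrt T < 1/2" by (rule order_tendstoD(2)) simp
    moreover have "\<forall>\<^sub>F T in at_right 0. T \<in> {0<..<T0}" by (rule eventually_at_right_real[OF r0(2)])
    ultimately have "\<forall>\<^sub>F T in at_right 0. D * exp (- c / T) < h \<and> \<theta>0 / \<theta> < Erf (a2 * (r'\<^sup>2 / 16) / sqrt T) \<and> C * sqrt T < 1/2 \<and> T \<in> {0<..<T0}"
      by eventually_elim simp
    from eventually_happens[OF this] obtain T where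
      T: "D * exp (- c / T) < h" "\<theta>0 / \<theta> < Erf (a2 * (r'\<^sup>2 / 16) / sqrt T)" "C * sqrt T < 1/2" "0 < T" "T < T0"
      by (auto simp: trivial_limit_at_right_real)
    show "\<exists>r>0. \<exists>T>0. \<forall>z\<in>\<Omega> \<inter> ball y r. \<forall>t. 0 < t \<and> t < T \<longrightarrow> v (z, t) \<le> \<theta> * A"
    proof (rule exI[of _ "r' / 4"], rule conjI, simp add: r'(1), rule exI[of _ T], intro conjI T(4) ballI allI impI)
      fix z t assume z: "z \<in> \<Omega> \<inter> ball y (r'/4)" and "0 < t \<and> t < T"
      then have t: "0 < t" "t < T" by auto
      have vA: "v (z, t) \<le> A" if "z \<in> \<Omega> \<inter> ball y r'" "0 < t" "t < T" for z t
        using that r' T by (intro r0(3)) auto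
      have z': "z \<in> \<Omega>" "dist z y < r' / 4" using z by (auto simp: dist_commute)
      have st: "0 < sqrt t" "C * sqrt t < 1/2"
      proof -
        show "0 < sqrt t" using t by simp
        have "C * sqrt t \<le> C * sqrt T" using t C by (intro mult_left_mono) auto
        then show "C * sqrt t < 1/2" using T by simp
      qed
      have tt: "(\<psi> z + e * C * t) / sqrt t = \<psi> z / sqrt t + e * (C * sqrt t)" for e
      proof -
        have "e * C * t / sqrt t = e * C * (t / sqrt t)" by simp
        then show ?thesis using t by (simp add: add_divide_distrib real_div_sqrt)
      qed
      have deep: "v (z, t) \<le> h" if "dist z y = r' / 2" "r'\<^sup>2 / 16 \<le> \<psi> z" "0 < t" "t < T" for z t
      proof -
        have "D * exp (- c / t) \<le> D * exp (- c / T)" using Dc that T by (simp add: divide_left_mono)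
        then show ?thesis using Dc(3)[OF that(1-3)] T by linarith
      qed
      show "v (z, t) \<le> \<theta> * A"
      proof (cases "\<psi> z \<le> sqrt t")
        case True
        have "a2 * ((\<psi> z + C * t) / sqrt t) \<le> a2 * 2"
        proof (rule mult_left_mono)
          have "\<psi> z / sqrt t \<le> 1" using True st by simp
          moreover have "(\<psi> z + C * t) / sqrt t = \<psi> z / sqrt t + C * sqrt t" using tt[of 1] by (simp only: mult_1_left)
          ultimately show "(\<psi> z + C * t) / sqrt t \<le> 2" using st(2) by linarith
        qed (use a2 in simp)
        then have E: "Erf (a2 * ((\<psi> z + C * t) / sqrt t)) \<le> \<theta>0" using Erf_mono[of _ "a2 * 2"] by (force simp: \<theta>0_def mult.commute)
        have Epos: "0 < Erf (a2 * (r'\<^sup>2 / 16 / sqrt T))" using a2 r' T by (intro Erf_pos) simp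
        have "\<theta>0 \<le> \<theta> * Erf (a2 * (r'\<^sup>2 / 16 / sqrt T))" using T(2) \<theta> by (simp add: divide_less_eq mult.commute)
        with Epos have "A / Erf (a2 * (r'\<^sup>2 / 16 / sqrt T)) * \<theta>0 \<le> A * \<theta>"
          using A by (simp add: divide_le_eq mult_left_mono mult.assoc)
        moreover have "A / Erf (a2 * (r'\<^sup>2 / 16 / sqrt T)) * Erf (a2 * ((\<psi> z + C * t) / sqrt t)) \<le> A / Erf (a2 * (r'\<^sup>2 / 16 / sqrt T)) * \<theta>0"
          using E A Epos by (intro mult_left_mono) auto
        moreover have "v (z, t) \<le> A / Erf (a2 * (r'\<^sup>2 / 16 / sqrt T)) * Erf (a2 * ((\<psi> z + C * t) / sqrt t))"
          unfolding C_def by (rule increasing_barrier[OF p N jet op vc ch' a2(1) a2(2)[unfolded q_def] A vA lat z' t])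
        ultimately show ?thesis by (simp add: mult.commute)
      next
        case False
        have "a1 * (1/2) \<le> a1 * ((\<psi> z - C * t) / sqrt t)"
        proof (rule mult_left_mono)
          have "1 \<le> \<psi> z / sqrt t" using False st by simp
          moreover have "(\<psi> z - C * t) / sqrt t = \<psi> z / sqrt t - C * sqrt t" using tt[of "-1"] by simp
          ultimately show "1/2 \<le> (\<psi> z - C * t) / sqrt t" using st(2) by linarith
        qed (use a1 in simp)
        from Erf_mono[OF this] have "1 - Erf (a1 * ((\<psi> z - C * t) / sqrt t)) \<le> \<theta>0" by (simp add: \<theta>0_def)
        from mult_left_mono[OF this, of A] A
        have "A * (1 - Erf (a1 * ((\<psi> z - C * t) / sqrt t))) + h \<le> \<theta> * A" by (simp add: h_def algebra_simps)
        moreover have "v (z, t) \<le> A * (1 - Erf (a1 * ((\<psi> z - C * t) / sqrt t))) + h"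
          unfolding C_def by (rule decreasing_barrier[OF p N jet op vc ch' a1(1) a1(2)[unfolded q_def] A h vA ini deep z' t])
        ultimately show ?thesis by linarith
      qed
    qed
  qed
qed

text \<open>Iteration of the previous lemma, starting from the global bound.\<close>

lemma corner_le:
  fixes v :: "(real^'n) \<times> real \<Rightarrow> real"
  assumes p: "1 < p" and N: "2 \<le> CARD('n)" and op: "open \<Omega>" and v: "bounded_subsolution p \<Omega> v"
    and lat: "laterally_le \<Omega> v" and ch: "chart \<Omega> y r \<kappa> m M \<psi> \<nu>" and m: "0 < m" and e: "0 < e"
  shows "\<exists>r>0. \<exists>T>0. \<forall>z\<in>\<Omega> \<inter> ball y r. \<forall>t. 0 < t \<and> t < T \<longrightarrow> v (z, t) \<le> e"
proof -
  obtain \<theta> where \<theta>: "\<theta> < 1" "0 < \<theta>" and step: "\<And>A. 0 < A \<Longrightarrow> (\<exists>r>0. \<exists>T>0. \<forall>z\<in>\<Omega> \<inter> ball y r. \<forall>t. 0 < t \<and> t < T \<longrightarrow> v (z, t) \<le> A) \<Longrightarrow>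
     (\<exists>r>0. \<exists>T>0. \<forall>z\<in>\<Omega> \<inter> ball y r. \<forall>t. 0 < t \<and> t < T \<longrightarrow> v (z, t) \<le> \<theta> * A)"
    using corner_improvement[OF p N op v lat ch m] by blast
  obtain B where B: "0 < B" "\<forall>z\<in>\<Omega>. \<forall>t>0. v (z, t) \<le> B" using v unfolding bounded_subsolution_def by blast
  have it: "\<exists>r>0. \<exists>T>0. \<forall>z\<in>\<Omega> \<inter> ball y r. \<forall>t. 0 < t \<and> t < T \<longrightarrow> v (z, t) \<le> \<theta> ^ n * B" for n
  proof (induction n)
    case 0
    show ?case by (rule exI[of _ 1], simp, rule exI[of _ 1]) (use B in auto)
  next
    case (Suc n)
    from step[OF _ Suc] B \<theta> show ?case by (simp add: mult.assoc)
  qed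
  have "(\<lambda>n. \<theta> ^ n * B) \<longlonglongrightarrow> 0" using LIMSEQ_power_zero[of \<theta>] \<theta> by (intro tendsto_mult_left_zero) auto
  from order_tendstoD(2)[OF this e] obtain n where "\<theta> ^ n * B < e" by (auto simp: eventually_sequentially)
  then show ?thesis using it[of n] by (meson less_imp_le order_trans)
qed

text \<open>With the corner under control, \<open>\<epsilon> (|z|\<^sup>2 + 2 C t + 1)\<close> is a barrier on large balls intersected with \<open>\<Omega>\<close>;
its growth replaces a condition at infinity when \<open>\<Omega>\<close> is unbounded.\<close>

lemma bounded_subsolution_nonpos:
  fixes v :: "(real^'n) \<times> real \<Rightarrow> real"
  assumes p: "1 < p" and N: "2 \<le> CARD('n)" and op: "open \<Omega>" and v: "bounded_subsolution p \<Omega> v"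
    and lat: "laterally_le \<Omega> v"
    and charts: "\<And>y. y \<in> frontier \<Omega> \<Longrightarrow> \<exists>r \<kappa> m M \<psi> \<nu>. chart \<Omega> y r \<kappa> m M \<psi> \<nu> \<and> 0 < m"
    and z1: "z1 \<in> \<Omega>" and t1: "0 < t1"
  shows "v (z1, t1) \<le> 0"
proof (rule le_of_le_add_eps_mult)
  fix \<epsilon> :: real assume \<epsilon>: "0 < \<epsilon>"
  have jet: "jet_subsolution p \<Omega> v" and vc: "continuous_on (\<Omega> \<times> {0<..}) v" and ini: "initially_le \<Omega> v"
    using v unfolding bounded_subsolution_def by auto
  obtain B where B: "0 < B" "\<And>z t. z \<in> \<Omega> \<Longrightarrow> 0 < t \<Longrightarrow> v (z, t) \<le> B" using v unfolding bounded_subsolution_def by blast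
  define C where "C = iso_coeff CARD('n) p"
  have C: "0 \<le> C" unfolding C_def by (rule iso_coeff_nonneg[OF p N])
  define \<rho> where "\<rho> = sqrt (B / \<epsilon>) + norm z1 + 1"
  have s0: "0 < sqrt (B / \<epsilon>)" using B \<epsilon> by simp
  have \<rho>: "0 < \<rho>" "norm z1 < \<rho>" "B \<le> \<epsilon> * \<rho>\<^sup>2"
  proof -
    show "0 < \<rho>" unfolding \<rho>_def using s0 norm_ge_zero[of z1] by linarith
    show "norm z1 < \<rho>" unfolding \<rho>_def using s0 by linarith
    have "(sqrt (B / \<epsilon>))\<^sup>2 \<le> \<rho>\<^sup>2" unfolding \<rho>_def using s0 by (intro power_mono) auto
    then have "B / \<epsilon> \<le> \<rho>\<^sup>2" using B \<epsilon> by simp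
    then show "B \<le> \<epsilon> * \<rho>\<^sup>2" using \<epsilon> by (simp add: divide_le_eq mult.commute)
  qed
  define f where "f s t = \<epsilon> * (s + 2 * C * t + 1)" for s t
  define \<phi> where "\<phi> z = (norm (z - 0))\<^sup>2" for z :: "real^'n"
  define V where "V = \<Omega> \<inter> ball 0 \<rho>"
  define T where "T = t1 + 1"
  have f_ge: "\<epsilon> \<le> f (\<phi> z) t" if "0 < t" for z t
    using \<epsilon> C that by (simp add: f_def \<phi>_def)
  have fc: "isCont (\<lambda>q. f (\<phi> (fst q)) (snd q)) q" for q
    unfolding f_def \<phi>_def by (intro continuous_intros)
  have small: "\<forall>\<^sub>F q in at (z, s) within V \<times> {0<..<T}. v q \<le> f (\<phi> (fst q)) (snd q)"
    if "\<forall>\<^sub>F q in at (z, s) within \<Omega> \<times> {0<..}. v q \<le> \<epsilon>" for z s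
  proof -
    have "\<forall>\<^sub>F q in at (z, s) within V \<times> {0<..<T}. v q \<le> \<epsilon>"
      by (rule eventually_within_mono[OF _ that]) (auto simp: V_def)
    with eventually_within_mem show ?thesis
    proof eventually_elim
      case (elim q) then show ?case using f_ge[of "snd q" "fst q"] by auto
    qed
  qed
  have "v (z1, t1) \<le> f (\<phi> z1) t1"
  proof (rule comparison_with_profile[OF jet, of V T B f \<phi> 0])
    show "V \<subseteq> \<Omega>" "open V" "bounded V" unfolding V_def using op by auto
    show "continuous_on (V \<times> {0<..<T}) v" using vc by (rule continuous_on_subset) (auto simp: V_def)
    show "v (z, t) \<le> B" if "z \<in> V" "0 < t" "t < T" for z t by (rule B) (use that in \<open>auto simp: V_def\<close>)
    show "continuous_on (V \<times> {0<..<T}) (\<lambda>q. f (\<phi> (fst q)) (snd q))"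
      by (intro continuous_at_imp_continuous_on ballI fc)
    show "- 0 \<le> f (\<phi> z) t" if "0 < t" for z t using f_ge[OF that, of z] \<epsilon> by simp
    show "z1 \<in> V" "0 < t1" "t1 < T" using z1 \<rho> t1 by (auto simp: V_def T_def)
  next
    fix z s assume zs: "z \<in> closure V" "0 \<le> s" "s < T" "\<not> (z \<in> V \<and> 0 < s)"
    have "closure V \<subseteq> cball 0 \<rho>" by (rule closure_minimal) (auto simp: V_def)
    then have zc: "norm z \<le> \<rho>" using zs by auto
    show "\<forall>\<^sub>F q in at (z, s) within V \<times> {0<..<T}. v q \<le> f (\<phi> (fst q)) (snd q)"
    proof (cases "z \<in> \<Omega>")
      case False
      have "z \<in> closure \<Omega>" using zs(1) closure_mono[of V \<Omega>] by (auto simp: V_def)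
      then have fr: "z \<in> frontier \<Omega>" using False op by (simp add: frontier_def interior_open)
      show ?thesis
      proof (cases "s = 0")
        case False
        then show ?thesis using lat fr \<epsilon> zs(2) unfolding laterally_le_def by (intro small) auto
      next
        case True
        obtain r \<kappa> m M \<psi> \<nu> where "chart \<Omega> z r \<kappa> m M \<psi> \<nu>" "0 < m" using charts[OF fr] by blast
        from corner_le[OF p N op v lat this \<epsilon>] obtain r' T' where
          c: "0 < r'" "0 < T'" "\<forall>z\<in>\<Omega> \<inter> ball z r'. \<forall>t. 0 < t \<and> t < T' \<longrightarrow> v (z, t) \<le> \<epsilon>" by blast
        have "open (ball z r' \<times> {..<T'})" by (intro open_Times) auto
        then have "\<forall>\<^sub>F q in nhds (z, s). q \<in> ball z r' \<times> {..<T'}"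
          using c True by (intro eventually_nhds_in_open) auto
        then have "\<forall>\<^sub>F q in at (z, s) within \<Omega> \<times> {0<..}. q \<in> ball z r' \<times> {..<T'}"
          unfolding eventually_at_filter by (rule eventually_mono) simp
        with eventually_within_mem have "\<forall>\<^sub>F q in at (z, s) within \<Omega> \<times> {0<..}. v q \<le> \<epsilon>"
          by eventually_elim (use c in auto)
        then show ?thesis by (rule small)
      qed
    next
      case z\<Omega>: True
      show ?thesis
      proof (cases "s = 0")
        case True
        then show ?thesis using ini z\<Omega> \<epsilon> unfolding initially_le_def by (intro small) auto
      next
        case False
        then have s: "0 < s" using zs by simp
        then have "norm z = \<rho>" using zs(4) z\<Omega> zc by (auto simp: V_def)
        then have "- f (\<phi> z) s < - B"
        proof -
          have "0 \<le> \<epsilon> * (2 * C * s)" using \<epsilon> C s by simp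
          moreover have "f (\<phi> z) s = \<epsilon> * \<rho>\<^sup>2 + \<epsilon> * (2 * C * s) + \<epsilon>"
            using \<open>norm z = \<rho>\<close> by (simp add: f_def \<phi>_def algebra_simps)
          ultimately show ?thesis using \<rho>(3) \<epsilon> by linarith
        qed
        then have "\<forall>\<^sub>F q in at (z, s) within V \<times> {0<..<T}. - f (\<phi> (fst q)) (snd q) < - B"
          using fc[of "(z, s)"] by (intro eventually_within_less continuous_intros) auto
        with eventually_within_mem show ?thesis
        proof eventually_elim
          case (elim q) then show ?case using B(2)[of "fst q" "snd q"] by (auto simp: V_def)
        qed
      qed
    qed
  next
    fix z s assume zs: "z \<in> V" "0 < s" "s < T" "f (\<phi> z) s < v (z, s)"
    have tay: "taylor2 f (\<phi> z) s ((\<lambda>_. \<epsilon>) (\<phi> z)) ((\<lambda>_. \<epsilon> * (2 * C)) (\<phi> z, s)) 0"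
      unfolding f_def by (rule taylor2I) (auto intro!: always_eventually derivative_eq_intros)
    have c11: "\<forall>\<^sub>F z' in nhds z. \<bar>\<phi> z' - \<phi> z - (2 *\<^sub>R (z - 0)) \<bullet> (z' - z)\<bar> \<le> 1 * (norm (z' - z))\<^sup>2"
      unfolding \<phi>_def by (intro always_eventually allI square_norm_expansion)
    show "supersolution_at p f \<phi> z s"
      by (rule supersolution_atI[OF tay _ _ c11]) (use \<epsilon> in \<open>simp_all add: C_def\<close>)
  qed
  then show "v (z1, t1) \<le> 0 + \<epsilon> * ((norm z1)\<^sup>2 + 2 * C * t1 + 1)" by (simp add: f_def \<phi>_def)
qed

section \<open>Charts of domains of class C2\<close>

lemma graph_gradient:
  fixes g :: "real^'n \<Rightarrow> real"
  assumes "C2_on UNIV g"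
  obtains H where "\<And>z. GDERIV g z :> gradient g z" "\<And>z. (gradient g has_derivative blinfun_apply (H z)) (at z)" "continuous_on UNIV H"
proof -
  obtain G and H :: "real^'n \<Rightarrow> (real^'n) \<Rightarrow>\<^sub>L (real^'n)" where
    GH: "\<forall>x. GDERIV g x :> G x" "\<forall>x. (G has_derivative blinfun_apply (H x)) (at x)" "continuous_on UNIV H"
    using assms unfolding C2_on_def by auto
  have eq: "gradient g = G" using GH(1) gradient_eq by blast
  show thesis by (rule that[of H]) (use GH in \<open>simp_all add: eq\<close>)
qed

text \<open>The length of \<open>n - \<nabla>g\<close> at \<open>y\<close> can be approximated to any accuracy \<open>\<eta>\<close>. The bound \<open>B\<close> on the second
derivatives near \<open>y\<close> serves both as the \<open>C\<^sup>1\<^sup>,\<^sup>1\<close> constant and to control the variation of the gradient.\<close>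

lemma graph_chart:
  fixes g :: "real^'n \<Rightarrow> real"
  assumes gr: "C2_graph_near \<Omega> y n g" and \<eta>: "0 < \<eta>" "\<eta> \<le> norm (n - gradient g y)"
  shows "\<exists>r \<kappa>. chart \<Omega> y r \<kappa> (norm (n - gradient g y) - \<eta>) (norm (n - gradient g y) + \<eta>) (\<lambda>z. z \<bullet> n - g z) (\<lambda>z. n - gradient g z)"
proof -
  let ?G = "gradient g"
  have C2: "C2_on UNIV g" using gr unfolding C2_graph_near_def by auto
  obtain r0 where r0: "0 < r0" "\<Omega> \<inter> ball y r0 = {z \<in> ball y r0. z \<bullet> n > g z}" using gr unfolding C2_graph_near_def by auto
  obtain H where G: "\<And>z. GDERIV g z :> ?G z" and H: "\<And>z. (?G has_derivative blinfun_apply (H z)) (at z)" and Hc: "continuous_on UNIV H"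
    by (rule graph_gradient[OF C2], rule that)
  define B where "B = norm (H y) + 1"
  have B: "0 < B" by (simp add: B_def add_nonneg_pos)
  have "isCont H y" using Hc by (simp add: continuous_on_eq_continuous_at)
  then have "(H \<longlongrightarrow> H y) (nhds y)" by (simp add: isCont_def tendsto_nhds_iff)
  from order_tendstoD(2)[OF tendsto_norm[OF this], of B]
  have "\<forall>\<^sub>F z in nhds y. norm (H z) < B" by (simp add: B_def)
  then obtain r1 where r1: "0 < r1" "\<And>z. dist z y < r1 \<Longrightarrow> norm (H z) < B" unfolding eventually_nhds_metric by auto
  define r where "r = Min {r0, r1, \<eta> / (B + 4)}"
  have r: "0 < r" "r \<le> r0" "r \<le> r1" "r \<le> \<eta> / (B + 4)" using r0 r1 \<eta> B by (auto simp: r_def)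
  have rB: "(B + 4) * r \<le> \<eta>" using r(4) B by (simp add: le_divide_eq mult.commute)
  have lip: "norm (?G z' - ?G z) \<le> B * norm (z' - z)" if "z \<in> ball y r" "z' \<in> ball y r" for z z'
  proof (rule differentiable_bound[of "ball y r" ?G "\<lambda>z. blinfun_apply (H z)"])
    show "(?G has_derivative blinfun_apply (H x)) (at x within ball y r)" for x
      using H by (rule has_derivative_at_withinI)
    show "onorm (blinfun_apply (H x)) \<le> B" if "x \<in> ball y r" for x
      using r1(2)[of x] that r by (simp add: norm_blinfun.rep_eq[symmetric] dist_commute)
  qed (use that in auto)
  have gc: "continuous_on (ball y r) g"
    by (rule has_derivative_continuous_on[OF has_derivative_at_withinI]) (rule G[unfolded gderiv_def])
  show ?thesis unfolding chart_def
  proof (rule exI[of _ r], rule exI[of _ B], intro conjI ballI)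
    show "0 < r" "0 \<le> B" "0 \<le> norm (n - ?G y) - \<eta>" using r B \<eta> by auto
    show "\<Omega> \<inter> ball y r = {z \<in> ball y r. 0 < z \<bullet> n - g z}"
    proof -
      have sub: "ball y r \<subseteq> ball y r0" using r by auto
      then have "\<Omega> \<inter> ball y r = (\<Omega> \<inter> ball y r0) \<inter> ball y r" by blast
      then show ?thesis unfolding r0(2) using sub by auto
    qed
    show "continuous_on (ball y r) (\<lambda>z. z \<bullet> n - g z)" by (intro continuous_intros gc)
  next
    fix z z' assume z: "z \<in> ball y r" "z' \<in> ball y r"
    define h where "h = z' - z"
    have d: "((\<lambda>s. g (z + s *\<^sub>R h)) has_real_derivative (?G (z + s *\<^sub>R h) \<bullet> h)) (at s)" for s
    proof -
      have "(g has_derivative (\<lambda>k. k \<bullet> ?G (z + s *\<^sub>R h))) (at (z + s *\<^sub>R h))" using G by (simp add: gderiv_def)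
      then have "((\<lambda>s. g (z + s *\<^sub>R h)) has_derivative (\<lambda>k. (k *\<^sub>R h) \<bullet> ?G (z + s *\<^sub>R h))) (at s)"
        by (rule has_derivative_compose[rotated]) (auto intro!: derivative_eq_intros)
      then show ?thesis by (simp add: has_field_derivative_def inner_commute mult.commute[of _ "_ \<bullet> _"])
    qed
    obtain s where s: "0 < s" "s < 1" "g (z + 1 *\<^sub>R h) - g (z + 0 *\<^sub>R h) = (1 - 0) * (?G (z + s *\<^sub>R h) \<bullet> h)"
      using MVT2[of 0 1 "\<lambda>s. g (z + s *\<^sub>R h)" "\<lambda>s. ?G (z + s *\<^sub>R h) \<bullet> h"] d by auto
    have mem: "z + s *\<^sub>R h \<in> ball y r"
    proof -
      have "(1 - s) *\<^sub>R z + s *\<^sub>R z' \<in> ball y r" using convex_ball z s by (intro convexD) auto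
      moreover have "(1 - s) *\<^sub>R z + s *\<^sub>R z' = z + s *\<^sub>R h" by (simp add: h_def algebra_simps)
      ultimately show ?thesis by simp
    qed
    have "(z' \<bullet> n - g z') - (z \<bullet> n - g z) - (n - ?G z) \<bullet> (z' - z) = - ((?G (z + s *\<^sub>R h) - ?G z) \<bullet> h)"
      using s(3) by (simp add: h_def algebra_simps inner_commute)
    then have "\<bar>(z' \<bullet> n - g z') - (z \<bullet> n - g z) - (n - ?G z) \<bullet> (z' - z)\<bar> \<le> norm (?G (z + s *\<^sub>R h) - ?G z) * norm h"
      using Cauchy_Schwarz_ineq2 by simp
    also have "\<dots> \<le> (B * norm (s *\<^sub>R h)) * norm h" using lip[OF z(1) mem] by (intro mult_right_mono) auto
    also have "\<dots> \<le> (B * norm h) * norm h"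
      using s B by (intro mult_right_mono mult_left_mono) (auto intro: mult_left_le_one_le)
    finally show "\<bar>(z' \<bullet> n - g z') - (z \<bullet> n - g z) - (n - ?G z) \<bullet> (z' - z)\<bar> \<le> B * (norm (z' - z))\<^sup>2"
      by (simp add: h_def power2_eq_square mult.assoc)
  next
    fix z assume z: "z \<in> ball y r"
    have "norm (?G z - ?G y) \<le> B * norm (z - y)" by (rule lip) (use z r in auto)
    also have "\<dots> \<le> B * r" using z B by (intro mult_left_mono) (auto simp: dist_norm norm_minus_commute)
    finally have l: "norm (?G z - ?G y) \<le> B * r" .
    have e: "B * r + 4 * r \<le> \<eta>" using rB by (simp add: algebra_simps)
    have "norm ((n - ?G y) - (n - ?G z)) \<le> B * r" using l by simp
    then have "norm (n - ?G y) - norm (n - ?G z) \<le> B * r" "norm (n - ?G z) - norm (n - ?G y) \<le> B * r"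
      using norm_triangle_ineq2[of "n - ?G y" "n - ?G z"] norm_triangle_ineq2[of "n - ?G z" "n - ?G y"]
      by (simp_all add: norm_minus_commute)
    then show "norm (n - ?G y) - \<eta> + 4 * r \<le> norm (n - ?G z)" "norm (n - ?G z) + 4 * r \<le> norm (n - ?G y) + \<eta>"
      using e by linarith+
  qed
qed

text \<open>Since \<open>g\<close> is constant along \<open>n\<close>, its gradient is orthogonal to \<open>n\<close>.\<close>

lemma graph_conormal_nonzero:
  fixes g :: "real^'n \<Rightarrow> real"
  assumes gr: "C2_graph_near \<Omega> y n g"
  shows "gradient g z \<bullet> n = 0" "1 \<le> norm (n - gradient g z)"
proof -
  have C2: "C2_on UNIV g" and n: "norm n = 1" and inv: "\<And>z s. g (z + s *\<^sub>R n) = g z" using gr unfolding C2_graph_near_def by auto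
  have G: "GDERIV g z :> gradient g z" by (rule graph_gradient[OF C2])
  have "(g has_derivative (\<lambda>k. k \<bullet> gradient g z)) (at (z + 0 *\<^sub>R n))" using G by (simp add: gderiv_def)
  then have "((\<lambda>s. g (z + s *\<^sub>R n)) has_derivative (\<lambda>k. (k *\<^sub>R n) \<bullet> gradient g z)) (at 0)"
    by (rule has_derivative_compose[rotated]) (auto intro!: derivative_eq_intros)
  then have "((\<lambda>s. g z) has_derivative (\<lambda>k. (k *\<^sub>R n) \<bullet> gradient g z)) (at (0::real))" by (simp add: inv)
  from has_derivative_unique[OF this has_derivative_const] have "(1 *\<^sub>R n) \<bullet> gradient g z = 0" by meson
  then show o: "gradient g z \<bullet> n = 0" by (simp add: inner_commute)
  have "1 \<le> (norm (n - gradient g z))\<^sup>2"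
    using n o by (simp add: power2_norm_eq_inner algebra_simps inner_commute norm_eq_1)
  then show "1 \<le> norm (n - gradient g z)" by (metis abs_norm_cancel abs_square_le_1 linorder_le_cases norm_ge_zero one_power2 power2_le_imp_le)
qed

lemma C2_domain_chart:
  fixes \<Omega> :: "(real^'n) set"
  assumes "C2_domain \<Omega>" "y \<in> frontier \<Omega>"
  shows "\<exists>r \<kappa> m M \<psi> \<nu>. chart \<Omega> y r \<kappa> m M \<psi> \<nu> \<and> 0 < m"
proof -
  obtain n g where gr: "C2_graph_near \<Omega> y n g" using assms unfolding C2_domain_def by blast
  have l: "1 \<le> norm (n - gradient g y)" by (rule graph_conormal_nonzero[OF gr])
  from graph_chart[OF gr, of "1/2"] obtain r \<kappa> where
    "chart \<Omega> y r \<kappa> (norm (n - gradient g y) - 1/2) (norm (n - gradient g y) + 1/2) (\<lambda>z. z \<bullet> n - g z) (\<lambda>z. n - gradient g z)"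
    using l by auto
  then show ?thesis using l by (intro exI conjI) (assumption, simp)
qed

section \<open>Bounds on the solution near the boundary\<close>

text \<open>The roles of \<open>u\<close>, \<open>u - 1\<close>, \<open>- u\<close> and \<open>1 - u\<close>: the second and third are nonpositive on the parabolic boundary and
give \<open>0 \<le> u \<le> 1\<close>, the first feeds the decreasing barrier and the last the increasing one. The summand
\<open>-1\<close> is written with a plus sign to match \<open>jet_subsolution_add\<close>.\<close>

lemma bounded_solution_subsolutions:
  fixes u :: "(real^'n) \<times> real \<Rightarrow> real"
  assumes u: "bounded_solution p \<Omega> u" and op: "open \<Omega>"
  shows "bounded_subsolution p \<Omega> u"
    "bounded_subsolution p \<Omega> (\<lambda>q. u q + (-1))" "bounded_subsolution p \<Omega> (\<lambda>q. - u q)"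
    "laterally_le \<Omega> (\<lambda>q. u q + (-1))" "laterally_le \<Omega> (\<lambda>q. - u q)" "laterally_le \<Omega> (\<lambda>q. - u q + 1)"
    "jet_subsolution p \<Omega> (\<lambda>q. - u q + 1)" "continuous_on (\<Omega> \<times> {0<..}) u"
proof -
  have visc: "viscosity_solution p \<Omega> u" and bd: "bounded (u ` (\<Omega> \<times> {0<..}))"
    and uc: "continuous_on (closure \<Omega> \<times> {0..} - frontier \<Omega> \<times> {0}) u"
    and u0: "\<And>z. z \<in> \<Omega> \<Longrightarrow> u (z, 0) = 0" and u1: "\<And>z t. z \<in> frontier \<Omega> \<Longrightarrow> 0 < t \<Longrightarrow> u (z, t) = 1"
    using u unfolding bounded_solution_def by auto
  have disj: "z \<notin> frontier \<Omega>" if "z \<in> \<Omega>" for z using that op by (simp add: frontier_def interior_open)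
  have sub: "\<Omega> \<times> {0::real<..} \<subseteq> closure \<Omega> \<times> {0..} - frontier \<Omega> \<times> {0}"
    using closure_subset[of \<Omega>] by auto
  show c: "continuous_on (\<Omega> \<times> {0<..}) u" using uc sub by (rule continuous_on_subset)
  have lim: "(u \<longlongrightarrow> u q) (at q within \<Omega> \<times> {0<..})" if "q \<in> closure \<Omega> \<times> {0..} - frontier \<Omega> \<times> {0}" for q
    using uc that sub unfolding continuous_on_def by (blast intro: tendsto_within_subset)
  have lim0: "(u \<longlongrightarrow> 0) (at (z, 0) within \<Omega> \<times> {0<..})" if "z \<in> \<Omega>" for z
    using lim[of "(z, 0)"] u0 that disj closure_subset[of \<Omega>] by auto
  have lim1: "(u \<longlongrightarrow> 1) (at (z, t) within \<Omega> \<times> {0<..})" if "z \<in> frontier \<Omega>" "0 < t" for z t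
    using lim[of "(z, t)"] u1[OF that] that by (auto simp: frontier_def)
  have ev: "\<forall>\<^sub>F q in F. v q \<le> e" if "(v \<longlongrightarrow> l) F" "l < e" for v :: "(real^'n) \<times> real \<Rightarrow> real" and l e F
    using order_tendstoD(2)[OF that] by (rule eventually_mono) simp
  note jets = viscosity_jet_subsolution[OF visc bd]
  obtain M where M: "\<And>z t. z \<in> \<Omega> \<Longrightarrow> 0 < t \<Longrightarrow> \<bar>u (z, t)\<bar> \<le> M"
    using bd unfolding bounded_iff by auto
  have M': "0 < \<bar>M\<bar> + 1" by simp
  have b: "\<forall>z\<in>\<Omega>. \<forall>t>0. u (z, t) \<le> \<bar>M\<bar> + 1" "\<forall>z\<in>\<Omega>. \<forall>t>0. u (z, t) + (-1) \<le> \<bar>M\<bar> + 1" "\<forall>z\<in>\<Omega>. \<forall>t>0. - u (z, t) \<le> \<bar>M\<bar> + 1"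
    using M by (smt (verit))+
  show "bounded_subsolution p \<Omega> u" unfolding bounded_subsolution_def initially_le_def
    using jets(1) c b(1) M' by (blast intro: ev[OF lim0])
  show "bounded_subsolution p \<Omega> (\<lambda>q. u q + (-1))" unfolding bounded_subsolution_def initially_le_def
  proof (intro conjI ballI allI impI)
    show "jet_subsolution p \<Omega> (\<lambda>q. u q + (-1))" by (rule jet_subsolution_add[OF jets(1)])
    show "\<forall>\<^sub>F q in at (z, 0) within \<Omega> \<times> {0<..}. u q + (-1) \<le> e" if "z \<in> \<Omega>" "0 < e" for z e
      by (rule ev[OF tendsto_add[OF lim0[OF that(1)] tendsto_const]]) (use that in simp)
  qed (use b M' c in \<open>auto intro!: continuous_intros\<close>)
  show "bounded_subsolution p \<Omega> (\<lambda>q. - u q)" unfolding bounded_subsolution_def initially_le_def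
  proof (intro conjI ballI allI impI)
    show "\<forall>\<^sub>F q in at (z, 0) within \<Omega> \<times> {0<..}. - u q \<le> e" if "z \<in> \<Omega>" "0 < e" for z e
      by (rule ev[OF tendsto_minus[OF lim0[OF that(1)]]]) (use that in simp)
  qed (use jets(2) b M' c in \<open>auto intro!: continuous_intros\<close>)
  show "laterally_le \<Omega> (\<lambda>q. u q + (-1))" unfolding laterally_le_def
    by (intro ballI allI impI, rule ev[OF tendsto_add[OF lim1 tendsto_const]]) auto
  show "laterally_le \<Omega> (\<lambda>q. - u q)" unfolding laterally_le_def
    by (intro ballI allI impI, rule ev[OF tendsto_minus[OF lim1]]) auto
  show "laterally_le \<Omega> (\<lambda>q. - u q + 1)" unfolding laterally_le_def
    by (intro ballI allI impI, rule ev[OF tendsto_add[OF tendsto_minus[OF lim1] tendsto_const]]) auto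
  show "jet_subsolution p \<Omega> (\<lambda>q. - u q + 1)" by (rule jet_subsolution_add[OF jets(2)])
qed

lemma solution_between_0_1:
  fixes u :: "(real^'n) \<times> real \<Rightarrow> real"
  assumes p: "1 < p" and N: "2 \<le> CARD('n)" and \<Omega>: "C2_domain \<Omega>" and u: "bounded_solution p \<Omega> u"
    and z: "z \<in> \<Omega>" and t: "0 < t"
  shows "0 \<le> u (z, t)" "u (z, t) \<le> 1"
proof -
  have op: "open \<Omega>" using \<Omega> by (simp add: C2_domain_def)
  note s = bounded_solution_subsolutions[OF u op]
  show "0 \<le> u (z, t)" using bounded_subsolution_nonpos[OF p N op s(3,5) C2_domain_chart[OF \<Omega>] z t] by simp
  show "u (z, t) \<le> 1" using bounded_subsolution_nonpos[OF p N op s(2,4) C2_domain_chart[OF \<Omega>] z t] by simp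
qed

text \<open>The two barriers with the sharp constant \<open>A = 1\<close>. Each is applied on the time interval up to \<open>2 t\<close>, so that
the values on the sphere contribute an error that is exponentially small in \<open>1 / t\<close>.\<close>

lemma solution_sandwich:
  fixes u :: "(real^'n) \<times> real \<Rightarrow> real"
  assumes p: "1 < p" and N: "2 \<le> CARD('n)" and \<Omega>: "C2_domain \<Omega>" and u: "bounded_solution p \<Omega> u"
    and ch: "chart \<Omega> y r \<kappa> m M \<psi> \<nu>"
    and a1: "0 < a1" "4 * a1\<^sup>2 * M\<^sup>2 * normal_coeff p \<le> 1" and a2: "0 < a2" "1 \<le> 4 * a2\<^sup>2 * m\<^sup>2 * normal_coeff p"
  shows "\<exists>D c C b. 0 < D \<and> 0 < c \<and> 0 \<le> C \<and> 0 < b \<and> (\<forall>z\<in>\<Omega>. dist z y < r / 4 \<longrightarrow> (\<forall>t>0.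
     u (z, t) \<le> 1 - Erf (a1 * ((\<psi> z - C * t) / sqrt t)) + D * exp (- c / t) \<and>
     1 - Erf (a2 * ((\<psi> z + C * t) / sqrt t)) / Erf (b / sqrt t) \<le> u (z, t)))"
proof -
  have op: "open \<Omega>" using \<Omega> by (simp add: C2_domain_def)
  note s = bounded_solution_subsolutions[OF u op]
  note b = solution_between_0_1[OF p N \<Omega> u]
  have jet: "jet_subsolution p \<Omega> u" and ini: "initially_le \<Omega> u" using s(1) unfolding bounded_subsolution_def by auto
  have r: "0 < r" "0 \<le> \<kappa>" using ch unfolding chart_def by auto
  obtain D c where Dc: "0 < D" "0 < c" "\<And>z t. dist z y = r / 2 \<Longrightarrow> r\<^sup>2 / 16 \<le> \<psi> z \<Longrightarrow> 0 < t \<Longrightarrow> u (z, t) \<le> D * exp (- c / t)"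
    using compact_decay[OF p N op s(1) chart_deep_sphere[OF ch]] by blast
  define C where "C = 2 * (\<kappa> + 1) * iso_coeff CARD('n) p"
  have C: "0 \<le> C" unfolding C_def using iso_coeff_nonneg[OF p N] r by simp
  \<comment> \<open>the argument of the normalizing \<open>Erf\<close> at the horizon \<open>2 t\<close>, multiplied by \<open>\<surd>t\<close>\<close>
  define e where "e = a2 * (r\<^sup>2 / 16) / sqrt 2"
  have e: "0 < e" using a2 r by (simp add: e_def)
  have "u (z, t) \<le> 1 - Erf (a1 * ((\<psi> z - C * t) / sqrt t)) + D * exp (- (c/2) / t)"
    "1 - Erf (a2 * ((\<psi> z + C * t) / sqrt t)) / Erf (e / sqrt t) \<le> u (z, t)"
    if z: "z \<in> \<Omega>" "dist z y < r / 4" and t: "0 < t" for z t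
  proof -
    define T where "T = 2 * t"
    have T: "t < T" "0 < T" using t by (auto simp: T_def)
    have h: "0 < D * exp (- c / T)" using Dc by simp
    have deep: "u (z, t) \<le> D * exp (- c / T)" if "dist z y = r / 2" "r\<^sup>2 / 16 \<le> \<psi> z" "0 < t" "t < T" for z t
    proof -
      have "D * exp (- c / t) \<le> D * exp (- c / T)" using Dc that T by (simp add: divide_left_mono)
      then show ?thesis using Dc(3)[OF that(1-3)] by linarith
    qed
    have "u (z, t) \<le> 1 * (1 - Erf (a1 * ((\<psi> z - C * t) / sqrt t))) + D * exp (- c / T)"
      unfolding C_def by (rule decreasing_barrier[OF p N jet op s(8) ch a1 zero_less_one h b(2) ini deep z t T(1)]) auto
    moreover have "- c / T = - (c/2) / t" by (simp add: T_def)
    ultimately show "u (z, t) \<le> 1 - Erf (a1 * ((\<psi> z - C * t) / sqrt t)) + D * exp (- (c/2) / t)"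
      by (simp only: mult_1_left)
    have vc: "continuous_on (\<Omega> \<times> {0<..}) (\<lambda>q. - u q + 1)" by (intro continuous_intros s(8))
    have "- u (z, t) + 1 \<le> 1 / Erf (a2 * (r\<^sup>2 / 16 / sqrt T)) * Erf (a2 * ((\<psi> z + C * t) / sqrt t))"
      unfolding C_def by (rule increasing_barrier[OF p N s(7) op vc ch a2 zero_less_one _ s(6) z t T(1)]) (use b(1) in auto)
    moreover have "a2 * (r\<^sup>2 / 16 / sqrt T) = e / sqrt t" by (simp add: e_def T_def real_sqrt_mult)
    ultimately show "1 - Erf (a2 * ((\<psi> z + C * t) / sqrt t)) / Erf (e / sqrt t) \<le> u (z, t)" by simp
  qed
  then show ?thesis using Dc C e by - (rule exI[of _ D], rule exI[of _ "c/2"], rule exI[of _ C], rule exI[of _ e], auto)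
qed

section \<open>Volume between quadratic graphs\<close>

text \<open>Quadratic functions on coordinate families, the form in which product measures present the points of a
Euclidean space.\<close>

definition quad_graph :: "real \<Rightarrow> ('i \<Rightarrow> real) \<Rightarrow> 'i set \<Rightarrow> ('i \<Rightarrow> real) \<Rightarrow> real" where
  "quad_graph c a A f = c + (\<Sum>b\<in>A. a b * (f b)\<^sup>2)"

lemma quad_graph_upd: "i \<notin> A \<Longrightarrow> quad_graph c a A (f(i := y)) = quad_graph c a A f"
  unfolding quad_graph_def by (intro arg_cong2[where f = "(+)"] refl sum.cong) auto

lemma quad_graph_measurable [measurable]:
  "finite B \<Longrightarrow> A \<subseteq> B \<Longrightarrow> quad_graph c a A \<in> borel_measurable (Pi\<^sub>M B (\<lambda>_. lborel))"
  unfolding quad_graph_def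
  by (intro borel_measurable_add borel_measurable_sum borel_measurable_times borel_measurable_power) 
     (auto intro!: measurable_component_singleton[THEN measurable_compose])

text \<open>The fibres are intervals; the formula stays true where the interval is empty, because \<open>ennreal\<close> truncates
negative lengths.\<close>

lemma emeasure_between_quad_graphs:
  assumes A: "finite A" "i \<notin> A"
  shows "{f \<in> space (Pi\<^sub>M (insert i A) (\<lambda>_. lborel)). quad_graph c a A f \<le> f i \<and> f i \<le> quad_graph c' a' A f} \<in> sets (Pi\<^sub>M (insert i A) (\<lambda>_. lborel))" (is "?S \<in> _")
    "emeasure (Pi\<^sub>M (insert i A) (\<lambda>_. lborel)) {f \<in> space (Pi\<^sub>M (insert i A) (\<lambda>_. lborel)). quad_graph c a A f \<le> f i \<and> f i \<le> quad_graph c' a' A f}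
      = (\<integral>\<^sup>+ f. ennreal (quad_graph c' a' A f - quad_graph c a A f) \<partial>Pi\<^sub>M A (\<lambda>_. lborel))"
proof -
  interpret product_sigma_finite "\<lambda>_. lborel :: real measure" by standard
  let ?M = "Pi\<^sub>M (insert i A) (\<lambda>_. lborel :: real measure)"
  have m: "quad_graph c a A \<in> borel_measurable ?M" "quad_graph c' a' A \<in> borel_measurable ?M" "(\<lambda>f. f i) \<in> borel_measurable ?M"
    using A by (auto intro!: quad_graph_measurable)
  show S: "?S \<in> sets ?M" by (intro sets.sets_Collect_conj borel_measurable_le m)
  have "emeasure ?M ?S = (\<integral>\<^sup>+ f. indicator ?S f \<partial>?M)" using S by simp
  also have "\<dots> = (\<integral>\<^sup>+ f. (\<integral>\<^sup>+ y. indicator ?S (f(i := y)) \<partial>lborel) \<partial>Pi\<^sub>M A (\<lambda>_. lborel))"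
    using A S by (intro product_nn_integral_insert) auto
  also have "\<dots> = (\<integral>\<^sup>+ f. ennreal (quad_graph c' a' A f - quad_graph c a A f) \<partial>Pi\<^sub>M A (\<lambda>_. lborel))"
  proof (rule nn_integral_cong)
    fix f assume f: "f \<in> space (Pi\<^sub>M A (\<lambda>_. lborel :: real measure))"
    have "indicator ?S (f(i := y)) = (indicator {quad_graph c a A f .. quad_graph c' a' A f} y :: ennreal)" for y
      using f by (auto simp: indicator_def quad_graph_upd[OF A(2)] space_PiM PiE_def extensional_def)
    then have "(\<integral>\<^sup>+ y. indicator ?S (f(i := y)) \<partial>lborel) = emeasure lborel {quad_graph c a A f .. quad_graph c' a' A f}" by simp
    also have "\<dots> = ennreal (quad_graph c' a' A f - quad_graph c a A f)"
      by (cases "quad_graph c a A f \<le> quad_graph c' a' A f") (auto simp: ennreal_neg)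
    finally show "(\<integral>\<^sup>+ y. indicator ?S (f(i := y)) \<partial>lborel) = ennreal (quad_graph c' a' A f - quad_graph c a A f)" .
  qed
  finally show "emeasure ?M ?S = (\<integral>\<^sup>+ f. ennreal (quad_graph c' a' A f - quad_graph c a A f) \<partial>Pi\<^sub>M A (\<lambda>_. lborel))" .
qed

text \<open>The volume of \<open>|w|\<^sup>2 \<le> h \<le> 1\<close> in dimension \<open>m + 1\<close>.\<close>

definition paraboloid_volume :: "nat \<Rightarrow> real" where
  "paraboloid_volume m = unit_ball_vol (real m) * (2 / (real m + 2))"

text \<open>The integral is the volume of a paraboloid sliced by fibres; slicing it by levels instead gives balls.\<close>

lemma nn_integral_paraboloid:
  assumes A: "finite A" "i \<notin> A"
  shows "(\<integral>\<^sup>+ f. ennreal (1 - (\<Sum>b\<in>A. (f b)\<^sup>2)) \<partial>Pi\<^sub>M A (\<lambda>_. lborel)) = ennreal (paraboloid_volume (card A))"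
proof -
  interpret product_sigma_finite "\<lambda>_. lborel :: real measure" by standard
  let ?M = "Pi\<^sub>M (insert i A) (\<lambda>_. lborel :: real measure)"
  let ?MA = "Pi\<^sub>M A (\<lambda>_. lborel :: real measure)"
  let ?S = "{f \<in> space ?M. quad_graph 0 (\<lambda>_. 1) A f \<le> f i \<and> f i \<le> quad_graph 1 (\<lambda>_. 0) A f}"
  note S = emeasure_between_quad_graphs[OF A, where c = 0 and a = "\<lambda>_. 1" and c' = 1 and a' = "\<lambda>_. 0"]
  have "(\<integral>\<^sup>+ f. ennreal (1 - (\<Sum>b\<in>A. (f b)\<^sup>2)) \<partial>?MA) = emeasure ?M ?S"
  proof -
    have e: "quad_graph 1 (\<lambda>_. 0) A f - quad_graph 0 (\<lambda>_. 1) A f = 1 - (\<Sum>b\<in>A. (f b)\<^sup>2)" for f by (simp add: quad_graph_def)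
    show ?thesis by (simp only: S(2) e)
  qed
  also have "\<dots> = (\<integral>\<^sup>+ f. indicator ?S f \<partial>?M)" using S(1) by simp
  also have "\<dots> = (\<integral>\<^sup>+ y. (\<integral>\<^sup>+ f. indicator ?S (f(i := y)) \<partial>?MA) \<partial>lborel)"
    using A S(1) by (intro product_nn_integral_insert_rev) auto
  also have "\<dots> = (\<integral>\<^sup>+ y. ennreal (unit_ball_vol (real (card A)) * (indicator {0..1} y * y powr (real (card A) / 2))) \<partial>lborel)"
  proof (rule nn_integral_cong_AE)
    have "AE y in lborel. y \<noteq> (0::real)" by (rule AE_lborel_singleton)
    then show "AE y in lborel. (\<integral>\<^sup>+ f. indicator ?S (f(i := y)) \<partial>?MA) = ennreal (unit_ball_vol (real (card A)) * (indicator {0..1} y * y powr (real (card A) / 2)))"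
    proof eventually_elim
      case (elim y)
      let ?B = "{f. sqrt (\<Sum>b\<in>A. (f b)\<^sup>2) \<le> sqrt y} \<inter> space ?MA"
      show ?case
      proof (cases "0 < y \<and> y \<le> 1")
        case True
        have "(\<integral>\<^sup>+ f. indicator ?S (f(i := y)) \<partial>?MA) = (\<integral>\<^sup>+ f. indicator ?B f \<partial>?MA)"
        proof (rule nn_integral_cong)
          fix f assume f: "f \<in> space ?MA"
          show "indicator ?S (f(i := y)) = (indicator ?B f :: ennreal)"
            using f True unfolding indicator_def mem_Collect_eq quad_graph_upd[OF A(2)]
            by (auto simp: quad_graph_def space_PiM PiE_def extensional_def)
        qed
        also have "\<dots> = emeasure ?MA ?B" using A(1) by (intro nn_integral_indicator) auto
        also have "\<dots> = ennreal (unit_ball_vol (real (card A)) * sqrt y ^ card A)"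
          using True by (intro emeasure_cball_aux A) auto
        also have "sqrt y ^ card A = y powr (real (card A) / 2)"
          using True by (simp add: powr_half_sqrt[symmetric] powr_realpow[symmetric] powr_powr)
        finally have X: "(\<integral>\<^sup>+ f. indicator ?S (f(i := y)) \<partial>?MA) = ennreal (unit_ball_vol (real (card A)) * y powr (real (card A) / 2))" .
        have "indicator {0..1} y * y powr (real (card A) / 2) = y powr (real (card A) / 2)" using True by simp
        then show ?thesis unfolding X by (simp only:)
      next
        case False
        have s0: "indicator ?S (f(i := y)) = (0 :: ennreal)" for f
        proof -
          have "0 \<le> (\<Sum>b\<in>A. (f b)\<^sup>2)" by (simp add: sum_nonneg)
          then show ?thesis using False elim unfolding indicator_def mem_Collect_eq quad_graph_upd[OF A(2)]
            by (auto simp: quad_graph_def)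
        qed
        have "(\<integral>\<^sup>+ f. indicator ?S (f(i := y)) \<partial>?MA) = (\<integral>\<^sup>+ f. 0 \<partial>?MA)" by (rule nn_integral_cong) (rule s0)
        moreover have "indicator {0..1} y = (0::real)" using False elim by (auto simp: indicator_def)
        ultimately show ?thesis by simp
      qed
    qed
  qed
  also have "\<dots> = ennreal (unit_ball_vol (real (card A))) * (\<integral>\<^sup>+ y. ennreal (indicator {0..1} y * y powr (real (card A) / 2)) \<partial>lborel)"
    by (subst nn_integral_cmult[symmetric]) (auto simp: ennreal_mult')
  also have "(\<integral>\<^sup>+ y. ennreal (indicator {0..1} y * y powr (real (card A) / 2)) \<partial>lborel) = ennreal (1 / (real (card A) / 2 + 1))"
  proof -
    have "((\<lambda>y. y powr (real (card A) / 2)) has_integral (1 powr (real (card A) / 2 + 1) / (real (card A) / 2 + 1))) {0..1}"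
      by (rule has_integral_powr_from_0) auto
    from nn_integral_has_integral_lebesgue[OF _ this] show ?thesis by simp
  qed
  also have "ennreal (unit_ball_vol (real (card A))) * ennreal (1 / (real (card A) / 2 + 1)) = ennreal (paraboloid_volume (card A))"
    by (subst ennreal_mult[symmetric]) (auto simp: paraboloid_volume_def field_simps)
  finally show ?thesis .
qed

lemma emeasure_lborel_PiM_Basis:
  assumes "S \<in> sets (borel :: 'a::euclidean_space measure)"
  shows "emeasure lborel S = emeasure (Pi\<^sub>M Basis (\<lambda>_. lborel)) {f \<in> space (Pi\<^sub>M Basis (\<lambda>_. lborel)). (\<Sum>b\<in>Basis. f b *\<^sub>R b) \<in> S}"
  by (subst lborel_eq, subst emeasure_distr) (use assms in \<open>auto intro!: arg_cong2[where f = emeasure]\<close>)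

lemma emeasure_between_paraboloids:
  fixes n0 :: "'a::euclidean_space" and a a' :: "'a \<Rightarrow> real"
  assumes n0: "n0 \<in> Basis" 
  defines "A \<equiv> Basis - {n0}"
  shows "emeasure lborel {w. c + (\<Sum>b\<in>A. a b * (w \<bullet> b)\<^sup>2) \<le> w \<bullet> n0 \<and> w \<bullet> n0 \<le> c' + (\<Sum>b\<in>A. a' b * (w \<bullet> b)\<^sup>2)}
     = (\<integral>\<^sup>+ f. ennreal (quad_graph c' a' A f - quad_graph c a A f) \<partial>Pi\<^sub>M A (\<lambda>_. lborel))" (is "emeasure lborel ?S = _")
proof -
  have B: "insert n0 A = Basis" using n0 by (auto simp: A_def)
  have A: "finite A" "n0 \<notin> A" by (auto simp: A_def)
  have S: "?S \<in> sets borel" by (simp, measurable)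
  have comp: "(\<Sum>b\<in>Basis. f b *\<^sub>R b) \<bullet> b' = f b'" if "b' \<in> Basis" for f and b' :: 'a
    using that by (simp add: inner_sum_left inner_Basis if_distrib sum.If_cases cong: if_cong)
  have "emeasure lborel ?S = emeasure (Pi\<^sub>M Basis (\<lambda>_. lborel)) {f \<in> space (Pi\<^sub>M Basis (\<lambda>_. lborel)). (\<Sum>b\<in>Basis. f b *\<^sub>R b) \<in> ?S}"
    by (rule emeasure_lborel_PiM_Basis[OF S])
  also have "{f \<in> space (Pi\<^sub>M Basis (\<lambda>_. lborel)). (\<Sum>b\<in>Basis. f b *\<^sub>R b) \<in> ?S} =
     {f \<in> space (Pi\<^sub>M (insert n0 A) (\<lambda>_. lborel)). quad_graph c a A f \<le> f n0 \<and> f n0 \<le> quad_graph c' a' A f}"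
  proof -
    have "(\<Sum>b\<in>A. k b * (((\<Sum>b\<in>Basis. f b *\<^sub>R b) \<bullet> b)\<^sup>2)) = (\<Sum>b\<in>A. k b * (f b)\<^sup>2)" for k f
      by (intro sum.cong refl) (simp add: comp A_def)
    then show ?thesis unfolding B quad_graph_def by (simp add: comp n0)
  qed
  also have "emeasure (Pi\<^sub>M Basis (\<lambda>_. lborel)) \<dots> = (\<integral>\<^sup>+ f. ennreal (quad_graph c' a' A f - quad_graph c a A f) \<partial>Pi\<^sub>M A (\<lambda>_. lborel))"
    using emeasure_between_quad_graphs(2)[OF A] unfolding B .
  finally show ?thesis .
qed

text \<open>The fibres have the same lengths as those of the standard paraboloid: this is the shear that makes the
limit region depend on the curvatures only through the scaling.\<close>

corollary measure_between_paraboloids: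
  fixes n0 :: "'a::euclidean_space" and a a' :: "'a \<Rightarrow> real"
  assumes n0: "n0 \<in> Basis" and d: "\<And>b. b \<in> Basis - {n0} \<Longrightarrow> a b - a' b = 1"
  shows "emeasure lborel {w. (\<Sum>b\<in>Basis - {n0}. a b * (w \<bullet> b)\<^sup>2) \<le> w \<bullet> n0 \<and> w \<bullet> n0 \<le> 1 + (\<Sum>b\<in>Basis - {n0}. a' b * (w \<bullet> b)\<^sup>2)}
     = ennreal (paraboloid_volume (DIM('a) - 1))"
proof -
  let ?A = "Basis - {n0} :: 'a set"
  have "quad_graph 1 a' ?A f - quad_graph 0 a ?A f = 1 - (\<Sum>b\<in>?A. (f b)\<^sup>2)" for f
  proof -
    have "(\<Sum>b\<in>?A. a b * (f b)\<^sup>2) - (\<Sum>b\<in>?A. a' b * (f b)\<^sup>2) = (\<Sum>b\<in>?A. (f b)\<^sup>2)"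
      unfolding sum_subtractf[symmetric] using d by (intro sum.cong refl) (simp add: left_diff_distrib[symmetric])
    then show ?thesis by (simp add: quad_graph_def)
  qed
  moreover have "card ?A = DIM('a) - 1" using n0 by simp
  ultimately show ?thesis
    using emeasure_between_paraboloids[OF n0, of 0 a 1 a'] nn_integral_paraboloid[of ?A n0] by simp
qed

corollary null_set_quadratic_graph:
  fixes n0 :: "'a::euclidean_space" and a :: "'a \<Rightarrow> real"
  assumes n0: "n0 \<in> Basis"
  shows "AE w in lborel. w \<bullet> n0 \<noteq> c + (\<Sum>b\<in>Basis - {n0}. a b * (w \<bullet> b)\<^sup>2)"
proof (rule AE_I[of _ _ "{w. c + (\<Sum>b\<in>Basis - {n0}. a b * (w \<bullet> b)\<^sup>2) \<le> w \<bullet> n0 \<and> w \<bullet> n0 \<le> c + (\<Sum>b\<in>Basis - {n0}. a b * (w \<bullet> b)\<^sup>2)}"])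
  show "emeasure lborel {w. c + (\<Sum>b\<in>Basis - {n0}. a b * (w \<bullet> b)\<^sup>2) \<le> w \<bullet> n0 \<and> w \<bullet> n0 \<le> c + (\<Sum>b\<in>Basis - {n0}. a b * (w \<bullet> b)\<^sup>2)} = 0"
    unfolding emeasure_between_paraboloids[OF n0] by simp
  show "{w. c + (\<Sum>b\<in>Basis - {n0}. a b * (w \<bullet> b)\<^sup>2) \<le> w \<bullet> n0 \<and> w \<bullet> n0 \<le> c + (\<Sum>b\<in>Basis - {n0}. a b * (w \<bullet> b)\<^sup>2)} \<in> sets lborel"
    by (simp, measurable)
qed auto

lemma nn_integral_lborel_shift:
  fixes f :: "'a::euclidean_space \<Rightarrow> ennreal"
  assumes [measurable]: "f \<in> borel_measurable borel"
  shows "(\<integral>\<^sup>+ x. f (x + c) \<partial>lborel) = (\<integral>\<^sup>+ x. f x \<partial>lborel)"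
proof -
  have "(\<integral>\<^sup>+ x. f x \<partial>lborel) = (\<integral>\<^sup>+ x. f x \<partial>distr lborel borel ((+) c))" by (simp add: lborel_distr_plus)
  also have "\<dots> = (\<integral>\<^sup>+ x. f (x + c) \<partial>lborel)" by (subst nn_integral_distr) (auto simp: add.commute)
  finally show ?thesis by simp
qed

text \<open>Invariance under linear isometries in any Euclidean space. For the unit ball \<open>B\<close>, integrate
\<open>1\<^sub>S(Q x + y) 1\<^sub>B(y)\<close> over \<open>x\<close> and \<open>y\<close>. Integrating first in \<open>x\<close> gives the measure of the preimage of \<open>S\<close>
times that of \<open>B\<close>; substituting \<open>y - Q x\<close> for \<open>y\<close> and then integrating in \<open>x\<close> gives the measure of \<open>S\<close> times
that of \<open>B\<close>, as the ball is invariant.\<close>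

lemma emeasure_lborel_isometry:
  fixes Q :: "'a::euclidean_space \<Rightarrow> 'a"
  assumes lin: "linear Q" and surj: "surj Q" and iso: "\<And>w. norm (Q w) = norm w" and S: "S \<in> sets borel"
  shows "emeasure lborel {w. Q w \<in> S} = emeasure lborel S"
proof -
  have [measurable]: "Q \<in> borel_measurable borel"
    using lin by (intro borel_measurable_continuous_onI linear_continuous_on) (simp add: linear_conv_bounded_linear)
  note S[measurable]
  let ?B = "ball 0 1 :: 'a set"
  have [measurable]: "?B \<in> sets borel" by simp
  define \<beta> where "\<beta> = emeasure lborel ?B"
  have \<beta>: "\<beta> \<noteq> 0" "\<beta> \<noteq> \<infinity>" unfolding \<beta>_def using emeasure_ball[of 1 "0::'a"]
    by (auto simp: ennreal_eq_0_iff not_le)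
  have ball: "emeasure lborel (ball c 1 :: 'a set) = \<beta>" for c unfolding \<beta>_def by (simp add: emeasure_ball)
  have dist: "dist (Q v) (Q w) = dist v w" for v w
    using iso[of "v - w"] lin by (simp add: dist_norm linear_diff)
  have "(\<integral>\<^sup>+ y. (\<integral>\<^sup>+ x. indicator S (Q x + y) * indicator ?B y \<partial>lborel) \<partial>lborel) = emeasure lborel {w. Q w \<in> S} * \<beta>"
  proof -
    have "(\<integral>\<^sup>+ x. indicator S (Q x + y) * indicator ?B y \<partial>lborel) = emeasure lborel {w. Q w \<in> S} * indicator ?B y" for y
    proof -
      obtain c where c: "Q c = y" using surj by (metis surjD)
      have "(\<integral>\<^sup>+ x. indicator S (Q x + y) \<partial>lborel) = (\<integral>\<^sup>+ x. indicator S (Q (x + c)) \<partial>lborel)"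
        using lin c by (simp add: linear_add)
      also have "\<dots> = (\<integral>\<^sup>+ x. indicator S (Q x) \<partial>lborel)"
        by (rule nn_integral_lborel_shift[where f = "\<lambda>x. indicator S (Q x)"]) measurable
      also have "\<dots> = (\<integral>\<^sup>+ x. indicator {w. Q w \<in> S} x \<partial>lborel)" by (simp add: indicator_def)
      also have "\<dots> = emeasure lborel {w. Q w \<in> S}" by (rule nn_integral_indicator) measurable
      finally show ?thesis by (subst nn_integral_multc) auto
    qed
    then show ?thesis by (simp only: \<beta>_def) (rule nn_integral_cmult_indicator, simp)
  qed
  moreover have "(\<integral>\<^sup>+ y. (\<integral>\<^sup>+ x. indicator S (Q x + y) * indicator ?B y \<partial>lborel) \<partial>lborel) = emeasure lborel S * \<beta>"
  proof -
    have "(\<integral>\<^sup>+ y. (\<integral>\<^sup>+ x. indicator S (Q x + y) * indicator ?B y \<partial>lborel) \<partial>lborel)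
      = (\<integral>\<^sup>+ x. (\<integral>\<^sup>+ y. indicator S (Q x + y) * indicator ?B y \<partial>lborel) \<partial>lborel)"
      by (rule lborel_pair.Fubini') measurable
    also have "\<dots> = (\<integral>\<^sup>+ x. (\<integral>\<^sup>+ y. indicator S y * indicator ?B (y - Q x) \<partial>lborel) \<partial>lborel)"
    proof (rule nn_integral_cong)
      fix x
      have "(\<integral>\<^sup>+ y. indicator S (y + Q x) * indicator ?B (y + Q x - Q x) \<partial>lborel) = (\<integral>\<^sup>+ y. indicator S y * indicator ?B (y - Q x) \<partial>lborel)"
        by (rule nn_integral_lborel_shift[where f = "\<lambda>y. indicator S y * indicator ?B (y - Q x)"]) measurable
      then show "(\<integral>\<^sup>+ y. indicator S (Q x + y) * indicator ?B y \<partial>lborel) = (\<integral>\<^sup>+ y. indicator S y * indicator ?B (y - Q x) \<partial>lborel)"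
        by (simp add: add.commute)
    qed
    also have "\<dots> = (\<integral>\<^sup>+ y. (\<integral>\<^sup>+ x. indicator S y * indicator ?B (y - Q x) \<partial>lborel) \<partial>lborel)"
      by (rule lborel_pair.Fubini') measurable
    also have "\<dots> = (\<integral>\<^sup>+ y. indicator S y * \<beta> \<partial>lborel)"
    proof (rule nn_integral_cong)
      fix y
      obtain c where c: "Q c = y" using surj by (metis surjD)
      have "indicator ?B (y - Q x) = (indicator (ball c 1) x :: ennreal)" for x
        unfolding c[symmetric] using dist[of x c] by (simp add: indicator_def dist_norm norm_minus_commute[of c x])
      then show "(\<integral>\<^sup>+ x. indicator S y * indicator ?B (y - Q x) \<partial>lborel) = indicator S y * \<beta>"
        by (simp only: ball[of c, symmetric]) (rule nn_integral_cmult_indicator, simp)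
    qed
    also have "\<dots> = emeasure lborel S * \<beta>" by (simp add: nn_integral_multc)
    finally show ?thesis .
  qed
  ultimately have "emeasure lborel {w. Q w \<in> S} * \<beta> = emeasure lborel S * \<beta>" by simp
  then show ?thesis using \<beta> by (metis ennreal_mult_cancel_left mult.commute top.not_eq_extremum infinity_ennreal_def)
qed

lemma measure_anisotropic_preimage:
  fixes S :: "'a::euclidean_space set" and E :: "'a \<Rightarrow> 'a"
  assumes S: "S \<in> sets borel" and E: "\<And>b b'. b \<in> Basis \<Longrightarrow> b' \<in> Basis \<Longrightarrow> E b \<bullet> E b' = (if b = b' then 1 else 0)"
    and d: "\<And>b. b \<in> Basis \<Longrightarrow> 0 < d b"
  shows "measure lborel S = (\<Prod>b\<in>Basis. d b) * measure lborel {w. y + (\<Sum>b\<in>Basis. (d b * (w \<bullet> b)) *\<^sub>R E b) \<in> S}"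
proof -
  define Q where "Q w = (\<Sum>b\<in>Basis. (w \<bullet> b) *\<^sub>R E b)" for w
  have linQ: "linear Q" unfolding Q_def
    by (rule linearI) (simp_all add: inner_add_left scaleR_left_distrib sum.distrib scaleR_sum_right)
  have inner: "Q v \<bullet> Q w = v \<bullet> w" for v w
  proof -
    have "E b \<bullet> Q w = w \<bullet> b" if "b \<in> Basis" for b
      using that by (simp add: Q_def inner_sum_right E if_distrib sum.delta cong: if_cong)
    then have "Q v \<bullet> Q w = (\<Sum>b\<in>Basis. (v \<bullet> b) * (w \<bullet> b))"
      unfolding Q_def[of v] inner_sum_left by (intro sum.cong) auto
    also have "\<dots> = v \<bullet> w" by (rule euclidean_inner[symmetric])
    finally show ?thesis .
  qed
  have normQ: "norm (Q w) = norm w" for w using inner[of w w] by (simp add: norm_eq)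
  have surj: "surj Q"
  proof (rule linear_injective_imp_surjective[OF linQ])
    show "inj Q" using normQ linear_injective_0[OF linQ] by (metis norm_eq_zero)
  qed simp
  have [measurable]: "Q \<in> borel_measurable borel"
    using linQ by (intro borel_measurable_continuous_onI linear_continuous_on) (simp add: linear_conv_bounded_linear)
  note S[measurable]
  define S' where "S' = {w. y + Q w \<in> S}"
  have S'b[measurable]: "S' \<in> sets borel"
  proof -
    have "S' = (\<lambda>w. y + Q w) -` S \<inter> space borel" by (auto simp: S'_def)
    also have "\<dots> \<in> sets borel" by measurable
    finally show ?thesis .
  qed
  have Sy: "{w. y + w \<in> S} \<in> sets borel"
  proof -
    have "{w. y + w \<in> S} = (\<lambda>w. y + w) -` S \<inter> space borel" by auto
    also have "\<dots> \<in> sets borel" by measurable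
    finally show ?thesis .
  qed
  have "emeasure lborel S = emeasure (distr lborel borel ((+) y)) S" by (simp add: lborel_distr_plus)
  also have "\<dots> = emeasure lborel {w. y + w \<in> S}" by (subst emeasure_distr) (auto simp: vimage_def)
  also have "\<dots> = emeasure lborel S'"
    using emeasure_lborel_isometry[OF linQ surj normQ Sy] by (simp add: S'_def)
  finally have "measure lborel S = measure lborel S'" by (simp add: measure_def)
  also have "\<dots> = (\<Prod>b\<in>Basis. d b) * measure lborel {w. (\<Sum>b\<in>Basis. (d b * (w \<bullet> b)) *\<^sub>R b) \<in> S'}"
  proof -
    define D :: "'a \<Rightarrow> 'a" where "D w = 0 + (\<Sum>b\<in>Basis. (d b * (w \<bullet> b)) *\<^sub>R b)" for w
    have [measurable]: "D \<in> borel_measurable borel" unfolding D_def by measurable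
    have "lborel = density (distr lborel borel D) (\<lambda>_. (\<Prod>j\<in>Basis. \<bar>d j\<bar>))"
      unfolding D_def by (rule lborel_affine_euclidean) (use d in force)
    then have "emeasure lborel S' = emeasure (density (distr lborel borel D) (\<lambda>_. (\<Prod>j\<in>Basis. \<bar>d j\<bar>))) S'" by simp
    also have "\<dots> = ennreal (\<Prod>j\<in>Basis. \<bar>d j\<bar>) * emeasure lborel (D -` S' \<inter> space lborel)"
      using S'b by (simp add: emeasure_density nn_integral_cmult emeasure_distr)
    also have "(\<Prod>j\<in>Basis. \<bar>d j\<bar>) = (\<Prod>j\<in>Basis. d j)" using d by (intro prod.cong abs_of_pos) auto
    finally have "measure lborel S' = (\<Prod>j\<in>Basis. d j) * measure lborel (D -` S')"
      using d by (simp add: measure_def enn2real_mult prod_nonneg less_imp_le)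
    moreover have "D -` S' = {w. (\<Sum>b\<in>Basis. (d b * (w \<bullet> b)) *\<^sub>R b) \<in> S'}" by (auto simp: D_def)
    ultimately show ?thesis by simp
  qed
  also have "{w. (\<Sum>b\<in>Basis. (d b * (w \<bullet> b)) *\<^sub>R b) \<in> S'} = {w. y + (\<Sum>b\<in>Basis. (d b * (w \<bullet> b)) *\<^sub>R E b) \<in> S}"
  proof -
    have "Q (\<Sum>b\<in>Basis. (d b * (w \<bullet> b)) *\<^sub>R b) = (\<Sum>b\<in>Basis. (d b * (w \<bullet> b)) *\<^sub>R E b)" for w :: 'a
      unfolding Q_def by (intro sum.cong refl) (simp add: inner_sum_left inner_Basis if_distrib sum.delta cong: if_cong)
    then show ?thesis by (simp add: S'_def)
  qed
  finally show ?thesis .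
qed

section \<open>The volume of the region near the contact point\<close>

text \<open>In the scaled coordinates \<open>w\<close>, with \<open>w \<bullet> n0\<close> the normal one, the ball is the condition
\<open>lo w + O(s) < w \<bullet> n0\<close> and the bound on the height is \<open>w \<bullet> n0 \<le> 1 + hi w + o(1)\<close>; the scaling is chosen so that
\<open>lo w - hi w\<close> is the sum of the squares of the tangential coordinates. Therefore the scaled regions converge
almost everywhere and stay in a fixed box, for all \<open>s > 0\<close> if \<open>\<rho>\<close> is small. The box also yields the
bound for all \<open>s\<close>.\<close>

lemma boundary_cap_volume:
  fixes \<Omega> :: "(real^'n) set" and e :: "nat \<Rightarrow> real^'n"
  assumes N: "2 \<le> CARD('n)" and gr: "C2_graph_near \<Omega> y n g" and G0: "gradient g y = 0" and gy: "y \<bullet> n = g y"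
    and eo: "\<And>i j. i \<in> {1..CARD('n) - 1} \<Longrightarrow> j \<in> {1..CARD('n) - 1} \<Longrightarrow> e i \<bullet> e j = (if i = j then 1 else 0)"
    and en: "\<And>j. j \<in> {1..CARD('n) - 1} \<Longrightarrow> e j \<bullet> n = 0"
    and ek: "\<And>j. j \<in> {1..CARD('n) - 1} \<Longrightarrow> hessian g y *v e j = \<kappa> j *\<^sub>R e j"
    and R: "0 < R" and \<kappa>: "\<And>j. j \<in> {1..CARD('n) - 1} \<Longrightarrow> \<kappa> j < 1 / R"
  defines "L \<equiv> (\<Prod>j=1..CARD('n) - 1. sqrt (2 / (1 / R - \<kappa> j))) * paraboloid_volume (CARD('n) - 1)"
  defines "cap \<rho> s \<equiv> {z. z \<in> ball (y + R *\<^sub>R n) R \<and> dist z y < \<rho> \<and> z \<bullet> n - g z \<le> s}"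
  shows "\<exists>\<delta>>0. \<forall>\<rho>. 0 < \<rho> \<and> \<rho> \<le> \<delta> \<longrightarrow>
     ((\<lambda>s. measure lborel (cap \<rho> s) / s powr ((real CARD('n) + 1) / 2)) \<longlongrightarrow> L) (at_right 0) \<and>
     (\<exists>C. \<forall>s>0. measure lborel (cap \<rho> s) \<le> C * s powr ((real CARD('n) + 1) / 2))"
proof -
  have C2: "C2_on UNIV g" and nn: "norm n = 1" and inv: "\<And>z s. g (z + s *\<^sub>R n) = g z" using gr unfolding C2_graph_near_def by auto
  obtain H where G: "\<And>z. GDERIV g z :> gradient g z" and H: "\<And>z. (gradient g has_derivative blinfun_apply (H z)) (at z)" and Hc: "continuous_on UNIV H"
    by (rule graph_gradient[OF C2], rule that)
  have Hess: "blinfun_apply (H y) v = hessian g y *v v" for v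
  proof -
    have "frechet_derivative (gradient g) (at y) = blinfun_apply (H y)" using frechet_derivative_at[OF H] by simp
    then show ?thesis unfolding hessian_def jacobian_def
      by (simp add: matrix_works blinfun.bounded_linear_right bounded_linear.linear)
  qed
  let ?I = "{1..CARD('n) - 1}"
  define \<theta> where "\<theta> j = 1 / R - \<kappa> j" for j
  have \<theta>: "0 < \<theta> j" if "j \<in> ?I" for j using \<kappa>[OF that] by (simp add: \<theta>_def)
  obtain n0 :: "real^'n" where n0: "n0 \<in> Basis" using nonempty_Basis by blast
  define A where "A = Basis - {n0}"
  have A: "finite A" "n0 \<notin> A" "insert n0 A = Basis" "A \<subseteq> Basis" "card A = CARD('n) - 1"
    using n0 by (auto simp: A_def)
  have "card A = card ?I" using A by simp
  then obtain \<beta> where \<beta>: "bij_betw \<beta> A ?I" using finite_same_card_bij[of A ?I] A by auto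
  have \<beta>I: "\<beta> b \<in> ?I" if "b \<in> A" for b using \<beta> that by (auto simp: bij_betw_def)
  have \<beta>inj: "\<beta> b = \<beta> b' \<longleftrightarrow> b = b'" if "b \<in> A" "b' \<in> A" for b b' using \<beta> that by (auto simp: bij_betw_def inj_on_def)
  define E where "E b = (if b = n0 then n else e (\<beta> b))" for b
  have E: "E b \<bullet> E b' = (if b = b' then 1 else 0)" if "b \<in> Basis" "b' \<in> Basis" for b b'
  proof -
    have n1: "n \<bullet> n = 1" using nn by (simp add: norm_eq_1)
    have "b = n0 \<or> b \<in> A" "b' = n0 \<or> b' \<in> A" using that by (auto simp: A_def)
    then consider "b = n0" "b' = n0" | "b = n0" "b' \<in> A" | "b \<in> A" "b' = n0" | "b \<in> A" "b' \<in> A"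
      by blast
    then show ?thesis
    proof cases
      case 1 then show ?thesis by (simp add: E_def n1)
    next
      case 2
      then have "b' \<noteq> n0" using A(2) by blast
      then show ?thesis using 2 en[OF \<beta>I[OF 2(2)]] by (simp add: E_def inner_commute)
    next
      case 3
      then have "b \<noteq> n0" using A(2) by blast
      then show ?thesis using 3 en[OF \<beta>I[OF 3(1)]] by (simp add: E_def)
    next
      case 4
      then have "b \<noteq> n0" "b' \<noteq> n0" using A(2) by blast+
      then show ?thesis using eo[OF \<beta>I[OF 4(1)] \<beta>I[OF 4(2)]] \<beta>inj[OF 4] by (simp add: E_def)
    qed
  qed
  define \<mu> where "\<mu> b = sqrt (2 / \<theta> (\<beta> b))" for b
  have \<mu>: "0 < \<mu> b" "(\<mu> b)\<^sup>2 = 2 / \<theta> (\<beta> b)" if "b \<in> A" for b using \<theta>[OF \<beta>I[OF that]] by (auto simp: \<mu>_def)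
  define \<zeta> where "\<zeta> w = (\<Sum>b\<in>A. (\<mu> b * (w \<bullet> b)) *\<^sub>R E b)" for w
  define d where "d s b = (if b = n0 then s else sqrt s * \<mu> b)" for s b
  define T where "T s w = (\<Sum>b\<in>Basis. (d s b * (w \<bullet> b)) *\<^sub>R E b)" for s w
  have T: "T s w = (s * (w \<bullet> n0)) *\<^sub>R n + sqrt s *\<^sub>R \<zeta> w" for s w
  proof -
    have "T s w = (d s n0 * (w \<bullet> n0)) *\<^sub>R E n0 + (\<Sum>b\<in>A. (d s b * (w \<bullet> b)) *\<^sub>R E b)"
      unfolding T_def A(3)[symmetric] using A by (subst sum.insert) auto
    also have "(\<Sum>b\<in>A. (d s b * (w \<bullet> b)) *\<^sub>R E b) = sqrt s *\<^sub>R \<zeta> w"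
      unfolding \<zeta>_def scaleR_sum_right using A by (intro sum.cong) (auto simp: d_def)
    finally show ?thesis by (simp add: d_def E_def)
  qed
  have \<zeta>n: "\<zeta> w \<bullet> n = 0" for w
    unfolding \<zeta>_def inner_sum_left by (rule sum.neutral) (use A en[OF \<beta>I] in \<open>auto simp: E_def\<close>)
  have \<zeta>e: "\<zeta> w \<bullet> E b = \<mu> b * (w \<bullet> b)" if "b \<in> A" for w b
  proof -
    have "\<zeta> w \<bullet> E b = (\<Sum>b'\<in>A. if b' = b then \<mu> b * (w \<bullet> b) else 0)"
      unfolding \<zeta>_def inner_sum_left using that A(4) by (intro sum.cong refl) (auto simp: E subset_iff)
    then show ?thesis using that A by simp
  qed
  have \<zeta>\<zeta>: "(norm (\<zeta> w))\<^sup>2 = (\<Sum>b\<in>A. 2 / \<theta> (\<beta> b) * (w \<bullet> b)\<^sup>2)" for w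
  proof -
    have "(norm (\<zeta> w))\<^sup>2 = \<zeta> w \<bullet> (\<Sum>b\<in>A. (\<mu> b * (w \<bullet> b)) *\<^sub>R E b)" by (simp add: power2_norm_eq_inner \<zeta>_def)
    also have "\<dots> = (\<Sum>b\<in>A. (\<mu> b)\<^sup>2 * (w \<bullet> b)\<^sup>2)"
      unfolding inner_sum_right by (intro sum.cong refl) (simp add: \<zeta>e power2_eq_square)
    also have "\<dots> = (\<Sum>b\<in>A. 2 / \<theta> (\<beta> b) * (w \<bullet> b)\<^sup>2)" by (intro sum.cong refl) (simp add: \<mu>)
    finally show ?thesis .
  qed
  have H\<zeta>: "(hessian g y *v \<zeta> w) \<bullet> \<zeta> w = (\<Sum>b\<in>A. \<kappa> (\<beta> b) * (2 / \<theta> (\<beta> b) * (w \<bullet> b)\<^sup>2))" for w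
  proof -
    have "hessian g y *v \<zeta> w = (\<Sum>b\<in>A. (\<mu> b * (w \<bullet> b)) *\<^sub>R (\<kappa> (\<beta> b) *\<^sub>R E b))"
      unfolding \<zeta>_def using A
      by (auto simp: linear_sum[OF matrix_vector_mul_linear] linear_cmul[OF matrix_vector_mul_linear] E_def ek[OF \<beta>I] intro!: sum.cong)
    then have "(hessian g y *v \<zeta> w) \<bullet> \<zeta> w = (\<Sum>b\<in>A. (\<mu> b * (w \<bullet> b)) * (\<kappa> (\<beta> b) * (\<zeta> w \<bullet> E b)))"
      by (simp add: inner_sum_left inner_commute[of "E _"] mult.assoc)
    also have "\<dots> = (\<Sum>b\<in>A. \<kappa> (\<beta> b) * ((\<mu> b)\<^sup>2 * (w \<bullet> b)\<^sup>2))"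
      by (intro sum.cong refl) (simp add: \<zeta>e power2_eq_square)
    also have "\<dots> = (\<Sum>b\<in>A. \<kappa> (\<beta> b) * (2 / \<theta> (\<beta> b) * (w \<bullet> b)\<^sup>2))" by (intro sum.cong refl) (simp add: \<mu>)
    finally show ?thesis .
  qed
  define \<alpha> where "\<alpha> b = 1 / (R * \<theta> (\<beta> b))" for b
  define \<gamma> where "\<gamma> b = \<kappa> (\<beta> b) / \<theta> (\<beta> b)" for b
  have \<alpha>\<gamma>: "\<alpha> b - \<gamma> b = 1" if "b \<in> A" for b
    using \<theta>[OF \<beta>I[OF that]] R unfolding \<alpha>_def \<gamma>_def by (simp add: \<theta>_def field_simps)
  define lo where "lo w = (\<Sum>b\<in>A. \<alpha> b * (w \<bullet> b)\<^sup>2)" for w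
  define hi where "hi w = (\<Sum>b\<in>A. \<gamma> b * (w \<bullet> b)\<^sup>2)" for w
  have lo: "(norm (\<zeta> w))\<^sup>2 = 2 * R * lo w" for w
    unfolding \<zeta>\<zeta> lo_def sum_distrib_left \<alpha>_def using R by (intro sum.cong refl) simp
  have hi: "(hessian g y *v \<zeta> w) \<bullet> \<zeta> w = 2 * hi w" for w
    unfolding H\<zeta> hi_def sum_distrib_left \<gamma>_def by (intro sum.cong refl) simp
  have lohi: "lo w = hi w + (\<Sum>b\<in>A. (w \<bullet> b)\<^sup>2)" for w
  proof -
    have "lo w - hi w = (\<Sum>b\<in>A. (\<alpha> b - \<gamma> b) * (w \<bullet> b)\<^sup>2)"
      unfolding lo_def hi_def by (simp add: sum_subtractf left_diff_distrib)
    also have "\<dots> = (\<Sum>b\<in>A. (w \<bullet> b)\<^sup>2)" using \<alpha>\<gamma> by (intro sum.cong) auto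
    finally show ?thesis by simp
  qed
  have lo0: "0 \<le> lo w" for w
  proof -
    have "0 \<le> 2 * R * lo w" unfolding lo[symmetric] by simp
    then show ?thesis using R by (simp add: zero_le_mult_iff)
  qed
  have Peano: "\<exists>\<delta>>0. \<forall>h. norm h < \<delta> \<longrightarrow> \<bar>g (y + h) - g y - (hessian g y *v h) \<bullet> h / 2\<bar> \<le> \<epsilon> * (norm h)\<^sup>2" if \<epsilon>: "0 < \<epsilon>" for \<epsilon>
  proof -
    have "\<forall>\<^sub>F z in nhds y. \<bar>g z - g y - gradient g y \<bullet> (z - y) - 1/2 * (H y (z - y) \<bullet> (z - y))\<bar> \<le> \<epsilon> * (norm (z - y))\<^sup>2"
      by (rule second_order_Taylor_Peano[OF _ H \<epsilon>]) (simp add: G)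
    then obtain \<delta> where \<delta>: "0 < \<delta>" "\<And>z. dist z y < \<delta> \<Longrightarrow> \<bar>g z - g y - 1/2 * ((hessian g y *v (z - y)) \<bullet> (z - y))\<bar> \<le> \<epsilon> * (norm (z - y))\<^sup>2"
      unfolding eventually_nhds_metric Hess G0 by auto
    show ?thesis
    proof (intro exI[of _ \<delta>] conjI allI impI \<delta>(1))
      fix h :: "real^'n" assume "norm h < \<delta>"
      then show "\<bar>g (y + h) - g y - (hessian g y *v h) \<bullet> h / 2\<bar> \<le> \<epsilon> * (norm h)\<^sup>2"
        using \<delta>(2)[of "y + h"] by (simp add: dist_norm)
    qed
  qed
  have scaled: "\<bar>g (y + sqrt s *\<^sub>R \<zeta> w) - g y - s * hi w\<bar> \<le> \<epsilon> * (s * (norm (\<zeta> w))\<^sup>2)"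
    if "\<forall>h. norm h < \<delta> \<longrightarrow> \<bar>g (y + h) - g y - (hessian g y *v h) \<bullet> h / 2\<bar> \<le> \<epsilon> * (norm h)\<^sup>2" "norm (sqrt s *\<^sub>R \<zeta> w) < \<delta>" "0 < s" for \<delta> \<epsilon> s w
  proof -
    have "(hessian g y *v (sqrt s *\<^sub>R \<zeta> w)) \<bullet> (sqrt s *\<^sub>R \<zeta> w) = (sqrt s * sqrt s) * ((hessian g y *v \<zeta> w) \<bullet> \<zeta> w)"
      by (simp only: linear_cmul[OF matrix_vector_mul_linear] inner_scaleR_left inner_scaleR_right mult.assoc)
    also have "\<dots> = 2 * (s * hi w)" using that(3) unfolding hi by simp
    finally have 1: "(hessian g y *v (sqrt s *\<^sub>R \<zeta> w)) \<bullet> (sqrt s *\<^sub>R \<zeta> w) / 2 = s * hi w" by simp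
    have 2: "(norm (sqrt s *\<^sub>R \<zeta> w))\<^sup>2 = s * (norm (\<zeta> w))\<^sup>2" using that(3) by (simp add: power_mult_distrib)
    show ?thesis using that(1)[rule_format, OF that(2)] unfolding 1 2 .
  qed
  define W where "W \<rho> s = {w. y + T s w \<in> cap \<rho> s}" for \<rho> s
  have normT: "(norm (T s w))\<^sup>2 = (s * (w \<bullet> n0))\<^sup>2 + s * (norm (\<zeta> w))\<^sup>2" if "0 < s" for s w
  proof -
    have "orthogonal ((s * (w \<bullet> n0)) *\<^sub>R n) (sqrt s *\<^sub>R \<zeta> w)"
      using \<zeta>n[of w] by (simp add: orthogonal_def inner_commute)
    from norm_add_Pythagorean[OF this] show ?thesis
      unfolding T[symmetric] using that nn by (simp add: power_mult_distrib)
  qed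
  have n1: "n \<bullet> n = 1" using nn by (simp add: norm_eq_1)
  have sqd: "(norm (v - R *\<^sub>R n))\<^sup>2 = (norm v)\<^sup>2 - 2 * R * (v \<bullet> n) + R\<^sup>2" for v
    unfolding power2_norm_eq_inner inner_diff_left inner_diff_right inner_scaleR_left inner_scaleR_right n1 inner_commute[of n v]
    by (simp add: power2_eq_square algebra_simps)
  have inball: "y + T s w \<in> ball (y + R *\<^sub>R n) R \<longleftrightarrow> lo w + s * (w \<bullet> n0)\<^sup>2 / (2 * R) < w \<bullet> n0" if s: "0 < s" for s w
  proof -
    have Tn: "T s w \<bullet> n = s * (w \<bullet> n0)" unfolding T using \<zeta>n[of w] n1 by (simp add: inner_add_left)
    have "y + T s w \<in> ball (y + R *\<^sub>R n) R \<longleftrightarrow> (norm (T s w - R *\<^sub>R n))\<^sup>2 < R\<^sup>2"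
    proof -
      have "dist (y + R *\<^sub>R n) (y + T s w) = norm (T s w - R *\<^sub>R n)"
        by (simp add: dist_norm norm_minus_commute)
      then show ?thesis using abs_le_square_iff[of R "norm (T s w - R *\<^sub>R n)"] R by (simp add: not_le[symmetric])
    qed
    also have "(norm (T s w - R *\<^sub>R n))\<^sup>2 = (norm (T s w))\<^sup>2 - 2 * R * (T s w \<bullet> n) + R\<^sup>2"
      by (rule sqd)
    also have "\<dots> = R\<^sup>2 + 2 * R * s * (lo w + s * (w \<bullet> n0)\<^sup>2 / (2 * R) - w \<bullet> n0)"
      unfolding normT[OF s] lo Tn using R by (simp add: field_simps power2_eq_square)
    also have "\<dots> < R\<^sup>2 \<longleftrightarrow> lo w + s * (w \<bullet> n0)\<^sup>2 / (2 * R) - w \<bullet> n0 < 0"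
      using R s by (simp add: mult_less_0_iff)
    finally show ?thesis by simp
  qed
  have height: "(y + T s w) \<bullet> n - g (y + T s w) = s * (w \<bullet> n0) - (g (y + sqrt s *\<^sub>R \<zeta> w) - g y)" for s w
  proof -
    have "g (y + T s w) = g (y + sqrt s *\<^sub>R \<zeta> w)"
      using inv[of "y + sqrt s *\<^sub>R \<zeta> w" "s * (w \<bullet> n0)"] unfolding T by (simp add: algebra_simps)
    moreover have "(y + T s w) \<bullet> n = g y + s * (w \<bullet> n0)"
      unfolding T using \<zeta>n[of w] n1 gy by (simp add: inner_add_left)
    ultimately show ?thesis by simp
  qed
  \<comment> \<open>A quarter of the smallest gap \<open>1 / R - \<kappa> j\<close>: the Taylor error then costs at most half of the
    quadratic term that separates the ball from the graph.\<close>
  define \<epsilon>0 where "\<epsilon>0 = Min (insert 1 (\<theta> ` ?I)) / 4"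
  have \<epsilon>0: "0 < \<epsilon>0" "\<And>j. j \<in> ?I \<Longrightarrow> \<epsilon>0 \<le> \<theta> j / 4"
  proof -
    have "0 < Min (insert 1 (\<theta> ` ?I))" using \<theta> by (subst Min_gr_iff) auto
    then show "0 < \<epsilon>0" by (simp add: \<epsilon>0_def)
    show "\<epsilon>0 \<le> \<theta> j / 4" if "j \<in> ?I" for j
      unfolding \<epsilon>0_def using that by (intro divide_right_mono Min_le) auto
  qed
  have \<epsilon>\<zeta>: "\<epsilon>0 * (norm (\<zeta> w))\<^sup>2 \<le> (\<Sum>b\<in>A. (w \<bullet> b)\<^sup>2) / 2" for w
    unfolding \<zeta>\<zeta> sum_distrib_left sum_divide_distrib
  proof (rule sum_mono)
    fix b assume b: "b \<in> A"
    have l: "0 < \<theta> (\<beta> b)" "\<epsilon>0 \<le> \<theta> (\<beta> b) / 4" using \<theta> \<epsilon>0 \<beta>I[OF b] by auto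
    then have "\<epsilon>0 * (2 / \<theta> (\<beta> b)) \<le> 1 / 2" by (simp add: field_simps)
    from mult_right_mono[OF this, of "(w \<bullet> b)\<^sup>2"] show "\<epsilon>0 * (2 / \<theta> (\<beta> b) * (w \<bullet> b)\<^sup>2) \<le> (w \<bullet> b)\<^sup>2 / 2" by simp
  qed
  obtain \<delta>0 where \<delta>0: "0 < \<delta>0" "\<forall>h. norm h < \<delta>0 \<longrightarrow> \<bar>g (y + h) - g y - (hessian g y *v h) \<bullet> h / 2\<bar> \<le> \<epsilon>0 * (norm h)\<^sup>2"
    using Peano[OF \<epsilon>0(1)] by blast
  define K where "K = 2 + 2 * (\<Sum>b\<in>A. \<bar>\<gamma> b\<bar>)"
  have K: "2 \<le> K" by (simp add: K_def sum_nonneg)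
  define Box where "Box = cbox (\<Sum>b\<in>Basis. (-K) *\<^sub>R b) (\<Sum>b\<in>Basis. K *\<^sub>R b :: real^'n)"
  have T\<rho>: "norm (sqrt s *\<^sub>R \<zeta> w) \<le> norm (T s w)" if "0 < s" for s w
  proof (rule power2_le_imp_le)
    show "(norm (sqrt s *\<^sub>R \<zeta> w))\<^sup>2 \<le> (norm (T s w))\<^sup>2"
      unfolding normT[OF that] using that by (simp add: power_mult_distrib)
  qed simp
  have Wbox: "W \<rho> s \<subseteq> Box" if s: "0 < s" and \<rho>: "\<rho> \<le> \<delta>0" for s \<rho>
  proof
    fix w assume "w \<in> W \<rho> s"
    then have c: "y + T s w \<in> ball (y + R *\<^sub>R n) R" "norm (T s w) < \<rho>" "(y + T s w) \<bullet> n - g (y + T s w) \<le> s"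
      by (auto simp: W_def cap_def dist_norm)
    have b1: "lo w + s * (w \<bullet> n0)\<^sup>2 / (2 * R) < w \<bullet> n0" using inball[OF s] c(1) by blast
    have "0 \<le> s * (w \<bullet> n0)\<^sup>2 / (2 * R)" using s R by simp
    then have b2: "lo w < w \<bullet> n0" using b1 by linarith
    have "norm (sqrt s *\<^sub>R \<zeta> w) < \<delta>0" using T\<rho>[OF s, of w] c(2) \<rho> by linarith
    from scaled[OF \<delta>0(2) this s]
    have "g (y + sqrt s *\<^sub>R \<zeta> w) - g y \<le> s * hi w + \<epsilon>0 * (s * (norm (\<zeta> w))\<^sup>2)" by (simp add: abs_le_iff)
    then have "s * (w \<bullet> n0) \<le> s + (s * hi w + \<epsilon>0 * (s * (norm (\<zeta> w))\<^sup>2))" using c(3) unfolding height by linarith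
    also have "\<dots> = s * (1 + hi w + \<epsilon>0 * (norm (\<zeta> w))\<^sup>2)" by (simp add: algebra_simps)
    finally have b3: "w \<bullet> n0 \<le> 1 + hi w + \<epsilon>0 * (norm (\<zeta> w))\<^sup>2" using s by simp
    define S2 where "S2 = (\<Sum>b\<in>A. (w \<bullet> b)\<^sup>2)"
    have b4: "S2 < 2" using b2 b3 lohi[of w] \<epsilon>\<zeta>[of w] by (simp add: S2_def)
    have wb: "(w \<bullet> b)\<^sup>2 \<le> 2" if "b \<in> A" for b
      using member_le_sum[of b A "\<lambda>b. (w \<bullet> b)\<^sup>2"] that A(1) b4 by (simp add: S2_def)
    have "hi w \<le> (\<Sum>b\<in>A. \<bar>\<gamma> b\<bar> * 2)"
      unfolding hi_def
    proof (rule sum_mono)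
      fix b assume b: "b \<in> A"
      have "\<gamma> b * (w \<bullet> b)\<^sup>2 \<le> \<bar>\<gamma> b\<bar> * (w \<bullet> b)\<^sup>2" by (intro mult_right_mono) auto
      also have "\<dots> \<le> \<bar>\<gamma> b\<bar> * 2" using wb[OF b] by (intro mult_left_mono) auto
      finally show "\<gamma> b * (w \<bullet> b)\<^sup>2 \<le> \<bar>\<gamma> b\<bar> * 2" .
    qed
    then have b5: "w \<bullet> n0 \<le> K" using b3 b4 \<epsilon>\<zeta>[of w] by (simp add: K_def S2_def sum_distrib_right[symmetric])
    have b6: "0 \<le> w \<bullet> n0" using b2 lo0[of w] by linarith
    have "- K \<le> w \<bullet> b \<and> w \<bullet> b \<le> K" if "b \<in> Basis" for b
    proof (cases "b = n0")
      case False
      then have "(w \<bullet> b)\<^sup>2 \<le> 2" using wb that by (simp add: A_def)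
      then have "(w \<bullet> b)\<^sup>2 \<le> K\<^sup>2" using power_mono[OF K, of 2] by simp
      then have "\<bar>w \<bullet> b\<bar> \<le> K" using K by (simp add: abs_le_square_iff[symmetric])
      then show ?thesis by linarith
    qed (use b5 b6 K in auto)
    then show "w \<in> Box" by (simp add: Box_def mem_box inner_sum_left inner_Basis if_distrib sum.delta cong: if_cong)
  qed
  have gc: "continuous_on UNIV g"
    by (rule has_derivative_continuous_on[OF has_derivative_at_withinI]) (rule G[unfolded gderiv_def])
  have capm: "cap \<rho> s \<in> sets borel" for \<rho> s
  proof -
    have [measurable]: "g \<in> borel_measurable borel" using gc by (rule borel_measurable_continuous_onI)
    have "cap \<rho> s = ball (y + R *\<^sub>R n) R \<inter> ball y \<rho> \<inter> {z \<in> space borel. z \<bullet> n - g z \<le> s}" by (auto simp: cap_def dist_commute)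
    also have "\<dots> \<in> sets borel" by measurable
    finally show "cap \<rho> s \<in> sets borel" .
  qed
  have Wm: "W \<rho> s \<in> sets borel" for \<rho> s
  proof -
    have [measurable]: "T s \<in> borel_measurable borel" unfolding T_def by measurable
    have "W \<rho> s = (\<lambda>w. y + T s w) -` cap \<rho> s \<inter> space borel" by (auto simp: W_def)
    also have "\<dots> \<in> sets borel" using capm by measurable
    finally show ?thesis .
  qed
  define P0 where "P0 = (\<Prod>j\<in>?I. sqrt (2 / \<theta> j))"
  have P0: "P0 = (\<Prod>b\<in>A. \<mu> b)" unfolding P0_def \<mu>_def using prod.reindex_bij_betw[OF \<beta>, of "\<lambda>j. sqrt (2 / \<theta> j)"] by simp
  have capW: "measure lborel (cap \<rho> s) = (P0 * s powr ((real CARD('n) + 1) / 2)) * measure lborel (W \<rho> s)" if s: "0 < s" for \<rho> s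
  proof -
    have "measure lborel (cap \<rho> s) = (\<Prod>b\<in>Basis. d s b) * measure lborel {w. y + (\<Sum>b\<in>Basis. (d s b * (w \<bullet> b)) *\<^sub>R E b) \<in> cap \<rho> s}"
    proof (rule measure_anisotropic_preimage[OF capm E])
      show "0 < d s b" if "b \<in> Basis" for b using \<mu>(1)[of b] s that by (auto simp: d_def A_def)
    qed
    also have "{w. y + (\<Sum>b\<in>Basis. (d s b * (w \<bullet> b)) *\<^sub>R E b) \<in> cap \<rho> s} = W \<rho> s" by (simp add: W_def T_def)
    also have "(\<Prod>b\<in>Basis. d s b) = s * (\<Prod>b\<in>A. sqrt s * \<mu> b)"
    proof -
      have "(\<Prod>b\<in>Basis. d s b) = d s n0 * (\<Prod>b\<in>A. d s b)" unfolding A(3)[symmetric] using A by (subst prod.insert) auto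
      also have "(\<Prod>b\<in>A. d s b) = (\<Prod>b\<in>A. sqrt s * \<mu> b)" using A by (intro prod.cong) (auto simp: d_def)
      finally show ?thesis by (simp add: d_def)
    qed
    also have "\<dots> = P0 * (s * sqrt s ^ (CARD('n) - 1))" by (simp add: prod.distrib A P0)
    also have "s * sqrt s ^ (CARD('n) - 1) = s powr ((real CARD('n) + 1) / 2)"
    proof -
      have "s * sqrt s ^ (CARD('n) - 1) = s powr 1 * (s powr (1/2)) powr (real (CARD('n) - 1))"
      proof -
        have "sqrt s ^ k = (s powr (1/2)) powr (real k)" for k using s by (simp add: powr_half_sqrt powr_realpow)
        then show ?thesis using s by (simp only: powr_one_gt_zero_iff[THEN iffD2])
      qed
      also have "\<dots> = s powr (1 + 1/2 * real (CARD('n) - 1))" by (simp only: powr_powr powr_add)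
      also have "1 + 1/2 * real (CARD('n) - 1) = (real CARD('n) + 1) / 2" using N by (simp add: of_nat_diff field_simps)
      finally show ?thesis .
    qed
    finally show ?thesis .
  qed
  define P where "P = {w. (\<Sum>b\<in>A. \<alpha> b * (w \<bullet> b)\<^sup>2) \<le> w \<bullet> n0 \<and> w \<bullet> n0 \<le> 1 + (\<Sum>b\<in>A. \<gamma> b * (w \<bullet> b)\<^sup>2)}"
  have Pm: "P \<in> sets borel" unfolding P_def by (simp, measurable)
  have pv: "measure lborel P = paraboloid_volume (CARD('n) - 1)"
  proof -
    have "emeasure lborel P = ennreal (paraboloid_volume (DIM(real^'n) - 1))"
      unfolding P_def A_def using \<alpha>\<gamma> by (intro measure_between_paraboloids[OF n0]) (simp add: A_def)
    moreover have "0 \<le> paraboloid_volume (CARD('n) - 1)" by (simp add: paraboloid_volume_def)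
    ultimately show ?thesis by (simp add: measure_def)
  qed
  have boxfin: "integrable lborel (indicator Box :: real^'n \<Rightarrow> real)"
    unfolding Box_def by (rule integrable_real_indicator, simp, rule emeasure_bounded_finite, simp)
  have lim: "((\<lambda>s. measure lborel (W \<rho> s)) \<longlongrightarrow> measure lborel P) (at_right 0)" if \<rho>: "0 < \<rho>" "\<rho> \<le> \<delta>0" for \<rho>
    unfolding tendsto_at_iff_sequentially comp_def
  proof (intro allI impI)
    fix X :: "nat \<Rightarrow> real" assume X: "\<forall>i. X i \<in> {0<..} - {0}" "X \<longlonglongrightarrow> 0"
    have Xp: "0 < X i" for i using X(1) by auto
    have Xf: "filterlim X (at_right 0) sequentially" unfolding filterlim_at using X(2) by (simp add: Xp less_imp_neq[OF Xp, symmetric])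
    have "(\<lambda>i. LINT w|lborel. indicator (W \<rho> (X i)) w) \<longlonglongrightarrow> (LINT w|lborel. indicator P w :: real)"
    proof (rule integral_dominated_convergence[where w = "indicator Box"])
      show "(indicator P :: _ \<Rightarrow> real) \<in> borel_measurable lborel" "(indicator (W \<rho> (X i)) :: _ \<Rightarrow> real) \<in> borel_measurable lborel" for i
        using Pm Wm by auto
      show "integrable lborel (indicator Box :: real^'n \<Rightarrow> real)" by (rule boxfin)
      show "AE w in lborel. norm (indicator (W \<rho> (X i)) w :: real) \<le> indicator Box w" for i
        using Wbox[OF Xp \<rho>(2)] by (intro AE_I2) (auto simp: indicator_def)
      have ae: "AE w in lborel. w \<bullet> n0 \<noteq> 0 + lo w" "AE w in lborel. w \<bullet> n0 \<noteq> 1 + hi w"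
        unfolding lo_def hi_def A_def by (rule null_set_quadratic_graph[OF n0])+
      show "AE w in lborel. (\<lambda>i. indicator (W \<rho> (X i)) w) \<longlonglongrightarrow> (indicator P w :: real)"
        using ae
      proof eventually_elim
        case (elim w)
        have memW: "w \<in> W \<rho> s \<longleftrightarrow> (lo w + s * (w \<bullet> n0)\<^sup>2 / (2 * R) < w \<bullet> n0 \<and> norm (T s w) < \<rho> \<and>
            s * (w \<bullet> n0) - (g (y + sqrt s *\<^sub>R \<zeta> w) - g y) \<le> s)" if "0 < s" for s
          unfolding W_def cap_def mem_Collect_eq inball[OF that] height by (simp add: dist_norm)
        have q0: "((\<lambda>s. s * (w \<bullet> n0)\<^sup>2 / (2 * R)) \<longlongrightarrow> 0 * (w \<bullet> n0)\<^sup>2 / (2 * R)) (at_right 0)"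
          using R by (intro tendsto_intros) auto
        have t0: "((\<lambda>s. norm (T s w)) \<longlongrightarrow> norm ((0 * (w \<bullet> n0)) *\<^sub>R n + sqrt 0 *\<^sub>R \<zeta> w)) (at_right 0)"
          unfolding T by (intro tendsto_intros)
        have z0: "((\<lambda>s. norm (sqrt s *\<^sub>R \<zeta> w)) \<longlongrightarrow> norm (sqrt 0 *\<^sub>R \<zeta> w)) (at_right 0)"
          by (intro tendsto_intros)
        have pos: "\<forall>\<^sub>F s in at_right 0. (0::real) < s" by (rule eventually_at_right_less)
        have curv: "\<forall>\<^sub>F s in at_right 0. \<bar>g (y + sqrt s *\<^sub>R \<zeta> w) - g y - s * hi w\<bar> \<le> s * \<eta>" if \<eta>: "0 < \<eta>" for \<eta>
        proof -
          define \<epsilon> where "\<epsilon> = \<eta> / ((norm (\<zeta> w))\<^sup>2 + 1)"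
          have np: "0 < (norm (\<zeta> w))\<^sup>2 + 1" by (simp add: add_nonneg_pos)
          have \<epsilon>: "0 < \<epsilon>" using \<eta> np by (simp add: \<epsilon>_def)
          have \<epsilon>2: "\<epsilon> * (norm (\<zeta> w))\<^sup>2 \<le> \<eta>"
          proof -
            have "\<epsilon> * (norm (\<zeta> w))\<^sup>2 \<le> \<epsilon> * ((norm (\<zeta> w))\<^sup>2 + 1)" using \<epsilon> by (intro mult_left_mono) auto
            then show ?thesis using np by (simp add: \<epsilon>_def)
          qed
          obtain \<delta> where \<delta>: "0 < \<delta>" "\<forall>h. norm h < \<delta> \<longrightarrow> \<bar>g (y + h) - g y - (hessian g y *v h) \<bullet> h / 2\<bar> \<le> \<epsilon> * (norm h)\<^sup>2"
            using Peano[OF \<epsilon>] by blast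
          have "\<forall>\<^sub>F s in at_right 0. norm (sqrt s *\<^sub>R \<zeta> w) < \<delta>" by (rule order_tendstoD(2)[OF z0]) (use \<delta> in simp)
          with pos show ?thesis
          proof eventually_elim
            case (elim s)
            have "\<epsilon> * (s * (norm (\<zeta> w))\<^sup>2) \<le> s * \<eta>" using mult_left_mono[OF \<epsilon>2, of s] elim by (simp add: mult_ac)
            then show ?case using scaled[OF \<delta>(2) elim(2,1)] by linarith
          qed
        qed
        have "\<forall>\<^sub>F s in at_right 0. (indicator (W \<rho> s) w :: real) = indicator P w"
        proof (cases "w \<in> P")
          case True
          then have h: "lo w < w \<bullet> n0" "w \<bullet> n0 < 1 + hi w" using elim by (auto simp: P_def lo_def hi_def)
          have "\<forall>\<^sub>F s in at_right 0. s * (w \<bullet> n0)\<^sup>2 / (2 * R) < w \<bullet> n0 - lo w" by (rule order_tendstoD(2)[OF q0]) (use h in simp)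
          moreover have "\<forall>\<^sub>F s in at_right 0. norm (T s w) < \<rho>" by (rule order_tendstoD(2)[OF t0]) (use \<rho> in simp)
          moreover have "\<forall>\<^sub>F s in at_right 0. \<bar>g (y + sqrt s *\<^sub>R \<zeta> w) - g y - s * hi w\<bar> \<le> s * (1 + hi w - w \<bullet> n0)"
            by (rule curv) (use h in simp)
          ultimately show ?thesis using pos
          proof eventually_elim
            case (elim s)
            have "s * (w \<bullet> n0) - (g (y + sqrt s *\<^sub>R \<zeta> w) - g y) \<le> s"
              using elim(3) by (simp add: abs_le_iff algebra_simps)
            then have "w \<in> W \<rho> s" using elim memW[OF elim(4)] by simp
            then show ?case using True by simp
          qed
        next
          case False
          then consider "w \<bullet> n0 < lo w" | "1 + hi w < w \<bullet> n0" using elim by (force simp: P_def lo_def hi_def)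
          then show ?thesis
          proof cases
            case 1
            from pos show ?thesis
            proof eventually_elim
              case (elim s)
              have "0 \<le> s * (w \<bullet> n0)\<^sup>2 / (2 * R)" using elim R by simp
              then have "w \<notin> W \<rho> s" using 1 memW[OF elim] by auto
              then show ?case using False by simp
            qed
          next
            case 2
            define \<eta> where "\<eta> = (w \<bullet> n0 - 1 - hi w) / 2"
            have \<eta>: "0 < \<eta>" using 2 by (simp add: \<eta>_def)
            from pos curv[OF \<eta>] show ?thesis
            proof eventually_elim
              case (elim s)
              have "s * (w \<bullet> n0) = s + s * hi w + s * \<eta> + s * \<eta>" by (simp add: \<eta>_def algebra_simps)
              moreover have "0 < s * \<eta>" using elim \<eta> by simp
              moreover have "g (y + sqrt s *\<^sub>R \<zeta> w) - g y \<le> s * hi w + s * \<eta>" using elim(2) by (simp add: abs_le_iff)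
              ultimately have "\<not> s * (w \<bullet> n0) - (g (y + sqrt s *\<^sub>R \<zeta> w) - g y) \<le> s" by linarith
              then have "w \<notin> W \<rho> s" using memW[OF elim(1)] by auto
              then show ?case using False by simp
            qed
          qed
        qed
        from filterlim_iff[THEN iffD1, OF Xf, rule_format, OF this]
        show ?case by (rule tendsto_eventually)
      qed
    qed
    then show "(\<lambda>i. measure lborel (W \<rho> (X i))) \<longlonglongrightarrow> measure lborel P" by simp
  qed
  show ?thesis
  proof (rule exI[of _ \<delta>0], intro conjI allI impI \<delta>0(1))
    fix \<rho> assume "0 < \<rho> \<and> \<rho> \<le> \<delta>0"
    then have \<rho>: "0 < \<rho>" "\<rho> \<le> \<delta>0" by auto
    have "((\<lambda>s. P0 * measure lborel (W \<rho> s)) \<longlongrightarrow> P0 * measure lborel P) (at_right 0)"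
      by (intro tendsto_intros lim \<rho>)
    moreover have "\<forall>\<^sub>F s in at_right 0. P0 * measure lborel (W \<rho> s) = measure lborel (cap \<rho> s) / s powr ((real CARD('n) + 1) / 2)"
      using eventually_at_right_less[of "0::real"] by eventually_elim (simp add: capW)
    ultimately have "((\<lambda>s. measure lborel (cap \<rho> s) / s powr ((real CARD('n) + 1) / 2)) \<longlongrightarrow> P0 * measure lborel P) (at_right 0)"
      by (rule Lim_transform_eventually)
    then show "((\<lambda>s. measure lborel (cap \<rho> s) / s powr ((real CARD('n) + 1) / 2)) \<longlongrightarrow> L) (at_right 0)"
      unfolding pv L_def P0_def \<theta>_def .
    show "\<exists>C. \<forall>s>0. measure lborel (cap \<rho> s) \<le> C * s powr ((real CARD('n) + 1) / 2)"
    proof (intro exI[of _ "P0 * measure lborel Box"] allI impI)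
      fix s :: real assume s: "0 < s"
      have P0p: "0 \<le> P0" unfolding P0_def using \<theta> by (intro prod_nonneg) (auto simp: less_imp_le)
      have "measure lborel (W \<rho> s) \<le> measure lborel Box"
      proof -
        have "emeasure lborel Box < \<infinity>" unfolding Box_def by (rule emeasure_bounded_finite) simp
        moreover have "emeasure lborel (W \<rho> s) \<le> emeasure lborel Box"
          using Wbox[OF s \<rho>(2)] by (intro emeasure_mono) (auto simp: Box_def)
        ultimately show ?thesis unfolding measure_def by (intro enn2real_mono) auto
      qed
      then have "P0 * s powr ((real CARD('n) + 1) / 2) * measure lborel (W \<rho> s) \<le> P0 * s powr ((real CARD('n) + 1) / 2) * measure lborel Box"
        using P0p by (intro mult_left_mono) auto
      then show "measure lborel (cap \<rho> s) \<le> P0 * measure lborel Box * s powr ((real CARD('n) + 1) / 2)"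
        unfolding capW[OF s] by (simp add: mult_ac)
    qed
  qed
qed

section \<open>Contact of the ball and the boundary\<close>

lemma graph_boundary_height:
  fixes g :: "real^'n \<Rightarrow> real"
  assumes gr: "C2_graph_near \<Omega> y n g" and op: "open \<Omega>" and y: "y \<in> frontier \<Omega>"
  shows "y \<bullet> n = g y"
proof (rule antisym)
  obtain r where r: "0 < r" "\<Omega> \<inter> ball y r = {z \<in> ball y r. z \<bullet> n > g z}" using gr unfolding C2_graph_near_def by auto
  have "y \<notin> \<Omega>" using y op by (simp add: frontier_def interior_open)
  then have "y \<notin> \<Omega> \<inter> ball y r" by simp
  then show "y \<bullet> n \<le> g y" unfolding r(2) using r(1) by simp
  show "g y \<le> y \<bullet> n"
  proof (rule ccontr)
    assume "\<not> g y \<le> y \<bullet> n"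
    have C2: "C2_on UNIV g" using gr unfolding C2_graph_near_def by auto
    have "GDERIV g y :> gradient g y" by (rule graph_gradient[OF C2])
    then have gc: "isCont g y" unfolding gderiv_def by (rule has_derivative_continuous)
    have "isCont (\<lambda>z. z \<bullet> n - g z) y" by (intro continuous_intros gc)
    then have "((\<lambda>z. z \<bullet> n - g z) \<longlongrightarrow> y \<bullet> n - g y) (nhds y)" by (simp add: isCont_def tendsto_nhds_iff)
    from order_tendstoD(2)[OF this, of 0] \<open>\<not> g y \<le> y \<bullet> n\<close>
    obtain d where d: "0 < d" "\<And>z. dist z y < d \<Longrightarrow> z \<bullet> n - g z < 0" unfolding eventually_nhds_metric by auto
    have "y \<in> closure \<Omega>" using y by (simp add: frontier_def)
    then obtain z where z: "z \<in> \<Omega>" "dist z y < min d r" using d(1) r(1) unfolding closure_approachable by (meson min_less_iff_conj)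
    then have "z \<in> \<Omega> \<inter> ball y r" by (simp add: dist_commute)
    then have "z \<bullet> n > g z" unfolding r(2) by simp
    then show False using d(2)[of z] z(2) by simp
  qed
qed

text \<open>The contact point lies on the sphere, since points just below the graph are outside \<open>\<Omega>\<close>. If the unit vector
\<open>w\<close> towards the centre differed from \<open>n\<close>, a small step in the direction \<open>w - n\<close> would stay in the ball, but lower the height
to first order.\<close>

lemma touching_ball_center:
  fixes g :: "real^'n \<Rightarrow> real"
  assumes gr: "C2_graph_near \<Omega> y n g" and op: "open \<Omega>" and y: "y \<in> frontier \<Omega>" and G0: "gradient g y = 0"
    and R: "0 < R" and touch: "cball x R \<inter> (UNIV - \<Omega>) = {y}"
  shows "x = y + R *\<^sub>R n"
proof -
  have nn: "norm n = 1" and inv: "\<And>z s. g (z + s *\<^sub>R n) = g z" using gr unfolding C2_graph_near_def by auto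
  have n1: "n \<bullet> n = 1" using nn by (simp add: norm_eq_1)
  have gy: "y \<bullet> n = g y" by (rule graph_boundary_height[OF gr op y])
  obtain r \<kappa> where ch: "chart \<Omega> y r \<kappa> (norm (n - gradient g y) - 1) (norm (n - gradient g y) + 1) (\<lambda>z. z \<bullet> n - g z) (\<lambda>z. n - gradient g z)"
    using graph_chart[OF gr, of 1] nn G0 by auto
  have r: "0 < r" "0 \<le> \<kappa>" and \<Omega>: "\<Omega> \<inter> ball y r = {z \<in> ball y r. 0 < z \<bullet> n - g z}"
    using ch unfolding chart_def by blast+
  have all: "\<forall>z\<in>ball y r. \<forall>z'\<in>ball y r. \<bar>(z' \<bullet> n - g z') - (z \<bullet> n - g z) - (n - gradient g z) \<bullet> (z' - z)\<bar> \<le> \<kappa> * (norm (z' - z))\<^sup>2"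
    using ch unfolding chart_def by (elim conjE) assumption
  have C11: "\<bar>(z \<bullet> n - g z) - n \<bullet> (z - y)\<bar> \<le> \<kappa> * (norm (z - y))\<^sup>2" if "z \<in> ball y r" for z
  proof -
    have "\<bar>(z \<bullet> n - g z) - (y \<bullet> n - g y) - (n - gradient g y) \<bullet> (z - y)\<bar> \<le> \<kappa> * (norm (z - y))\<^sup>2"
      using bspec[OF bspec[OF all, of y] that] r(1) by simp
    then show ?thesis using gy G0 by simp
  qed
  have "y \<in> cball x R \<inter> (UNIV - \<Omega>)" unfolding touch by simp
  then have yc: "dist x y \<le> R" "y \<notin> \<Omega>" by simp_all
  have only: "z \<in> \<Omega>" if "dist x z \<le> R" "z \<noteq> y" for z
  proof (rule ccontr)
    assume "z \<notin> \<Omega>"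
    then have "z \<in> cball x R \<inter> (UNIV - \<Omega>)" using that by simp
    then show False unfolding touch using that by simp
  qed
  have dR: "dist x y = R"
  proof (rule ccontr)
    assume "dist x y \<noteq> R"
    then have lt: "dist x y < R" using yc by simp
    define s where "s = min (R - dist x y) (r / 2)"
    have s: "0 < s" "s < r" "s \<le> R - dist x y" using lt r by (auto simp: s_def)
    define z where "z = y + (-s) *\<^sub>R n"
    have zy: "dist y z = s" using s nn by (simp add: z_def dist_norm)
    have "dist x z \<le> R" using dist_triangle[of x z y] zy s by linarith
    moreover have "z \<noteq> y" using zy s by auto
    ultimately have "z \<in> \<Omega> \<inter> ball y r" using only zy s by auto
    then have "0 < z \<bullet> n - g z" unfolding \<Omega> by simp
    moreover have "z \<bullet> n - g z = - s" unfolding z_def inv using gy n1 by (simp add: inner_diff_left)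
    ultimately show False using s by simp
  qed
  define w where "w = (1 / R) *\<^sub>R (x - y)"
  have nw: "norm w = 1" using dR R by (simp add: w_def dist_norm)
  have w1: "w \<bullet> w = 1" using nw by (simp add: norm_eq_1)
  have "1 \<le> w \<bullet> n"
  proof (rule ccontr)
    assume "\<not> 1 \<le> w \<bullet> n"
    define k where "k = w - n"
    define c where "c = 1 - w \<bullet> n"
    have c: "0 < c" using \<open>\<not> 1 \<le> w \<bullet> n\<close> by (simp add: c_def)
    have kn: "n \<bullet> k = - c" and kw: "k \<bullet> w = c" by (simp_all add: k_def c_def inner_diff_left inner_diff_right n1 w1 inner_commute)
    have kk: "(norm k)\<^sup>2 = 2 * c" unfolding power2_norm_eq_inner by (simp add: k_def c_def inner_diff_left inner_diff_right n1 w1 inner_commute)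
    have k0: "k \<noteq> 0" using kw c by auto
    \<comment> \<open>the step stays in the ball, in the chart, and is too short for the \<open>\<kappa>\<close>-term to matter\<close>
    define \<epsilon> where "\<epsilon> = Min {R, r / (2 * norm k), 1 / (2 * (\<kappa> + 1))} / 2"
    have \<epsilon>: "0 < \<epsilon>" "\<epsilon> \<le> R" "\<epsilon> < r / norm k" "2 * \<kappa> * \<epsilon> < 1"
    proof -
      have m: "0 < Min {R, r / (2 * norm k), 1 / (2 * (\<kappa> + 1))}" using R r k0 by simp
      then show e: "0 < \<epsilon>" by (simp add: \<epsilon>_def)
      have le: "2 * \<epsilon> \<le> R" "2 * \<epsilon> \<le> r / (2 * norm k)" "2 * \<epsilon> \<le> 1 / (2 * (\<kappa> + 1))" by (simp_all add: \<epsilon>_def)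
      show "\<epsilon> \<le> R" using le(1) e by linarith
      have "r / (2 * norm k) = r / norm k / 2" by simp
      moreover have "0 < r / norm k" using r k0 by simp
      ultimately show "\<epsilon> < r / norm k" using le(2) e by linarith
      have "2 * \<epsilon> * (2 * (\<kappa> + 1)) \<le> 1" using le(3) r by (simp add: le_divide_eq)
      moreover have "2 * \<epsilon> * (2 * (\<kappa> + 1)) = 2 * \<kappa> * \<epsilon> + (2 * \<kappa> * \<epsilon> + 4 * \<epsilon>)" by (simp add: algebra_simps)
      moreover have "0 < 2 * \<kappa> * \<epsilon> + 4 * \<epsilon>" using e r by (simp add: add_nonneg_pos)
      ultimately show "2 * \<kappa> * \<epsilon> < 1" by linarith
    qed
    define z where "z = y + \<epsilon> *\<^sub>R k"
    have zy: "norm (z - y) = \<epsilon> * norm k" using \<epsilon> by (simp add: z_def)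
    have zr: "z \<in> ball y r" using zy \<epsilon>(3) k0 by (simp add: dist_norm norm_minus_commute less_divide_eq)
    have xz: "x - z = R *\<^sub>R w - \<epsilon> *\<^sub>R k" using R by (simp add: w_def z_def)
    have "k \<bullet> k = 2 * c" using kk by (simp add: power2_norm_eq_inner)
    then have "(norm (x - z))\<^sup>2 = R\<^sup>2 - 2 * R * \<epsilon> * c + \<epsilon>\<^sup>2 * (2 * c)"
      unfolding xz power2_norm_eq_inner
      by (simp add: inner_diff_left inner_diff_right w1 kw inner_commute[of w k] algebra_simps power2_eq_square)
    also have "\<dots> = R\<^sup>2 - 2 * \<epsilon> * c * (R - \<epsilon>)" by (simp add: algebra_simps power2_eq_square)
    also have "\<dots> \<le> R\<^sup>2"
    proof -
      have "0 \<le> 2 * \<epsilon> * c * (R - \<epsilon>)" using \<epsilon>(1,2) c by (intro mult_nonneg_nonneg) auto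
      then show ?thesis by linarith
    qed
    finally have "dist x z \<le> R" unfolding dist_norm by (rule power2_le_imp_le) (use R in simp)
    moreover have "z \<noteq> y" using \<epsilon> k0 by (simp add: z_def)
    ultimately have "z \<in> \<Omega> \<inter> ball y r" using only zr by auto
    then have u1: "0 < z \<bullet> n - g z" unfolding \<Omega> by simp
    have u2: "z \<bullet> n - g z \<le> n \<bullet> (z - y) + \<kappa> * (norm (z - y))\<^sup>2" using abs_le_D1[OF C11[OF zr]] by linarith
    have u3: "n \<bullet> (z - y) + \<kappa> * (norm (z - y))\<^sup>2 = \<epsilon> * c * (2 * \<kappa> * \<epsilon> - 1)"
    proof -
      have "n \<bullet> (z - y) = - (\<epsilon> * c)" using kn by (simp add: z_def)
      moreover have "(norm (z - y))\<^sup>2 = \<epsilon>\<^sup>2 * (2 * c)" unfolding zy power_mult_distrib kk ..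
      ultimately show ?thesis by (simp add: algebra_simps power2_eq_square)
    qed
    have "\<epsilon> * c * (2 * \<kappa> * \<epsilon> - 1) < 0" by (rule mult_pos_neg) (use \<epsilon>(1,4) c in auto)
    then show False using u1 u2 u3 by linarith
  qed
  then have "(norm (w - n))\<^sup>2 \<le> 0" unfolding power2_norm_eq_inner by (simp add: inner_diff_left inner_diff_right n1 w1 inner_commute)
  then have "w = n" by simp
  then show ?thesis using R by (auto simp: w_def)
qed

section \<open>The integral of a heat profile\<close>

text \<open>Tonelli, after writing \<open>1 - Erf\<close> as a Gaussian tail. The maximum with 0 matches the bound \<open>u \<le> 1\<close>.\<close>

lemma Erf_layer_cake:
  fixes \<phi> :: "'a::euclidean_space \<Rightarrow> real"
  assumes S[measurable]: "S \<in> sets borel" and Sb: "bounded S" and [measurable]: "\<phi> \<in> borel_measurable borel"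
  shows "(LINT z:S|lborel. 1 - Erf (max 0 (\<phi> z))) = (LINT \<tau>:{0<..}|lborel. gauss \<tau> * measure lborel {z \<in> S. \<phi> z \<le> \<tau>})"
    "set_integrable lborel S (\<lambda>z. 1 - Erf (max 0 (\<phi> z)))"
proof -
  have [measurable]: "Erf \<in> borel_measurable borel"
    by (intro borel_measurable_continuous_onI continuous_at_imp_continuous_on ballI DERIV_isCont[OF Erf_deriv])
  have [measurable]: "gauss \<in> borel_measurable borel" by (intro borel_measurable_continuous_onI continuous_gauss)
  have Sfin: "emeasure lborel S < \<infinity>" by (rule emeasure_bounded_finite[OF Sb])
  have fin: "emeasure lborel {z \<in> S. \<phi> z \<le> \<tau>} = ennreal (measure lborel {z \<in> S. \<phi> z \<le> \<tau>})" for \<tau>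
  proof -
    have "emeasure lborel {z \<in> S. \<phi> z \<le> \<tau>} \<le> emeasure lborel S" by (intro emeasure_mono) auto
    then show ?thesis using Sfin by (intro emeasure_eq_ennreal_measure) (auto simp: top_unique)
  qed
  have sub[measurable]: "{z \<in> S. \<phi> z \<le> \<tau>} \<in> sets lborel" for \<tau>
  proof -
    have "{z \<in> S. \<phi> z \<le> \<tau>} = S \<inter> {z \<in> space borel. \<phi> z \<le> \<tau>}" by auto
    also have "\<dots> \<in> sets borel" by measurable
    finally show ?thesis by simp
  qed
  have nn: "(\<integral>\<^sup>+ z. ennreal (indicator S z * (1 - Erf (max 0 (\<phi> z)))) \<partial>lborel)
     = (\<integral>\<^sup>+ \<tau>. ennreal (indicator {0<..} \<tau> * (gauss \<tau> * measure lborel {z \<in> S. \<phi> z \<le> \<tau>})) \<partial>lborel)"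
  proof -
    have "(\<integral>\<^sup>+ z. ennreal (indicator S z * (1 - Erf (max 0 (\<phi> z)))) \<partial>lborel)
      = (\<integral>\<^sup>+ z. (\<integral>\<^sup>+ \<tau>. ennreal (gauss \<tau>) * indicator {0..} \<tau> * (indicator S z * indicator {x. 0 \<le> x} (\<tau> - \<phi> z)) \<partial>lborel) \<partial>lborel)"
    proof (rule nn_integral_cong)
      fix z
      have "(\<integral>\<^sup>+ \<tau>. ennreal (gauss \<tau>) * indicator {0..} \<tau> * (indicator S z * indicator {x. 0 \<le> x} (\<tau> - \<phi> z)) \<partial>lborel)
        = (\<integral>\<^sup>+ \<tau>. indicator S z * (ennreal (gauss \<tau>) * indicator {max 0 (\<phi> z)..} \<tau>) \<partial>lborel)"
        by (intro nn_integral_cong) (auto simp: indicator_def)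
      also have "\<dots> = indicator S z * ennreal (1 - Erf (max 0 (\<phi> z)))"
        by (subst nn_integral_cmult) (auto simp: nn_integral_gauss_tail)
      also have "\<dots> = ennreal (indicator S z * (1 - Erf (max 0 (\<phi> z))))" by (auto simp: indicator_def)
      finally show "ennreal (indicator S z * (1 - Erf (max 0 (\<phi> z)))) = (\<integral>\<^sup>+ \<tau>. ennreal (gauss \<tau>) * indicator {0..} \<tau> * (indicator S z * indicator {x. 0 \<le> x} (\<tau> - \<phi> z)) \<partial>lborel)" by simp
    qed
    also have "\<dots> = (\<integral>\<^sup>+ \<tau>. (\<integral>\<^sup>+ z. ennreal (gauss \<tau>) * indicator {0..} \<tau> * (indicator S z * indicator {x. 0 \<le> x} (\<tau> - \<phi> z)) \<partial>lborel) \<partial>lborel)"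
      by (rule lborel_pair.Fubini') measurable
    also have "\<dots> = (\<integral>\<^sup>+ \<tau>. ennreal (indicator {0<..} \<tau> * (gauss \<tau> * measure lborel {z \<in> S. \<phi> z \<le> \<tau>})) \<partial>lborel)"
    proof (rule nn_integral_cong_AE)
      have "AE \<tau> in lborel. \<tau> \<noteq> (0::real)" by (rule AE_lborel_singleton)
      then show "AE \<tau> in lborel. (\<integral>\<^sup>+ z. ennreal (gauss \<tau>) * indicator {0..} \<tau> * (indicator S z * indicator {x. 0 \<le> x} (\<tau> - \<phi> z)) \<partial>lborel)
         = ennreal (indicator {0<..} \<tau> * (gauss \<tau> * measure lborel {z \<in> S. \<phi> z \<le> \<tau>}))"
      proof eventually_elim
        case (elim \<tau>)
        have "(\<integral>\<^sup>+ z. ennreal (gauss \<tau>) * indicator {0..} \<tau> * (indicator S z * indicator {x. 0 \<le> x} (\<tau> - \<phi> z)) \<partial>lborel)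
          = (\<integral>\<^sup>+ z. (ennreal (gauss \<tau>) * indicator {0..} \<tau>) * indicator {z \<in> S. \<phi> z \<le> \<tau>} z \<partial>lborel)"
          by (intro nn_integral_cong) (auto simp: indicator_def)
        also have "\<dots> = (ennreal (gauss \<tau>) * indicator {0..} \<tau>) * emeasure lborel {z \<in> S. \<phi> z \<le> \<tau>}"
          by (rule nn_integral_cmult_indicator[OF sub])
        also have "\<dots> = ennreal (indicator {0<..} \<tau> * (gauss \<tau> * measure lborel {z \<in> S. \<phi> z \<le> \<tau>}))"
          unfolding fin using elim gauss_pos[of \<tau>] by (auto simp: indicator_def ennreal_mult)
        finally show ?case .
      qed
    qed
    finally show ?thesis .
  qed
  have pos: "0 \<le> 1 - Erf x" for x using Erf_less_1[of x] by simp
  have m2: "(\<lambda>\<tau>. indicator {0<..} \<tau> * (gauss \<tau> * measure lborel {z \<in> S. \<phi> z \<le> \<tau>})) \<in> borel_measurable lborel"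
  proof -
    have "mono (\<lambda>\<tau>. measure lborel {z \<in> S. \<phi> z \<le> \<tau>})"
    proof (rule monoI)
      fix a b :: real assume "a \<le> b"
      then have "emeasure lborel {z \<in> S. \<phi> z \<le> a} \<le> emeasure lborel {z \<in> S. \<phi> z \<le> b}" by (intro emeasure_mono) auto
      then show "measure lborel {z \<in> S. \<phi> z \<le> a} \<le> measure lborel {z \<in> S. \<phi> z \<le> b}" by (simp add: fin)
    qed
    then have [measurable]: "(\<lambda>\<tau>. measure lborel {z \<in> S. \<phi> z \<le> \<tau>}) \<in> borel_measurable borel" by (rule borel_measurable_mono)
    show ?thesis by measurable
  qed
  show "(LINT z:S|lborel. 1 - Erf (max 0 (\<phi> z))) = (LINT \<tau>:{0<..}|lborel. gauss \<tau> * measure lborel {z \<in> S. \<phi> z \<le> \<tau>})"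
    unfolding set_lebesgue_integral_def real_scaleR_def
    by (subst (1 2) integral_eq_nn_integral) (use pos m2 gauss_pos in \<open>auto simp: nn less_imp_le\<close>)
  show "set_integrable lborel S (\<lambda>z. 1 - Erf (max 0 (\<phi> z)))" unfolding set_integrable_def
  proof (rule Bochner_Integration.integrable_bound[where f = "indicator S :: 'a \<Rightarrow> real"])
    show "integrable lborel (indicator S :: 'a \<Rightarrow> real)" using Sfin by (intro integrable_real_indicator) auto
    show "AE z in lborel. norm (indicator S z *\<^sub>R (1 - Erf (max 0 (\<phi> z)))) \<le> norm (indicator S z :: real)"
      using pos Erf_nonneg by (intro AE_I2) (auto simp: indicator_def)
  qed measurable
qed

text \<open>The integrand of the layer cake formula is the volume at the level \<open>\<tau> \<surd>t / a - C t\<close>. Divided by \<open>t\<close> to the power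
\<open>\<beta>/2\<close> it converges to \<open>L (\<tau> / a)\<close> to the power \<open>\<beta>\<close>, whatever the sign of \<open>C\<close>, and the power bound on the
volume gives an integrable majorant.\<close>

lemma scaled_profile_integral:
  fixes \<psi> :: "'a::euclidean_space \<Rightarrow> real"
  assumes S[measurable]: "S \<in> sets borel" and Sb: "bounded S" and \<psi>m[measurable]: "\<psi> \<in> borel_measurable borel"
    and \<psi>pos: "\<And>z. z \<in> S \<Longrightarrow> 0 < \<psi> z" and \<beta>: "0 < \<beta>"
    and V: "((\<lambda>s. measure lborel {z \<in> S. \<psi> z \<le> s} / s powr \<beta>) \<longlongrightarrow> L) (at_right 0)"
    and VK: "\<And>s. 0 < s \<Longrightarrow> measure lborel {z \<in> S. \<psi> z \<le> s} \<le> K * s powr \<beta>"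
    and a: "0 < a"
  shows "((\<lambda>t. t powr (- (\<beta> / 2)) * (LINT z:S|lborel. 1 - Erf (max 0 (a * ((\<psi> z + C * t) / sqrt t)))))
     \<longlongrightarrow> L * a powr (- \<beta>) * (Gamma ((\<beta> + 1) / 2) / sqrt pi)) (at_right 0)"
proof -
  have [measurable]: "gauss \<in> borel_measurable borel" by (intro borel_measurable_continuous_onI continuous_gauss)
  define W where "W s = measure lborel {z \<in> S. \<psi> z \<le> s}" for s
  have Wneg: "W s = 0" if "s \<le> 0" for s
  proof -
    have "{z \<in> S. \<psi> z \<le> s} = {}" using \<psi>pos that by force
    then show ?thesis unfolding W_def by (simp only: measure_empty)
  qed
  have W0: "0 \<le> W s" for s by (simp add: W_def)
  have "W 1 \<le> K * 1 powr \<beta>" unfolding W_def by (rule VK) simp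
  then have K: "0 \<le> K" using W0[of 1] by simp
  have Wm: "W \<in> borel_measurable borel"
  proof (rule borel_measurable_mono, rule monoI)
    fix b c :: real assume "b \<le> c"
    have [measurable]: "{z \<in> S. \<psi> z \<le> \<tau>} \<in> sets lborel" for \<tau>
    proof -
      have "{z \<in> S. \<psi> z \<le> \<tau>} = S \<inter> {z \<in> space borel. \<psi> z \<le> \<tau>}" by auto
      also have "\<dots> \<in> sets borel" by measurable
      finally show ?thesis by simp
    qed
    have "emeasure lborel {z \<in> S. \<psi> z \<le> c} \<le> emeasure lborel S" by (intro emeasure_mono) auto
    also have "\<dots> < \<infinity>" by (rule emeasure_bounded_finite[OF Sb])
    finally show "W b \<le> W c" unfolding W_def measure_def using \<open>b \<le> c\<close>
      by (intro enn2real_mono emeasure_mono) auto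
  qed
  note Wm[measurable]
  let ?J = "\<lambda>t. LINT z:S|lborel. 1 - Erf (max 0 (a * ((\<psi> z + C * t) / sqrt t)))"
  have J: "t powr (- (\<beta> / 2)) * ?J t = (LINT \<tau>|lborel. indicator {0<..} \<tau> * (gauss \<tau> * (W (\<tau> * sqrt t / a - C * t) / t powr (\<beta>/2))))"
    if t: "0 < t" for t
  proof -
    have set: "{z \<in> S. a * ((\<psi> z + C * t) / sqrt t) \<le> \<tau>} = {z \<in> S. \<psi> z \<le> \<tau> * sqrt t / a - C * t}" for \<tau>
    proof -
      have "a * ((p + C * t) / sqrt t) \<le> \<tau> \<longleftrightarrow> p \<le> \<tau> * sqrt t / a - C * t" for p
      proof -
        have "a * ((p + C * t) / sqrt t) \<le> \<tau> \<longleftrightarrow> a * (p + C * t) \<le> \<tau> * sqrt t" using t by (simp add: divide_le_eq)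
        also have "\<dots> \<longleftrightarrow> p + C * t \<le> \<tau> * sqrt t / a" using a by (simp add: le_divide_eq mult.commute)
        finally show ?thesis by linarith
      qed
      then show ?thesis by simp
    qed
    have "?J t = (LINT \<tau>:{0<..}|lborel. gauss \<tau> * W (\<tau> * sqrt t / a - C * t))"
      unfolding W_def set[symmetric] by (rule Erf_layer_cake(1)[OF S Sb]) measurable
    then have "t powr (- (\<beta> / 2)) * ?J t = (LINT \<tau>|lborel. t powr (- (\<beta> / 2)) * (indicator {0<..} \<tau> * (gauss \<tau> * W (\<tau> * sqrt t / a - C * t))))"
      by (simp add: set_lebesgue_integral_def)
    also have "\<dots> = (LINT \<tau>|lborel. indicator {0<..} \<tau> * (gauss \<tau> * (W (\<tau> * sqrt t / a - C * t) / t powr (\<beta>/2))))"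
    proof (intro Bochner_Integration.integral_cong refl)
      fix \<tau> :: real
      have "t powr (- (\<beta> / 2)) = 1 / t powr (\<beta> / 2)" by (rule powr_minus_divide)
      then show "t powr (- (\<beta> / 2)) * (indicator {0<..} \<tau> * (gauss \<tau> * W (\<tau> * sqrt t / a - C * t))) = indicator {0<..} \<tau> * (gauss \<tau> * (W (\<tau> * sqrt t / a - C * t) / t powr (\<beta>/2)))" by simp
    qed
    finally show ?thesis .
  qed
  define dom where "dom \<tau> = indicator {0<..} \<tau> * (gauss \<tau> * (K * (2 powr \<beta> * ((1 / a) powr \<beta> * \<tau> powr \<beta> + \<bar>C\<bar> powr \<beta>))))" for \<tau>
  have gi: "integrable lborel (\<lambda>\<tau>. indicator {0<..} \<tau> * (gauss \<tau> * \<tau> powr b))" 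
    and gv: "(LINT \<tau>|lborel. indicator {0<..} \<tau> * (gauss \<tau> * \<tau> powr b)) = Gamma ((b + 1) / 2) / sqrt pi" if "0 \<le> b" for b
  proof -
    have eq: "indicator {0<..} \<tau> * (gauss \<tau> * \<tau> powr b) = (2 / sqrt pi) * (indicator {0<..} \<tau> *\<^sub>R (\<tau> powr b * exp (- \<tau>\<^sup>2)))" for \<tau>
      by (simp add: gauss_def)
    note m = gaussian_moment_half_line[OF that]
    show "integrable lborel (\<lambda>\<tau>. indicator {0<..} \<tau> * (gauss \<tau> * \<tau> powr b))"
      unfolding eq using m(1) by (intro integrable_mult_right) (simp add: set_integrable_def)
    show "(LINT \<tau>|lborel. indicator {0<..} \<tau> * (gauss \<tau> * \<tau> powr b)) = Gamma ((b + 1) / 2) / sqrt pi"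
      unfolding eq using m(2) by (simp add: set_lebesgue_integral_def)
  qed
  have domi: "integrable lborel dom"
  proof -
    have eq: "dom = (\<lambda>\<tau>. K * 2 powr \<beta> * (1 / a) powr \<beta> * (indicator {0<..} \<tau> * (gauss \<tau> * \<tau> powr \<beta>))
       + K * 2 powr \<beta> * \<bar>C\<bar> powr \<beta> * (indicator {0<..} \<tau> * (gauss \<tau> * \<tau> powr 0)))"
      by (rule ext) (auto simp: dom_def indicator_def algebra_simps)
    show ?thesis unfolding eq by (intro Bochner_Integration.integrable_add integrable_mult_right gi) (use \<beta> in auto)
  qed
  have "((\<lambda>t. LINT \<tau>|lborel. indicator {0<..} \<tau> * (gauss \<tau> * (W (\<tau> * sqrt t / a - C * t) / t powr (\<beta>/2))))
      \<longlongrightarrow> (LINT \<tau>|lborel. indicator {0<..} \<tau> * (gauss \<tau> * (L * (\<tau> / a) powr \<beta>)))) (at_right 0)"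
    unfolding tendsto_at_iff_sequentially comp_def
  proof (intro allI impI)
    fix X :: "nat \<Rightarrow> real" assume X: "\<forall>i. X i \<in> {0<..} - {0}" "X \<longlonglongrightarrow> 0"
    have Xp: "0 < X i" for i using X(1) by auto
    have Xf: "filterlim X (at_right 0) sequentially" unfolding filterlim_at using X(2) by (simp add: Xp less_imp_neq[OF Xp, symmetric])
    have "\<forall>\<^sub>F i in sequentially. X i < 1" using order_tendstoD(2)[OF X(2), of 1] by simp
    then obtain i0 where "\<forall>i\<ge>i0. X i < 1" unfolding eventually_sequentially by blast
    then have i0: "X i \<le> 1" if "i0 \<le> i" for i using that by (simp add: less_imp_le)
    have "(\<lambda>i. LINT \<tau>|lborel. indicator {0<..} \<tau> * (gauss \<tau> * (W (\<tau> * sqrt (X (i + i0)) / a - C * X (i + i0)) / X (i + i0) powr (\<beta>/2))))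
       \<longlonglongrightarrow> (LINT \<tau>|lborel. indicator {0<..} \<tau> * (gauss \<tau> * (L * (\<tau> / a) powr \<beta>)))"
    proof (rule integral_dominated_convergence[where w = dom])
      show "integrable lborel dom" by (rule domi)
      show "AE \<tau> in lborel. norm (indicator {0<..} \<tau> * (gauss \<tau> * (W (\<tau> * sqrt (X (i + i0)) / a - C * X (i + i0)) / X (i + i0) powr (\<beta>/2)))) \<le> dom \<tau>" for i
      proof (intro AE_I2)
        fix \<tau> :: real
        define t where "t = X (i + i0)"
        have t: "0 < t" "t \<le> 1" using Xp i0 by (auto simp: t_def)
        show "norm (indicator {0<..} \<tau> * (gauss \<tau> * (W (\<tau> * sqrt (X (i + i0)) / a - C * X (i + i0)) / X (i + i0) powr (\<beta>/2)))) \<le> dom \<tau>"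
          unfolding t_def[symmetric]
        proof (cases "0 < \<tau>")
          case True
          define s where "s = \<tau> * sqrt t / a - C * t"
          have sq: "0 < sqrt t" "sqrt t * sqrt t = t" "sqrt t \<le> 1" using t by auto
          have "W s / t powr (\<beta>/2) \<le> K * (2 powr \<beta> * ((1 / a) powr \<beta> * \<tau> powr \<beta> + \<bar>C\<bar> powr \<beta>))"
          proof (cases "0 < s")
            case s: True
            define A where "A = \<tau> / a"
            have A: "0 < A" using True a by (simp add: A_def)
            have "s \<le> sqrt t * (A + \<bar>C\<bar>)"
            proof -
              have "- C * t \<le> \<bar>C\<bar> * (sqrt t * sqrt t)" using t sq by (metis abs_ge_minus_self less_imp_le mult_right_mono)
              also have "\<dots> \<le> \<bar>C\<bar> * (sqrt t * 1)" using sq by (intro mult_left_mono) auto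
              finally show ?thesis by (simp add: s_def A_def algebra_simps)
            qed
            also have "\<dots> \<le> sqrt t * (2 * max A \<bar>C\<bar>)" using sq by (intro mult_left_mono) auto
            finally have "s powr \<beta> \<le> (sqrt t * (2 * max A \<bar>C\<bar>)) powr \<beta>" using s \<beta> by (intro powr_mono2) auto
            also have "\<dots> = t powr (\<beta>/2) * (2 powr \<beta> * (max A \<bar>C\<bar>) powr \<beta>)"
              using A t by (simp add: powr_mult powr_half_sqrt[symmetric] powr_powr)
            also have "(max A \<bar>C\<bar>) powr \<beta> \<le> A powr \<beta> + \<bar>C\<bar> powr \<beta>" by (auto simp: max_def)
            finally have "s powr \<beta> \<le> t powr (\<beta>/2) * (2 powr \<beta> * (A powr \<beta> + \<bar>C\<bar> powr \<beta>))" by (simp add: mult_left_mono)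
            then have "K * s powr \<beta> \<le> K * (t powr (\<beta>/2) * (2 powr \<beta> * (A powr \<beta> + \<bar>C\<bar> powr \<beta>)))" using K by (rule mult_left_mono)
            with VK[OF s] have "W s \<le> t powr (\<beta>/2) * (K * (2 powr \<beta> * (A powr \<beta> + \<bar>C\<bar> powr \<beta>)))" by (simp add: W_def mult_ac)
            moreover have "A powr \<beta> = (1 / a) powr \<beta> * \<tau> powr \<beta>" using True a by (simp add: A_def powr_mult[symmetric])
            ultimately show ?thesis using t by (simp add: divide_le_eq mult_ac)
          next
            case False
            then show ?thesis using Wneg[of s] K by simp
          qed
          then have "gauss \<tau> * (W s / t powr (\<beta>/2)) \<le> gauss \<tau> * (K * (2 powr \<beta> * ((1 / a) powr \<beta> * \<tau> powr \<beta> + \<bar>C\<bar> powr \<beta>)))"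
            using gauss_pos[of \<tau>] by (intro mult_left_mono) auto
          moreover have "0 \<le> gauss \<tau> * (W s / t powr (\<beta>/2))" using gauss_pos[of \<tau>] W0 by simp
          ultimately show "norm (indicator {0<..} \<tau> * (gauss \<tau> * (W (\<tau> * sqrt t / a - C * t) / t powr (\<beta>/2)))) \<le> dom \<tau>"
            using True by (simp add: dom_def s_def)
        qed (simp add: dom_def)
      qed
      show "AE \<tau> in lborel. (\<lambda>i. indicator {0<..} \<tau> * (gauss \<tau> * (W (\<tau> * sqrt (X (i + i0)) / a - C * X (i + i0)) / X (i + i0) powr (\<beta>/2))))
         \<longlonglongrightarrow> indicator {0<..} \<tau> * (gauss \<tau> * (L * (\<tau> / a) powr \<beta>))"
      proof (intro AE_I2)
        fix \<tau> :: real
        show "(\<lambda>i. indicator {0<..} \<tau> * (gauss \<tau> * (W (\<tau> * sqrt (X (i + i0)) / a - C * X (i + i0)) / X (i + i0) powr (\<beta>/2))))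
         \<longlonglongrightarrow> indicator {0<..} \<tau> * (gauss \<tau> * (L * (\<tau> / a) powr \<beta>))"
        proof (cases "0 < \<tau>")
          case True
          define s where "s t = \<tau> * sqrt t / a - C * t" for t
          define q where "q t = \<tau> / a - C * sqrt t" for t
          have sq: "s t = sqrt t * q t" if "0 < t" for t
            using that by (simp add: s_def q_def right_diff_distrib mult.left_commute[of _ C])
          have qlim: "(q \<longlongrightarrow> \<tau> / a - C * sqrt 0) (at_right 0)" unfolding q_def by (intro tendsto_intros)
          have qlim': "(q \<longlongrightarrow> \<tau> / a) (at_right 0)" using qlim by simp
          have qpos: "\<forall>\<^sub>F t in at_right 0. 0 < q t" by (rule order_tendstoD(1)[OF qlim']) (use True a in simp)
          have slim: "(s \<longlongrightarrow> \<tau> * sqrt 0 / a - C * 0) (at_right 0)" unfolding s_def using a by (intro tendsto_intros) auto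
          have tpos: "\<forall>\<^sub>F t in at_right 0. (0::real) < t" by (rule eventually_at_right_less)
          have spos: "\<forall>\<^sub>F t in at_right 0. 0 < s t" using qpos tpos by eventually_elim (simp add: sq)
          have "filterlim s (at_right 0) (at_right 0)"
            unfolding filterlim_at using slim spos by (auto elim!: eventually_mono)
          from filterlim_compose[OF V this]
          have "((\<lambda>t. W (s t) / s t powr \<beta>) \<longlongrightarrow> L) (at_right 0)" by (simp add: W_def)
          moreover have "((\<lambda>t. q t powr \<beta>) \<longlongrightarrow> (\<tau> / a) powr \<beta>) (at_right 0)"
            using True a by (intro tendsto_powr qlim' tendsto_const) auto
          ultimately have "((\<lambda>t. W (s t) / s t powr \<beta> * q t powr \<beta>) \<longlongrightarrow> L * (\<tau> / a) powr \<beta>) (at_right 0)" by (rule tendsto_mult)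
          moreover have "\<forall>\<^sub>F t in at_right 0. W (s t) / s t powr \<beta> * q t powr \<beta> = W (s t) / t powr (\<beta>/2)"
            using qpos tpos
          proof eventually_elim
            case (elim t)
            then have "s t powr \<beta> = t powr (\<beta>/2) * q t powr \<beta>"
              by (simp add: sq powr_mult powr_half_sqrt[symmetric] powr_powr)
            then show ?case using elim by simp
          qed
          ultimately have "((\<lambda>t. W (s t) / t powr (\<beta>/2)) \<longlongrightarrow> L * (\<tau> / a) powr \<beta>) (at_right 0)" by (rule Lim_transform_eventually)
          from filterlim_compose[OF this Xf]
          have "(\<lambda>i. W (s (X i)) / X i powr (\<beta>/2)) \<longlonglongrightarrow> L * (\<tau> / a) powr \<beta>" .
          from tendsto_mult_left[OF LIMSEQ_ignore_initial_segment[OF this, of i0], of "gauss \<tau>"] True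
          show ?thesis unfolding s_def by simp
        qed simp
      qed
      show "(\<lambda>\<tau>. indicator {0<..} \<tau> * (gauss \<tau> * (L * (\<tau> / a) powr \<beta>))) \<in> borel_measurable lborel" by measurable
      show "(\<lambda>\<tau>. indicator {0<..} \<tau> * (gauss \<tau> * (W (\<tau> * sqrt (X (i + i0)) / a - C * X (i + i0)) / X (i + i0) powr (\<beta>/2)))) \<in> borel_measurable lborel" for i
        by measurable
    qed
    then show "(\<lambda>i. LINT \<tau>|lborel. indicator {0<..} \<tau> * (gauss \<tau> * (W (\<tau> * sqrt (X i) / a - C * X i) / X i powr (\<beta>/2))))
       \<longlonglongrightarrow> (LINT \<tau>|lborel. indicator {0<..} \<tau> * (gauss \<tau> * (L * (\<tau> / a) powr \<beta>)))"
      by (rule LIMSEQ_offset)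
  qed
  moreover have "(LINT \<tau>|lborel. indicator {0<..} \<tau> * (gauss \<tau> * (L * (\<tau> / a) powr \<beta>))) = L * a powr (- \<beta>) * (Gamma ((\<beta> + 1) / 2) / sqrt pi)"
  proof -
    have eq: "indicator {0<..} \<tau> * (gauss \<tau> * (L * (\<tau> / a) powr \<beta>)) = (L * a powr (- \<beta>)) * (indicator {0<..} \<tau> * (gauss \<tau> * \<tau> powr \<beta>))" for \<tau>
    proof (cases "0 < \<tau>")
      case True
      then have "(\<tau> / a) powr \<beta> = a powr (- \<beta>) * \<tau> powr \<beta>" using a by (simp add: powr_divide powr_minus_divide)
      then show ?thesis by simp
    qed simp
    show ?thesis unfolding eq integral_mult_right_zero using gv[of \<beta>] \<beta> by simp
  qed
  moreover have "\<forall>\<^sub>F t in at_right 0. (LINT \<tau>|lborel. indicator {0<..} \<tau> * (gauss \<tau> * (W (\<tau> * sqrt t / a - C * t) / t powr (\<beta>/2)))) = t powr (- (\<beta> / 2)) * ?J t"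
    using eventually_at_right_less[of "0::real"] by eventually_elim (simp only: J)
  ultimately show ?thesis by (simp only:) (rule Lim_transform_eventually)
qed

lemma exp_inverse_negligible:
  fixes c D m :: real
  assumes c: "0 < c"
  shows "((\<lambda>t. t powr (- m) * (D * exp (- c / t))) \<longlongrightarrow> 0) (at_right 0)"
proof -
  define k where "k = nat \<lceil>m\<rceil>"
  have k: "m \<le> real k" by (simp add: k_def real_nat_ceiling_ge)
  have "filterlim (\<lambda>t::real. c * inverse t) at_top (at_right 0)"
    by (rule filterlim_tendsto_pos_mult_at_top[OF tendsto_const c filterlim_inverse_at_top_right])
  from filterlim_compose[OF tendsto_power_div_exp_0[of k] this]
  have "((\<lambda>t. \<bar>D\<bar> / c ^ k * ((c * inverse t) ^ k / exp (c * inverse t))) \<longlongrightarrow> \<bar>D\<bar> / c ^ k * 0) (at_right 0)"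
    by (intro tendsto_intros)
  then have lim: "((\<lambda>t. \<bar>D\<bar> / c ^ k * ((c * inverse t) ^ k / exp (c * inverse t))) \<longlongrightarrow> 0) (at_right 0)" by simp
  show ?thesis
  proof (rule Lim_null_comparison[OF _ lim])
    have "\<forall>\<^sub>F t in at_right 0. t \<in> {0<..<1::real}" by (rule eventually_at_right_real) simp
    then show "\<forall>\<^sub>F t in at_right 0. norm (t powr (- m) * (D * exp (- c / t))) \<le> \<bar>D\<bar> / c ^ k * ((c * inverse t) ^ k / exp (c * inverse t))"
    proof eventually_elim
      case (elim t)
      then have t: "0 < t" "t < 1" by auto
      have "t powr (- m) \<le> t powr (- real k)" using t k by (intro powr_mono') auto
      also have "\<dots> = inverse t ^ k" using t by (simp add: powr_minus powr_realpow power_inverse)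
      finally have "t powr (- m) * (\<bar>D\<bar> * exp (- c / t)) \<le> inverse t ^ k * (\<bar>D\<bar> * exp (- c / t))" by (intro mult_right_mono) auto
      moreover have "\<bar>D\<bar> / c ^ k * ((c * inverse t) ^ k / exp (c * inverse t)) = inverse t ^ k * (\<bar>D\<bar> * exp (- c / t))"
        using c by (simp add: power_mult_distrib exp_minus divide_inverse)
      ultimately show ?case by (simp add: abs_mult)
    qed
  qed
qed

lemma Gamma_duplication_real:
  fixes z :: real assumes "0 < z"
  shows "Gamma z * Gamma (z + 1/2) = 2 powr (1 - 2 * z) * sqrt pi * Gamma (2 * z)"
proof -
  have "complex_of_real z \<notin> \<int>\<^sub>\<le>\<^sub>0" "complex_of_real z + 1/2 \<notin> \<int>\<^sub>\<le>\<^sub>0"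
    using assms by (auto elim!: nonpos_Ints_cases simp: complex_eq_iff)
  from Gamma_legendre_duplication[OF this]
  have "complex_of_real (Gamma z * Gamma (z + 1/2)) = complex_of_real (exp ((1 - 2*z) * ln 2) * sqrt pi * Gamma (2 * z))"
    by (simp add: Gamma_complex_of_real[symmetric] exp_of_real[symmetric])
  then show ?thesis unfolding of_real_eq_iff by (simp add: powr_def mult.commute)
qed

section \<open>The constant\<close>

text \<open>The Gamma factor of the ball of dimension \<open>N - 1\<close> cancels against the one of the Gaussian moment by the
duplication formula at \<open>(N + 1) / 4\<close>.\<close>

lemma limit_constant:
  fixes \<kappa> :: "nat \<Rightarrow> real"
  assumes N: "2 \<le> N" and p: "1 < p" and R: "0 < R" and \<kappa>: "\<And>j. j \<in> {1..N - 1} \<Longrightarrow> \<kappa> j < 1 / R"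
  shows "((\<Prod>j=1..N - 1. sqrt (2 / (1 / R - \<kappa> j))) * paraboloid_volume (N - 1)) * (1 / (2 * sqrt (normal_coeff p))) powr (- ((real N + 1) / 2))
      * (Gamma (((real N + 1) / 2 + 1) / 2) / sqrt pi)
    = c_const N / conj_exponent p powr ((real N + 1) / 4) * (R powr ((real N - 1) / 2) / sqrt (\<Prod>j=1..N - 1. 1 - R * \<kappa> j))"
proof -
  have q: "0 < normal_coeff p" using normal_coeff_bounds[OF p] by simp
  have conj: "conj_exponent p = 1 / normal_coeff p"
    using p by (cases p) (auto simp: conj_exponent_def normal_coeff_def recip_def one_ereal_def field_simps)
  have pos: "0 < 1 - R * \<kappa> j" if "j \<in> {1..N-1}" for j using \<kappa>[OF that] R by (simp add: field_simps)
  define P where "P = (\<Prod>j=1..N - 1. 1 - R * \<kappa> j)"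
  have P: "0 < P" unfolding P_def using pos by (intro prod_pos) auto
  have sqrt_prod: "(\<Prod>j\<in>A. sqrt (f j)) = sqrt (\<Prod>j\<in>A. f j)" for f :: "nat \<Rightarrow> real" and A
    by (induction A rule: infinite_finite_induct) (auto simp: real_sqrt_mult)
  have e1: "(\<Prod>j=1..N - 1. sqrt (2 / (1 / R - \<kappa> j))) = (2 * R) powr ((real N - 1) / 2) / sqrt P"
  proof -
    have "(\<Prod>j=1..N - 1. sqrt (2 / (1 / R - \<kappa> j))) = (\<Prod>j=1..N - 1. sqrt (2 * R) / sqrt (1 - R * \<kappa> j))"
    proof (rule prod.cong[OF refl])
      fix j assume "j \<in> {1..N-1}"
      have "2 / (1 / R - \<kappa> j) = (2 * R) / (1 - R * \<kappa> j)" using R pos[OF \<open>j \<in> {1..N-1}\<close>] by (simp add: field_simps)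
      then show "sqrt (2 / (1 / R - \<kappa> j)) = sqrt (2 * R) / sqrt (1 - R * \<kappa> j)" by (simp add: real_sqrt_divide)
    qed
    also have "\<dots> = sqrt (2 * R) ^ (N - 1) / sqrt P" by (simp add: prod_dividef sqrt_prod P_def)
    also have "sqrt (2 * R) ^ (N - 1) = (2 * R) powr ((real N - 1) / 2)"
    proof -
      have "sqrt (2 * R) ^ (N - 1) = sqrt (2 * R) powr real (N - 1)" using R by (intro powr_realpow[symmetric]) simp
      also have "\<dots> = (2 * R) powr ((real N - 1) / 2)" using R N by (simp add: powr_half_sqrt[symmetric] powr_powr of_nat_diff)
      finally show ?thesis .
    qed
    finally show ?thesis .
  qed
  define G where "G = Gamma ((real N + 1) / 2)"
  have G: "0 < G" "0 < Gamma ((real N + 1) / 4)" unfolding G_def by (auto intro!: Gamma_real_pos)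
  have e2: "paraboloid_volume (N - 1) = pi powr ((real N - 1) / 2) / G * (2 / (real N + 1))"
  proof -
    have r: "real (N - 1) = real N - 1" using N by (simp add: of_nat_diff)
    have "(real N - 1) / 2 + 1 = (real N + 1) / 2" "real N - 1 + 2 = real N + 1" by (simp_all add: field_simps)
    then show ?thesis unfolding paraboloid_volume_def unit_ball_vol_def r G_def by (simp only:)
  qed
  have e3: "Gamma (((real N + 1) / 2 + 1) / 2) / sqrt pi = 2 powr (1 - (real N + 1) / 2) * G / Gamma ((real N + 1) / 4)"
  proof -
    have "Gamma ((real N + 1) / 4) * Gamma ((real N + 1) / 4 + 1/2) = 2 powr (1 - 2 * ((real N + 1) / 4)) * sqrt pi * Gamma (2 * ((real N + 1) / 4))"
      by (rule Gamma_duplication_real) simp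
    moreover have "(real N + 1) / 4 + 1/2 = ((real N + 1) / 2 + 1) / 2" "2 * ((real N + 1) / 4) = (real N + 1) / 2" by (simp_all add: field_simps)
    ultimately have "Gamma ((real N + 1) / 4) * Gamma (((real N + 1) / 2 + 1) / 2) = 2 powr (1 - (real N + 1) / 2) * sqrt pi * G"
      unfolding G_def by (simp only:)
    then have "Gamma (((real N + 1) / 2 + 1) / 2) = 2 powr (1 - (real N + 1) / 2) * sqrt pi * G / Gamma ((real N + 1) / 4)"
      using G(2) by (metis less_irrefl nonzero_mult_div_cancel_left)
    then show ?thesis by simp
  qed
  have e4: "(1 / (2 * sqrt (normal_coeff p))) powr (- ((real N + 1) / 2)) = 2 powr ((real N + 1) / 2) / conj_exponent p powr ((real N + 1) / 4)"
  proof -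
    have "(1 / (2 * sqrt (normal_coeff p))) powr (- ((real N + 1) / 2)) = (2 * sqrt (normal_coeff p)) powr ((real N + 1) / 2)"
      by (simp add: powr_minus powr_divide)
    also have "\<dots> = 2 powr ((real N + 1) / 2) * normal_coeff p powr ((real N + 1) / 4)"
      using q by (simp add: powr_mult powr_half_sqrt[symmetric] powr_powr)
    also have "normal_coeff p powr ((real N + 1) / 4) = 1 / conj_exponent p powr ((real N + 1) / 4)"
      unfolding conj using q by (simp add: powr_divide)
    finally show ?thesis by simp
  qed
  have e5: "2 powr ((real N - 1) / 2) * 2 * 2 powr ((real N + 1) / 2) * 2 powr (1 - (real N + 1) / 2) = 2 powr ((real N + 3) / 2)"
  proof -
    have "2 powr ((real N - 1) / 2) * 2 powr 1 * 2 powr ((real N + 1) / 2) * 2 powr (1 - (real N + 1) / 2)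
       = 2 powr ((real N - 1) / 2 + 1 + (real N + 1) / 2 + (1 - (real N + 1) / 2))" by (simp only: powr_add)
    also have "(real N - 1) / 2 + 1 + (real N + 1) / 2 + (1 - (real N + 1) / 2) = (real N + 3) / 2" by (simp add: field_simps)
    finally show ?thesis by simp
  qed
  have e6: "(2 * R) powr ((real N - 1) / 2) = 2 powr ((real N - 1) / 2) * R powr ((real N - 1) / 2)" using R by (simp add: powr_mult)
  have rearrange: "((t1 * r) / s * (\<pi> / G * (2 / n))) * (t2 / k) * (t3 * G / h) = (t1 * 2 * t2 * t3) * \<pi> / (n * h) / k * (r / s)"
    for t1 t2 t3 r s \<pi> n k h :: real using G(1) by (simp add: mult_ac)
  show ?thesis unfolding e1 e2 e3 e4 e6 c_const_def P_def[symmetric] rearrange e5 ..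
qed

section \<open>Conclusion\<close>

text \<open>Outside a small ball around \<open>y\<close> the solution is exponentially small on the ball of integration; inside, the
sandwich bounds apply. In the upper bound a negative argument of \<open>Erf\<close> is replaced by 0, which is allowed as
\<open>u \<le> 1\<close>. In the lower bound the normalization costs the factor \<open>h t = 1 / Erf(b / \<surd>t) - 1\<close>, which is exponentially small.\<close>

lemma heat_content_bounds:
  fixes u :: "(real^'n) \<times> real \<Rightarrow> real" and \<psi> :: "real^'n \<Rightarrow> real"
  assumes p: "1 < p" and N: "2 \<le> CARD('n)" and \<Omega>: "C2_domain \<Omega>" and u: "bounded_solution p \<Omega> u"
    and ch: "chart \<Omega> y r \<kappa> m M \<psi> \<nu>" and \<psi>c: "continuous_on UNIV \<psi>"
    and a1: "0 < a1" "4 * a1\<^sup>2 * M\<^sup>2 * normal_coeff p \<le> 1" and a2: "0 < a2" "1 \<le> 4 * a2\<^sup>2 * m\<^sup>2 * normal_coeff p"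
    and touch: "cball x R \<inter> (UNIV - \<Omega>) = {y}" "y \<notin> ball x R"
    and \<rho>: "0 < \<rho>" "\<rho> \<le> r / 4" and \<beta>: "0 < \<beta>"
    and V: "((\<lambda>s. measure lborel {z \<in> ball x R \<inter> ball y \<rho>. \<psi> z \<le> s} / s powr \<beta>) \<longlongrightarrow> L) (at_right 0)"
    and VK: "\<And>s. 0 < s \<Longrightarrow> measure lborel {z \<in> ball x R \<inter> ball y \<rho>. \<psi> z \<le> s} \<le> K * s powr \<beta>"
  defines "I t \<equiv> t powr (- (\<beta> / 2)) * (LINT z:ball x R|lborel. u (z, t))"
    and "\<Lambda> a \<equiv> L * a powr (- \<beta>) * (Gamma ((\<beta> + 1) / 2) / sqrt pi)"
  shows "\<exists>U. (U \<longlongrightarrow> \<Lambda> a1) (at_right 0) \<and> (\<forall>\<^sub>F t in at_right 0. I t \<le> U t)"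
    "\<exists>U. (U \<longlongrightarrow> \<Lambda> a2) (at_right 0) \<and> (\<forall>\<^sub>F t in at_right 0. U t \<le> I t)"
proof -
  have op: "open \<Omega>" using \<Omega> by (simp add: C2_domain_def)
  note sols = bounded_solution_subsolutions[OF u op]
  note b01 = solution_between_0_1[OF p N \<Omega> u]
  let ?B = "ball x R" and ?S = "ball x R \<inter> ball y \<rho>"
  have in\<Omega>: "z \<in> \<Omega>" if "z \<in> cball x R" "z \<noteq> y" for z
  proof (rule ccontr)
    assume "z \<notin> \<Omega>"
    then have "z \<in> cball x R \<inter> (UNIV - \<Omega>)" using that by simp
    then show False unfolding touch(1) using that by simp
  qed
  have B\<Omega>: "?B \<subseteq> \<Omega>" using in\<Omega> touch(2) by (metis ball_subset_cball subsetD subsetI)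
  have r: "0 < r" and \<Omega>r: "\<Omega> \<inter> ball y r = {z \<in> ball y r. 0 < \<psi> z}" using ch unfolding chart_def by blast+
  have \<psi>pos: "0 < \<psi> z" if "z \<in> ?S" for z
  proof -
    have "z \<in> \<Omega> \<inter> ball y r" using that B\<Omega> \<rho> r by (auto simp: subset_iff)
    then show ?thesis unfolding \<Omega>r by simp
  qed
  have \<psi>m: "\<psi> \<in> borel_measurable borel" using \<psi>c by (rule borel_measurable_continuous_onI)
  obtain D c C b where s: "0 < D" "0 < c" "0 \<le> C" "0 < b" and sandwich: "\<forall>z\<in>\<Omega>. dist z y < r / 4 \<longrightarrow> (\<forall>t>0.
     u (z, t) \<le> 1 - Erf (a1 * ((\<psi> z - C * t) / sqrt t)) + D * exp (- c / t) \<and>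
     1 - Erf (a2 * ((\<psi> z + C * t) / sqrt t)) / Erf (b / sqrt t) \<le> u (z, t))"
    using solution_sandwich[OF p N \<Omega> u ch a1 a2] by (elim exE conjE)
  have Kc: "compact (cball x R - ball y \<rho>)" "cball x R - ball y \<rho> \<subseteq> \<Omega>"
  proof -
    show "compact (cball x R - ball y \<rho>)" by (intro compact_diff) auto
    show "cball x R - ball y \<rho> \<subseteq> \<Omega>" using in\<Omega> \<rho> by (metis DiffE centre_in_ball subsetI)
  qed
  obtain D' c' where D': "0 < D'" "0 < c'" "\<And>z t. z \<in> cball x R - ball y \<rho> \<Longrightarrow> 0 < t \<Longrightarrow> u (z, t) \<le> D' * exp (- c' / t)"
    using compact_decay[OF p N op sols(1) Kc] by blast
  have Sb: "?S \<in> sets borel" "bounded ?S" by (auto intro: bounded_Int)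
  have ball_int: "integrable lborel (indicator ?B :: _ \<Rightarrow> real)"
    by (rule integrable_real_indicator, simp, rule emeasure_bounded_finite, simp)
  have ui: "integrable lborel (\<lambda>z. indicator ?B z * u (z, t))" if t: "0 < t" for t
  proof (rule Bochner_Integration.integrable_bound[OF ball_int])
    have "continuous_on ?B (\<lambda>z. u (z, t))"
      by (rule continuous_on_compose2[OF sols(8)]) (use B\<Omega> t in \<open>auto intro!: continuous_intros\<close>)
    then have "(\<lambda>z. indicator ?B z *\<^sub>R u (z, t)) \<in> borel_measurable borel"
      by (intro borel_measurable_continuous_on_indicator) auto
    then show "(\<lambda>z. indicator ?B z * u (z, t)) \<in> borel_measurable lborel" by simp
    show "AE z in lborel. norm (indicator ?B z * u (z, t)) \<le> norm (indicator ?B z :: real)"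
      using b01[OF subsetD[OF B\<Omega>] t] by (intro AE_I2) (auto simp: indicator_def)
  qed
  define \<phi> where "\<phi> a C t z = a * ((\<psi> z + C * t) / sqrt t)" for a C t z
  have \<phi>m: "\<phi> a C t \<in> borel_measurable borel" for a C t
    unfolding \<phi>_def using \<psi>m by measurable
  define J where "J a C t = (LINT z:?S|lborel. 1 - Erf (max 0 (\<phi> a C t z)))" for a C t
  have Ji: "integrable lborel (\<lambda>z. indicator ?S z * (1 - Erf (max 0 (\<phi> a C t z))))" for a C t
    using Erf_layer_cake(2)[OF Sb \<phi>m] by (simp add: set_integrable_def)
  have Jlim: "((\<lambda>t. t powr (- (\<beta> / 2)) * J a C t) \<longlongrightarrow> \<Lambda> a) (at_right 0)" if "0 < a" for a C
    unfolding J_def \<phi>_def \<Lambda>_def by (rule scaled_profile_integral[OF Sb \<psi>m \<psi>pos \<beta> V VK that])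
  define vol where "vol = measure lborel ?B"
  have vol: "(LINT z|lborel. indicator ?B z * k) = k * vol" for k :: real by (simp add: vol_def)
  show "\<exists>U. (U \<longlongrightarrow> \<Lambda> a1) (at_right 0) \<and> (\<forall>\<^sub>F t in at_right 0. I t \<le> U t)"
  proof (intro exI[of _ "\<lambda>t. t powr (- (\<beta> / 2)) * J a1 (- C) t
        + (t powr (- (\<beta> / 2)) * ((D * vol) * exp (- c / t)) + t powr (- (\<beta> / 2)) * ((D' * vol) * exp (- c' / t)))"] conjI)
    have "((\<lambda>t. t powr (- (\<beta> / 2)) * J a1 (- C) t
        + (t powr (- (\<beta> / 2)) * ((D * vol) * exp (- c / t)) + t powr (- (\<beta> / 2)) * ((D' * vol) * exp (- c' / t)))) \<longlongrightarrow> \<Lambda> a1 + (0 + 0)) (at_right 0)"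
      by (intro tendsto_add Jlim[OF a1(1)] exp_inverse_negligible s D')
    then show "((\<lambda>t. t powr (- (\<beta> / 2)) * J a1 (- C) t
        + (t powr (- (\<beta> / 2)) * ((D * vol) * exp (- c / t)) + t powr (- (\<beta> / 2)) * ((D' * vol) * exp (- c' / t)))) \<longlongrightarrow> \<Lambda> a1) (at_right 0)" by simp
    show "\<forall>\<^sub>F t in at_right 0. I t \<le> t powr (- (\<beta> / 2)) * J a1 (- C) t
        + (t powr (- (\<beta> / 2)) * ((D * vol) * exp (- c / t)) + t powr (- (\<beta> / 2)) * ((D' * vol) * exp (- c' / t)))"
      using eventually_at_right_less[of "0::real"]
    proof eventually_elim
      case (elim t)
      define h where "h = D * exp (- c / t) + D' * exp (- c' / t)"
      have h: "0 \<le> D * exp (- c / t)" "0 \<le> D' * exp (- c' / t)" using s D' by auto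
      have pt: "indicator ?B z * u (z, t) \<le> indicator ?S z * (1 - Erf (max 0 (\<phi> a1 (- C) t z))) + indicator ?B z * h" for z
      proof (cases "z \<in> ?B")
        case zB: True
        then have z\<Omega>: "z \<in> \<Omega>" using B\<Omega> by blast
        show ?thesis
        proof (cases "z \<in> ball y \<rho>")
          case True
          have "u (z, t) \<le> 1 - Erf (max 0 (\<phi> a1 (- C) t z)) + D * exp (- c / t)"
          proof (cases "0 \<le> \<phi> a1 (- C) t z")
            case True
            have "dist z y < r / 4" using \<open>z \<in> ball y \<rho>\<close> \<rho> by (simp add: dist_commute)
            from sandwich[rule_format, OF z\<Omega> this elim] True show ?thesis by (simp add: \<phi>_def)
          next
            case False
            then show ?thesis using b01(2)[OF z\<Omega> elim] h by simp
          qed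
          then show ?thesis using True zB h by (simp add: h_def)
        next
          case False
          then have "u (z, t) \<le> D' * exp (- c' / t)" using zB elim by (intro D'(3)) auto
          then show ?thesis using False zB h by (simp add: h_def)
        qed
      qed simp
      have "(LINT z|lborel. indicator ?B z * u (z, t)) \<le> (LINT z|lborel. indicator ?S z * (1 - Erf (max 0 (\<phi> a1 (- C) t z))) + indicator ?B z * h)"
        by (intro integral_mono ui elim pt Bochner_Integration.integrable_add Ji integrable_mult_left ball_int)
      also have "\<dots> = (LINT z|lborel. indicator ?S z * (1 - Erf (max 0 (\<phi> a1 (- C) t z)))) + (LINT z|lborel. indicator ?B z * h)"
        by (intro Bochner_Integration.integral_add Ji integrable_mult_left ball_int)
      also have "\<dots> = J a1 (- C) t + h * vol" unfolding vol J_def set_lebesgue_integral_def real_scaleR_def ..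
      finally have "t powr (- (\<beta> / 2)) * (LINT z|lborel. indicator ?B z * u (z, t)) \<le> t powr (- (\<beta> / 2)) * (J a1 (- C) t + h * vol)"
        by (intro mult_left_mono) auto
      then show ?case by (simp add: I_def set_lebesgue_integral_def h_def algebra_simps)
    qed
  qed
  define h where "h t = 1 / Erf (b / sqrt t) - 1" for t
  have hlim: "((\<lambda>t. t powr (- (\<beta> / 2)) * (h t * vol)) \<longlongrightarrow> 0) (at_right 0)"
  proof (rule Lim_null_comparison[OF _ exp_inverse_negligible[of "b\<^sup>2" "\<beta> / 2" "2 * vol"]])
    have "\<forall>\<^sub>F t in at_right 0. 1 / 2 < Erf (b / sqrt t)" by (rule order_tendstoD(1)[OF Erf_inverse_sqrt_tendsto_1[OF s(4)]]) simp
    moreover have "\<forall>\<^sub>F t in at_right 0. t \<in> {0<..<b\<^sup>2}" using s(4) by (intro eventually_at_right_real) simp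
    ultimately show "\<forall>\<^sub>F t in at_right 0. norm (t powr (- (\<beta> / 2)) * (h t * vol)) \<le> t powr (- (\<beta> / 2)) * (2 * vol * exp (- b\<^sup>2 / t))"
    proof eventually_elim
      case (elim t)
      then have t: "0 < t" "t < b\<^sup>2" by auto
      have "sqrt t < b" using t s(4) by (metis abs_of_pos real_sqrt_abs real_sqrt_less_mono)
      then have "1 \<le> b / sqrt t" using t by simp
      from Erf_tail[OF this] have E: "1 - Erf (b / sqrt t) \<le> exp (- b\<^sup>2 / t)" using t by (simp add: power_divide)
      have E1: "Erf (b / sqrt t) < 1" by (rule Erf_less_1)
      define e where "e = Erf (b / sqrt t)"
      have e: "1/2 < e" "e < 1" "1 - e \<le> exp (- b\<^sup>2 / t)" using elim(1) E E1 by (auto simp: e_def)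
      have "h t = (1 - e) / e" using e by (simp add: h_def e_def[symmetric] field_simps)
      also have "\<dots> \<le> (1 - e) / (1/2)" using e by (intro divide_left_mono) auto
      finally have "h t \<le> 2 * exp (- b\<^sup>2 / t)" using e by simp
      moreover have "0 \<le> h t" using e by (simp add: h_def e_def[symmetric] field_simps)
      moreover have "0 \<le> vol" by (simp add: vol_def)
      ultimately have hv: "h t * vol \<le> 2 * vol * exp (- b\<^sup>2 / t)" "0 \<le> h t * vol"
        using mult_right_mono[of "h t" "2 * exp (- b\<^sup>2 / t)" vol] by (auto simp: mult_ac)
      have nn: "0 \<le> t powr (- (\<beta> / 2)) * (h t * vol)" using hv(2) by simp
      show ?case unfolding real_norm_def abs_of_nonneg[OF nn] using hv(1) by (intro mult_left_mono) auto
    qed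
  qed (use s(4) in simp)
  show "\<exists>U. (U \<longlongrightarrow> \<Lambda> a2) (at_right 0) \<and> (\<forall>\<^sub>F t in at_right 0. U t \<le> I t)"
  proof (intro exI[of _ "\<lambda>t. t powr (- (\<beta> / 2)) * J a2 C t - t powr (- (\<beta> / 2)) * (h t * vol)"] conjI)
    have "((\<lambda>t. t powr (- (\<beta> / 2)) * J a2 C t - t powr (- (\<beta> / 2)) * (h t * vol)) \<longlongrightarrow> \<Lambda> a2 - 0) (at_right 0)"
      by (intro tendsto_diff Jlim[OF a2(1)] hlim)
    then show "((\<lambda>t. t powr (- (\<beta> / 2)) * J a2 C t - t powr (- (\<beta> / 2)) * (h t * vol)) \<longlongrightarrow> \<Lambda> a2) (at_right 0)" by simp
    show "\<forall>\<^sub>F t in at_right 0. t powr (- (\<beta> / 2)) * J a2 C t - t powr (- (\<beta> / 2)) * (h t * vol) \<le> I t"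
      using eventually_at_right_less[of "0::real"]
    proof eventually_elim
      case (elim t)
      have E: "0 < Erf (b / sqrt t)" "Erf (b / sqrt t) < 1" using s(4) elim by (auto intro!: Erf_pos Erf_less_1)
      have h0: "0 \<le> h t" using E by (simp add: h_def)
      have pt: "indicator ?S z * (1 - Erf (max 0 (\<phi> a2 C t z))) - indicator ?B z * h t \<le> indicator ?B z * u (z, t)" for z
      proof (cases "z \<in> ?B")
        case zB: True
        then have z\<Omega>: "z \<in> \<Omega>" using B\<Omega> by blast
        show ?thesis
        proof (cases "z \<in> ball y \<rho>")
          case True
          have "0 < \<psi> z" using True zB by (intro \<psi>pos) simp
          then have p0: "0 \<le> \<phi> a2 C t z" unfolding \<phi>_def using s(3) elim a2(1) by simp
          have dz: "dist z y < r / 4" using True \<rho> by (simp add: dist_commute)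
          define X where "X = Erf (\<phi> a2 C t z)"
          have X: "0 \<le> X" "X \<le> 1" unfolding X_def using Erf_nonneg[OF p0] Erf_less_1 by (auto simp: less_imp_le)
          have "X * h t \<le> 1 * h t" using X h0 by (intro mult_right_mono) auto
          then have "X / Erf (b / sqrt t) \<le> X + h t" by (simp add: h_def algebra_simps)
          moreover have "1 - X / Erf (b / sqrt t) \<le> u (z, t)" using sandwich[rule_format, OF z\<Omega> dz elim] by (simp add: X_def \<phi>_def)
          ultimately show ?thesis using True zB p0 by (simp add: X_def)
        next
          case False
          then show ?thesis using b01(1)[OF z\<Omega> elim] zB h0 by simp
        qed
      qed simp
      have "J a2 C t - h t * vol = (LINT z|lborel. indicator ?S z * (1 - Erf (max 0 (\<phi> a2 C t z)))) - (LINT z|lborel. indicator ?B z * h t)"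
        unfolding vol J_def set_lebesgue_integral_def real_scaleR_def ..
      also have "\<dots> = (LINT z|lborel. indicator ?S z * (1 - Erf (max 0 (\<phi> a2 C t z))) - indicator ?B z * h t)"
        by (intro Bochner_Integration.integral_diff[symmetric] Ji integrable_mult_left ball_int)
      also have "\<dots> \<le> (LINT z|lborel. indicator ?B z * u (z, t))"
        by (intro integral_mono ui elim pt Bochner_Integration.integrable_diff Ji integrable_mult_left ball_int)
      finally have "t powr (- (\<beta> / 2)) * (J a2 C t - h t * vol) \<le> t powr (- (\<beta> / 2)) * (LINT z|lborel. indicator ?B z * u (z, t))"
        by (intro mult_left_mono) auto
      then show ?case by (simp add: I_def set_lebesgue_integral_def algebra_simps)
    qed
  qed
qed

theorem theorem3p3:
  fixes p :: ereal and \<Omega> :: "(real^'n) set" and x y :: "real^'n" and R :: real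
    and \<kappa> :: "nat \<Rightarrow> real" and u :: "(real^'n) \<times> real \<Rightarrow> real"
  assumes "CARD('n) \<ge> 2"
    and "1 < p"
    and "C2_domain \<Omega>"
    and "x \<in> \<Omega>"
    and "R > 0"
    and "y \<in> frontier \<Omega>"
    and "cball x R \<inter> (UNIV - \<Omega>) = {y}"
    and "principal_curvatures \<Omega> y \<kappa>"
    and "\<forall>j\<in>{1..CARD('n) - 1}. \<kappa> j < 1 / R"
    and "bounded_solution p \<Omega> u"
  shows "((\<lambda>t. t powr (- ((real CARD('n) + 1) / 4)) * (LINT z:ball x R|lborel. u (z, t)))
      \<longlongrightarrow> c_const CARD('n) / conj_exponent p powr ((real CARD('n) + 1) / 4)
        * (R powr ((real CARD('n) - 1) / 2) / sqrt (\<Prod>j=1..CARD('n) - 1. 1 - R * \<kappa> j)))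
      (at_right 0)"
proof -
  note N = assms(1) and p = assms(2) and \<Omega> = assms(3) and R = assms(5) and y = assms(6) and touch = assms(7) and u = assms(10)
  have op: "open \<Omega>" using \<Omega> by (simp add: C2_domain_def)
  have \<kappa>: "\<kappa> j < 1 / R" if "j \<in> {1..CARD('n) - 1}" for j using assms(9) that by blast
  obtain n g e where gr: "C2_graph_near \<Omega> y n g" and G0: "gradient g y = 0"
    and eo: "\<And>i j. i \<in> {1..CARD('n) - 1} \<Longrightarrow> j \<in> {1..CARD('n) - 1} \<Longrightarrow> e i \<bullet> e j = (if i = j then 1 else 0)"
    and en: "\<And>j. j \<in> {1..CARD('n) - 1} \<Longrightarrow> e j \<bullet> n = 0"
    and ek: "\<And>j. j \<in> {1..CARD('n) - 1} \<Longrightarrow> hessian g y *v e j = \<kappa> j *\<^sub>R e j"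
    using assms(8) unfolding principal_curvatures_def by blast
  have nn: "norm n = 1" and C2: "C2_on UNIV g" using gr unfolding C2_graph_near_def by auto
  have gy: "y \<bullet> n = g y" by (rule graph_boundary_height[OF gr op y])
  have x: "x = y + R *\<^sub>R n" by (rule touching_ball_center[OF gr op y G0 R touch])
  have yB: "y \<notin> ball x R" using R nn by (simp add: x dist_norm)
  define \<beta> where "\<beta> = (real CARD('n) + 1) / 2"
  have \<beta>: "0 < \<beta>" by (simp add: \<beta>_def)
  define \<psi> where "\<psi> z = z \<bullet> n - g z" for z
  define L where "L = (\<Prod>j=1..CARD('n) - 1. sqrt (2 / (1 / R - \<kappa> j))) * paraboloid_volume (CARD('n) - 1)"
  define \<Lambda> where "\<Lambda> a = L * a powr (- \<beta>) * (Gamma ((\<beta> + 1) / 2) / sqrt pi)" for a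
  obtain \<delta> where \<delta>: "0 < \<delta>" "\<And>\<rho>. 0 < \<rho> \<Longrightarrow> \<rho> \<le> \<delta> \<Longrightarrow>
     ((\<lambda>s. measure lborel {z. z \<in> ball (y + R *\<^sub>R n) R \<and> dist z y < \<rho> \<and> z \<bullet> n - g z \<le> s} / s powr \<beta>) \<longlongrightarrow> L) (at_right 0) \<and>
     (\<exists>C. \<forall>s>0. measure lborel {z. z \<in> ball (y + R *\<^sub>R n) R \<and> dist z y < \<rho> \<and> z \<bullet> n - g z \<le> s} \<le> C * s powr \<beta>)"
    using boundary_cap_volume[OF N gr G0 gy eo en ek R \<kappa>] unfolding \<beta>_def L_def by blast
  have \<psi>c: "continuous_on UNIV \<psi>"
  proof -
    have "continuous_on UNIV g"
      by (rule has_derivative_continuous_on[OF has_derivative_at_withinI]) (rule graph_gradient[OF C2, unfolded gderiv_def])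
    then show ?thesis unfolding \<psi>_def by (intro continuous_intros)
  qed
  define q where "q = normal_coeff p"
  have q: "0 < q" unfolding q_def using normal_coeff_bounds[OF p] by simp
  \<comment> \<open>the critical coefficient, where the conditions of the two barriers meet for unit gradient\<close>
  define a0 where "a0 = 1 / (2 * sqrt q)"
  have a0: "0 < a0" using q by (simp add: a0_def)
  have a0sq: "4 * (a0)\<^sup>2 * q = 1" using q by (simp add: a0_def power_divide power_mult_distrib)
  define I where "I t = t powr (- (\<beta> / 2)) * (LINT z:ball x R|lborel. u (z, t))" for t
  have bounds: "(\<exists>U. (U \<longlongrightarrow> \<Lambda> (a0 / (1 + \<eta>))) (at_right 0) \<and> (\<forall>\<^sub>F t in at_right 0. I t \<le> U t)) \<and>
      (\<exists>U. (U \<longlongrightarrow> \<Lambda> (a0 / (1 - \<eta>))) (at_right 0) \<and> (\<forall>\<^sub>F t in at_right 0. U t \<le> I t))"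
    if \<eta>: "0 < \<eta>" "\<eta> < 1" for \<eta>
  proof -
    obtain r \<kappa>' where ch: "chart \<Omega> y r \<kappa>' (1 - \<eta>) (1 + \<eta>) \<psi> (\<lambda>z. n - gradient g z)"
      using graph_chart[OF gr, of \<eta>] \<eta> G0 nn unfolding \<psi>_def by auto
    have r: "0 < r" using ch unfolding chart_def by blast
    define \<rho> where "\<rho> = min \<delta> (r / 4)"
    have \<rho>: "0 < \<rho>" "\<rho> \<le> \<delta>" "\<rho> \<le> r / 4" using r \<delta>(1) by (auto simp: \<rho>_def)
    have set: "{z. z \<in> ball (y + R *\<^sub>R n) R \<and> dist z y < \<rho> \<and> z \<bullet> n - g z \<le> s} = {z \<in> ball x R \<inter> ball y \<rho>. \<psi> z \<le> s}" for s
      by (auto simp: x \<psi>_def dist_commute)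
    note cap = \<delta>(2)[OF \<rho>(1,2), unfolded set]
    obtain K where K: "\<And>s. 0 < s \<Longrightarrow> measure lborel {z \<in> ball x R \<inter> ball y \<rho>. \<psi> z \<le> s} \<le> K * s powr \<beta>" using cap by blast
    have a1: "0 < a0 / (1 + \<eta>)" "4 * (a0 / (1 + \<eta>))\<^sup>2 * (1 + \<eta>)\<^sup>2 * normal_coeff p \<le> 1"
      using a0 \<eta> a0sq by (simp_all add: power_divide q_def)
    have a2: "0 < a0 / (1 - \<eta>)" "1 \<le> 4 * (a0 / (1 - \<eta>))\<^sup>2 * (1 - \<eta>)\<^sup>2 * normal_coeff p"
      using a0 \<eta> a0sq by (simp_all add: power_divide q_def)
    note hb = heat_content_bounds[OF p N \<Omega> u ch \<psi>c a1 a2 touch yB \<rho>(1,3) \<beta> conjunct1[OF cap] K]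
    show ?thesis using hb unfolding I_def \<Lambda>_def by blast
  qed
  have \<Lambda>lim: "((\<lambda>\<eta>. \<Lambda> (a0 / (1 + \<eta>))) \<longlongrightarrow> \<Lambda> a0) (at_right 0)" "((\<lambda>\<eta>. \<Lambda> (a0 / (1 - \<eta>))) \<longlongrightarrow> \<Lambda> a0) (at_right 0)"
  proof -
    have "((\<lambda>\<eta>. \<Lambda> (a0 / (1 + \<eta>))) \<longlongrightarrow> \<Lambda> (a0 / (1 + 0))) (at_right 0)" "((\<lambda>\<eta>. \<Lambda> (a0 / (1 - \<eta>))) \<longlongrightarrow> \<Lambda> (a0 / (1 - 0))) (at_right 0)"
      unfolding \<Lambda>_def using a0 by (intro tendsto_intros; simp)+
    then show "((\<lambda>\<eta>. \<Lambda> (a0 / (1 + \<eta>))) \<longlongrightarrow> \<Lambda> a0) (at_right 0)" "((\<lambda>\<eta>. \<Lambda> (a0 / (1 - \<eta>))) \<longlongrightarrow> \<Lambda> a0) (at_right 0)" by simp_all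
  qed
  have small: "\<forall>\<^sub>F \<eta> in at_right 0. \<eta> \<in> {0<..<1::real}" by (rule eventually_at_right_real) simp
  have "(I \<longlongrightarrow> \<Lambda> a0) (at_right 0)"
  proof (rule order_tendstoI)
    fix l assume "l < \<Lambda> a0"
    from eventually_happens[OF eventually_conj[OF small order_tendstoD(1)[OF \<Lambda>lim(2) this]]]
    obtain \<eta> where \<eta>: "0 < \<eta>" "\<eta> < 1" "l < \<Lambda> (a0 / (1 - \<eta>))" by (auto simp: trivial_limit_at_right_real)
    obtain U where U: "(U \<longlongrightarrow> \<Lambda> (a0 / (1 - \<eta>))) (at_right 0)" "\<forall>\<^sub>F t in at_right 0. U t \<le> I t" using bounds[OF \<eta>(1,2)] by blast
    from order_tendstoD(1)[OF U(1) \<eta>(3)] U(2) show "\<forall>\<^sub>F t in at_right 0. l < I t" by eventually_elim simp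
  next
    fix l assume "\<Lambda> a0 < l"
    from eventually_happens[OF eventually_conj[OF small order_tendstoD(2)[OF \<Lambda>lim(1) this]]]
    obtain \<eta> where \<eta>: "0 < \<eta>" "\<eta> < 1" "\<Lambda> (a0 / (1 + \<eta>)) < l" by (auto simp: trivial_limit_at_right_real)
    obtain U where U: "(U \<longlongrightarrow> \<Lambda> (a0 / (1 + \<eta>))) (at_right 0)" "\<forall>\<^sub>F t in at_right 0. I t \<le> U t" using bounds[OF \<eta>(1,2)] by blast
    from order_tendstoD(2)[OF U(1) \<eta>(3)] U(2) show "\<forall>\<^sub>F t in at_right 0. I t < l" by eventually_elim simp
  qed
  moreover have "\<Lambda> a0 = c_const CARD('n) / conj_exponent p powr ((real CARD('n) + 1) / 4)
        * (R powr ((real CARD('n) - 1) / 2) / sqrt (\<Prod>j=1..CARD('n) - 1. 1 - R * \<kappa> j))"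
    unfolding \<Lambda>_def L_def a0_def q_def \<beta>_def by (rule limit_constant[OF N p R \<kappa>])
  moreover have "\<beta> / 2 = (real CARD('n) + 1) / 4" by (simp add: \<beta>_def)
  ultimately show ?thesis unfolding I_def[abs_def] by (simp only:)
qed

end
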